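(* Let $m\ge 2$, let $x:\Sigma^{m}\to\mathbb{R}^{m+1}$ be a self-expander of the mean curvature flow, and let $f=-|x|^2/2$. Then: (a) the following $f$-Poincaré inequality holds: \[ m\int_\Sigma \varphi^2 e^{-f}d\mathrm{vol}_{\Sigma}\leq \int_\Sigma (m+H^2) \varphi^2 e^{-f}d\mathrm{vol}_{\Sigma}\leq \int_\Sigma |\nabla \varphi|^2 e^{-f}d\mathrm{vol}_{\Sigma} \] for any $\varphi\in C^{\infty}_c(\Sigma)$; (b) if $x$ is a proper immersion, then every end of $\Sigma$ has infinite $f$-volume.
   Context: A self-expander of the mean curvature flow is an isometrically immersed complete (orientable) hypersurface $x:\Sigma^m\to\mathbb{R}^{m+1}$ whose mean curvature vector field satisfies $\mathbf{H}=x^{\perp}$, where $(\cdot)^\perp$ is the projection on the normal bundle of $\Sigma$. Here $\mathbf{H}$ is the trace (not the average) of the second fundamental form and $H$ is the scalar mean curvature, so that $H^2=|\mathbf{H}|^2$. $\nabla$ and $d\mathrm{vol}_\Sigma$ are the gradient and the Riemannian measure of the induced metric. The $f$-volume of $E\subseteq\Sigma$ is $\mathrm{vol}_f(E)=\int_E e^{-f}d\mathrm{vol}_\Sigma$. An end of $\Sigma$ (with respect to a compact set $K\subset\Sigma$) is an unbounded connected component of $\Sigma\setminus K$. *)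

theory Defs
  imports "HOL-Analysis.Analysis"
begin

section \<open>Smooth manifolds modelled on \<open>real^'m\<close>\<close>

text \<open>
  The manifold is a whole type \<open>'a\<close> that is Hausdorff and second countable; its smooth structure is
  the one generated by an atlas, a set of charts.  A chart is a pair of a domain and a coordinate
  map; the values of the coordinate map outside the domain are irrelevant.  The manifold is not
  required to be connected.
\<close>

type_synonym ('a, 'm) chart = "'a set \<times> ('a \<Rightarrow> real^'m)"

abbreviation chart_param :: "('a, 'm::finite) chart \<Rightarrow> real^'m \<Rightarrow> 'a" where
  "chart_param c \<equiv> inv_into (fst c) (snd c)"

primrec Ck_on :: "nat \<Rightarrow> 'v::real_normed_vector set \<Rightarrow> ('v \<Rightarrow> 'w::real_normed_vector) \<Rightarrow> bool" where
  "Ck_on 0 S h \<longleftrightarrow> continuous_on S h"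
| "Ck_on (Suc k) S h \<longleftrightarrow>
     (\<forall>u\<in>S. h differentiable (at u)) \<and> (\<forall>v. Ck_on k S (\<lambda>u. frechet_derivative h (at u) v))"

text \<open>Only used for open sets \<open>S\<close>.\<close>

definition smooth_on :: "'v::real_normed_vector set \<Rightarrow> ('v \<Rightarrow> 'w::real_normed_vector) \<Rightarrow> bool" where
  "smooth_on S h \<longleftrightarrow> (\<forall>k. Ck_on k S h)"

definition is_chart :: "('a::topological_space, 'm::finite) chart \<Rightarrow> bool" where
  "is_chart c \<longleftrightarrow> open (fst c) \<and> open (snd c ` fst c) \<and>
     homeomorphism (fst c) (snd c ` fst c) (snd c) (chart_param c)"

definition smooth_atlas :: "('a::topological_space, 'm::finite) chart set \<Rightarrow> bool" where
  "smooth_atlas \<A> \<longleftrightarrow> (\<forall>c\<in>\<A>. is_chart c) \<and> (\<Union>c\<in>\<A>. fst c) = UNIV \<and>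
     (\<forall>c\<in>\<A>. \<forall>d\<in>\<A>. smooth_on (snd c ` (fst c \<inter> fst d)) (snd d \<circ> chart_param c))"

text \<open>The smooth structure generated by \<open>\<A>\<close> admits an oriented atlas.\<close>

definition orientable :: "('a::topological_space, 'm::finite) chart set \<Rightarrow> bool" where
  "orientable \<A> \<longleftrightarrow> (\<exists>\<B>. smooth_atlas \<B> \<and> smooth_atlas (\<A> \<union> \<B>) \<and>
     (\<forall>c\<in>\<B>. \<forall>d\<in>\<B>. \<forall>u \<in> snd c ` (fst c \<inter> fst d).
        det (jacobian (snd d \<circ> chart_param c) (at u)) > 0))"

definition smooth_map ::
  "('a::topological_space, 'm::finite) chart set \<Rightarrow> ('a \<Rightarrow> 'w::real_normed_vector) \<Rightarrow> bool" where
  "smooth_map \<A> h \<longleftrightarrow> (\<forall>c\<in>\<A>. smooth_on (snd c ` fst c) (h \<circ> chart_param c))"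

definition test_function ::
  "('a::topological_space, 'm::finite) chart set \<Rightarrow> ('a \<Rightarrow> real) \<Rightarrow> bool" where
  "test_function \<A> \<phi> \<longleftrightarrow> smooth_map \<A> \<phi> \<and> compact (closure {p. \<phi> p \<noteq> 0})"

text \<open>
  An arbitrary chart around \<open>p\<close>.  The geometric objects below that are computed in this chart do
  not depend on the choice.
\<close>

definition chart_at :: "('a::topological_space, 'm::finite) chart set \<Rightarrow> 'a \<Rightarrow> ('a, 'm) chart" where
  "chart_at \<A> p = (SOME c. c \<in> \<A> \<and> p \<in> fst c)"

definition differential_in ::
  "('a, 'm::finite) chart \<Rightarrow> ('a \<Rightarrow> 'w::real_normed_vector) \<Rightarrow> real^'m \<Rightarrow> real^'m \<Rightarrow> 'w" where
  "differential_in c h u = frechet_derivative (h \<circ> chart_param c) (at u)"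


section \<open>Immersed hypersurfaces with the induced metric\<close>

definition immersion ::
  "('a::topological_space, 'm::finite) chart set \<Rightarrow> ('a \<Rightarrow> real^'n::finite) \<Rightarrow> bool" where
  "immersion \<A> x \<longleftrightarrow> smooth_map \<A> x \<and>
     (\<forall>c\<in>\<A>. \<forall>u \<in> snd c ` fst c. inj (differential_in c x u))"

text \<open>The image of the tangent space at \<open>p\<close> under the differential of \<open>x\<close>.\<close>

definition tangent_space ::
  "('a::topological_space, 'm::finite) chart set \<Rightarrow> ('a \<Rightarrow> real^'n::finite) \<Rightarrow> 'a \<Rightarrow> (real^'n) set" where
  "tangent_space \<A> x p = range (differential_in (chart_at \<A> p) x (snd (chart_at \<A> p) p))"

definition normal_proj ::
  "('a::topological_space, 'm::finite) chart set \<Rightarrow> ('a \<Rightarrow> real^'n::finite) \<Rightarrow> 'a \<Rightarrow> real^'n \<Rightarrow> real^'n" where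
  "normal_proj \<A> x p w =
     (THE n. n \<in> orthogonal_comp (tangent_space \<A> x p) \<and> w - n \<in> tangent_space \<A> x p)"

text \<open>The matrix of the induced metric in the coordinate frame of a chart.\<close>

definition metric_matrix ::
  "('a, 'm::finite) chart \<Rightarrow> ('a \<Rightarrow> real^'n::finite) \<Rightarrow> real^'m \<Rightarrow> real^'m^'m" where
  "metric_matrix c x u =
     (\<chi> i j. differential_in c x u (axis i 1) \<bullet> differential_in c x u (axis j 1))"

text \<open>
  The second fundamental form at \<open>p\<close> on the coordinate vectors with indices \<open>i\<close>, \<open>j\<close>: the normal
  part of the second partial derivative of the position vector.
\<close>

definition second_fundamental_form ::
  "('a::topological_space, 'm::finite) chart set \<Rightarrow> ('a \<Rightarrow> real^'n::finite) \<Rightarrow> 'a \<Rightarrow> 'm \<Rightarrow> 'm \<Rightarrow> real^'n"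
where
  "second_fundamental_form \<A> x p i j = (let c = chart_at \<A> p in
     normal_proj \<A> x p
       (frechet_derivative (\<lambda>u. differential_in c x u (axis j 1)) (at (snd c p)) (axis i 1)))"

text \<open>The trace (not the average) of the second fundamental form with respect to the metric.\<close>

definition mean_curvature_vector ::
  "('a::topological_space, 'm::finite) chart set \<Rightarrow> ('a \<Rightarrow> real^'n::finite) \<Rightarrow> 'a \<Rightarrow> real^'n" where
  "mean_curvature_vector \<A> x p = (let c = chart_at \<A> p in
     (\<Sum>i\<in>UNIV. \<Sum>j\<in>UNIV.
        matrix_inv (metric_matrix c x (snd c p)) $ i $ j *\<^sub>R second_fundamental_form \<A> x p i j))"

text \<open>
  A choice of unit normals.  Continuity is not demanded: only the square of the scalar mean
  curvature is used below, and changing the sign of the normal does not affect it.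
\<close>

definition unit_normal ::
  "('a::topological_space, 'm::finite) chart set \<Rightarrow> ('a \<Rightarrow> real^'n::finite) \<Rightarrow> ('a \<Rightarrow> real^'n) \<Rightarrow> bool"
where
  "unit_normal \<A> x \<nu> \<longleftrightarrow>
     (\<forall>p. norm (\<nu> p) = 1 \<and> \<nu> p \<in> orthogonal_comp (tangent_space \<A> x p))"

definition scalar_mean_curvature ::
  "('a::topological_space, 'm::finite) chart set \<Rightarrow> ('a \<Rightarrow> real^'n::finite) \<Rightarrow> ('a \<Rightarrow> real^'n) \<Rightarrow> 'a \<Rightarrow> real"
where
  "scalar_mean_curvature \<A> x \<nu> p = mean_curvature_vector \<A> x p \<bullet> \<nu> p"

text \<open>
  The gradient with respect to the induced metric, identified with a vector of the ambient space
  through the differential of \<open>x\<close>.  This identification is isometric, so that the norm of the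
  gradient is the Euclidean one.
\<close>

definition gradient ::
  "('a::topological_space, 'm::finite) chart set \<Rightarrow> ('a \<Rightarrow> real^'n::finite) \<Rightarrow> ('a \<Rightarrow> real) \<Rightarrow> 'a \<Rightarrow> real^'n"
where
  "gradient \<A> x h p = (let c = chart_at \<A> p in
     THE w. w \<in> tangent_space \<A> x p \<and>
       (\<forall>v. w \<bullet> differential_in c x (snd c p) v = differential_in c h (snd c p) v))"

text \<open>
  The Riemannian measure is the unique Borel measure that has density \<open>sqrt (det g)\<close> with respect to
  Lebesgue measure in every chart.
\<close>

definition riemannian_measure ::
  "('a::topological_space, 'm::finite) chart set \<Rightarrow> ('a \<Rightarrow> real^'n::finite) \<Rightarrow> 'a measure" where
  "riemannian_measure \<A> x = (THE \<mu>. sets \<mu> = sets borel \<and>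
     (\<forall>c\<in>\<A>. \<forall>B\<in>sets borel. B \<subseteq> fst c \<longrightarrow>
        emeasure \<mu> B = (\<integral>\<^sup>+ u \<in> snd c ` B. ennreal (sqrt (det (metric_matrix c x u))) \<partial>lborel)))"


section \<open>Riemannian distance and completeness\<close>

definition piecewise_C1_curve ::
  "('a::topological_space, 'm::finite) chart set \<Rightarrow> (real \<Rightarrow> 'a) \<Rightarrow> bool" where
  "piecewise_C1_curve \<A> \<gamma> \<longleftrightarrow> path \<gamma> \<and>
     (\<exists>T. finite T \<and>
        (\<forall>c\<in>\<A>. (snd c \<circ> \<gamma>) C1_differentiable_on ({t\<in>{0..1}. \<gamma> t \<in> fst c} - T)))"

text \<open>The speed of a curve in the induced metric is the Euclidean speed of its image under \<open>x\<close>.\<close>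

definition curve_length :: "('a \<Rightarrow> real^'n::finite) \<Rightarrow> (real \<Rightarrow> 'a) \<Rightarrow> ennreal" where
  "curve_length x \<gamma> =
     (\<integral>\<^sup>+ t \<in> {0..1}. ennreal (norm (vector_derivative (x \<circ> \<gamma>) (at t))) \<partial>lborel)"

text \<open>The distance between points of different components is infinite.\<close>

definition riemannian_dist ::
  "('a::topological_space, 'm::finite) chart set \<Rightarrow> ('a \<Rightarrow> real^'n::finite) \<Rightarrow> 'a \<Rightarrow> 'a \<Rightarrow> ennreal" where
  "riemannian_dist \<A> x p q =
     Inf {curve_length x \<gamma> | \<gamma>. piecewise_C1_curve \<A> \<gamma> \<and> pathstart \<gamma> = p \<and> pathfinish \<gamma> = q}"

definition riemannian_complete ::
  "('a::topological_space, 'm::finite) chart set \<Rightarrow> ('a \<Rightarrow> real^'n::finite) \<Rightarrow> bool" where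
  "riemannian_complete \<A> x \<longleftrightarrow>
     (\<forall>s :: nat \<Rightarrow> 'a. (\<forall>\<epsilon>>0. \<exists>N. \<forall>k\<ge>N. \<forall>l\<ge>N. riemannian_dist \<A> x (s k) (s l) < ennreal \<epsilon>) \<longrightarrow>
        (\<exists>p. (\<lambda>k. riemannian_dist \<A> x (s k) p) \<longlonglongrightarrow> 0))"

definition riemannian_unbounded ::
  "('a::topological_space, 'm::finite) chart set \<Rightarrow> ('a \<Rightarrow> real^'n::finite) \<Rightarrow> 'a set \<Rightarrow> bool" where
  "riemannian_unbounded \<A> x E \<longleftrightarrow> (\<forall>C::real. \<exists>p\<in>E. \<exists>q\<in>E. riemannian_dist \<A> x p q > ennreal C)"

definition is_end ::
  "('a::topological_space, 'm::finite) chart set \<Rightarrow> ('a \<Rightarrow> real^'n::finite) \<Rightarrow> 'a set \<Rightarrow> 'a set \<Rightarrow> bool"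
where
  "is_end \<A> x K E \<longleftrightarrow> compact K \<and> E \<in> components (- K) \<and> riemannian_unbounded \<A> x E"


section \<open>Self-expanders and weighted volume\<close>

definition self_expander ::
  "('a::{t2_space, second_countable_topology}, 'm::finite) chart set \<Rightarrow> ('a \<Rightarrow> real^'n::finite) \<Rightarrow> bool"
where
  "self_expander \<A> x \<longleftrightarrow> CARD('n) = CARD('m) + 1 \<and>
     smooth_atlas \<A> \<and> orientable \<A> \<and> immersion \<A> x \<and> riemannian_complete \<A> x \<and>
     (\<forall>p. mean_curvature_vector \<A> x p = normal_proj \<A> x p (x p))"

definition f_volume ::
  "('a::topological_space, 'm::finite) chart set \<Rightarrow> ('a \<Rightarrow> real^'n::finite) \<Rightarrow> ('a \<Rightarrow> real) \<Rightarrow> 'a set \<Rightarrow> ennreal"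
where
  "f_volume \<A> x f E = (\<integral>\<^sup>+ p \<in> E. ennreal (exp (- f p)) \<partial>riemannian_measure \<A> x)"

text \<open>In the literature a proper map is one under which compact sets have compact preimages.\<close>

definition compact_preimages :: "('a::topological_space \<Rightarrow> 'w::topological_space) \<Rightarrow> bool" where
  "compact_preimages x \<longleftrightarrow> (\<forall>C. compact C \<longrightarrow> compact (x -` C))"

end

theory Submission
  imports Defs
begin

text \<open>
  Let \<open>r = |x|\<^sup>2 / 2\<close>, so that the weight is \<open>exp r\<close>, and split the position vector into its
  tangential part \<open>X\<close> and its normal part \<open>N\<close>.  Then \<open>X\<close> is the gradient of \<open>r\<close>.  Its divergence is
  the trace of the differential of \<open>x - N\<close>: the differential of \<open>x\<close> has trace \<open>m\<close>, and the normal
  field \<open>N\<close> contributes \<open>H \<bullet> N\<close>, because differentiating \<open>N \<bullet> e\<^sub>j = 0\<close> along the coordinate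
  vectors \<open>e\<^sub>j\<close> moves the derivative to \<open>e\<^sub>j\<close>.  For a self-expander \<open>H = N\<close>, so the divergence is
  \<open>m + |N|\<^sup>2 = m + H\<^sup>2\<close>.  Everything follows from the resulting identity (\<open>first_variation\<close>)

    \<open>\<integral> (m + H\<^sup>2) g + \<nabla>g \<bullet> X = 0\<close>   for all \<open>g\<close> of class C1 with compact support.

  For the Poincare inequality take \<open>g = \<phi>\<^sup>2 exp r\<close>: the second summand is
  \<open>(2 \<phi> \<nabla>\<phi> \<bullet> X + \<phi>\<^sup>2 |X|\<^sup>2) exp r\<close>, which is at least \<open>- |\<nabla>\<phi>|\<^sup>2 exp r\<close> by completing the
  square.

  For an end \<open>E\<close> of a properly immersed hypersurface take for \<open>g\<close> a function of \<open>r\<close> on \<open>E\<close>, and zero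
  outside: it rises from 0 to 1 beyond the values of \<open>r\<close> on the boundary of \<open>E\<close> and falls back to 0
  between \<open>T\<close> and \<open>2 T\<close>.  There its slope is of order \<open>1 / T\<close> and \<open>|X|\<^sup>2 \<le> 2 r\<close> is of order \<open>T\<close>, so
  that the identity bounds the volume of a fixed piece of \<open>E\<close> by a constant times the volume of
  \<open>E \<inter> {r \<ge> T}\<close>, and this by \<open>exp (- T)\<close> times the weighted volume of \<open>E\<close>.  If the latter were
  finite, \<open>T \<rightarrow> \<infinity>\<close> would show that a nonempty open set has volume zero.  The fixed piece exists because
  \<open>r\<close> is unbounded on \<open>E\<close>: otherwise \<open>E\<close> would be relatively compact, and a relatively compact
  connected set has bounded intrinsic diameter.

  The identity itself is a statement in charts.  With the metric matrix \<open>G\<close> and the coordinates \<open>a\<close>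
  of \<open>X\<close>, Jacobi's formula for the determinant and the symmetry of second derivatives turn the
  integrand, multiplied by the density \<open>\<surd> det G\<close>, into the divergence of \<open>\<surd> det G g a\<close>, a field of
  class C1 with compact support in \<open>real^'m\<close>.  The integral of a partial derivative of such a function
  vanishes by translation invariance.  The mean curvature at a point is computed in one chosen chart;
  since the trace of the differential of \<open>X\<close> is the same in all charts by the first-order chain rule,
  a transformation law for second derivatives can be bypassed.  That the Riemannian measure exists,
  and hence that integrals against it may be computed in charts, is the change of variables formula
  for transition maps.
\<close>


section \<open>Functions of class C1\<close>

abbreviation fderiv :: "('v::real_normed_vector \<Rightarrow> 'w::real_normed_vector) \<Rightarrow> 'v \<Rightarrow> 'v \<Rightarrow> 'w" where
  "fderiv h u \<equiv> frechet_derivative h (at u)"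

abbreviation C1_on :: "'v::real_normed_vector set \<Rightarrow> ('v \<Rightarrow> 'w::real_normed_vector) \<Rightarrow> bool" where
  "C1_on \<equiv> Ck_on (Suc 0)"

lemma C1_onI:
  assumes "\<And>u. u \<in> S \<Longrightarrow> (h has_derivative h' u) (at u)"
    and "\<And>v. continuous_on S (\<lambda>u. h' u v)"
  shows "C1_on S h"
proof -
  have "fderiv h u = h' u" if "u \<in> S" for u
    using assms(1)[OF that] by (metis frechet_derivative_at)
  moreover have "h differentiable (at u)" if "u \<in> S" for u
    using assms(1)[OF that] by (rule differentiableI)
  ultimately show ?thesis
    using assms(2) by (auto cong: continuous_on_cong)
qed

lemma C1_on_derivative:
  assumes "C1_on S h" "u \<in> S"
  shows "(h has_derivative fderiv h u) (at u)"
  using assms by (auto simp: frechet_derivative_works[symmetric])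

lemma C1_on_continuous_derivative:
  "C1_on S h \<Longrightarrow> continuous_on S (\<lambda>u. fderiv h u v)"
  by simp

lemma C1_on_imp_continuous_on: "C1_on S h \<Longrightarrow> continuous_on S h"
  by (rule continuous_at_imp_continuous_on)
    (auto intro: differentiable_imp_continuous_within)

lemma C1_on_subset: "C1_on S h \<Longrightarrow> T \<subseteq> S \<Longrightarrow> C1_on T h"
  by (auto intro: continuous_on_subset)

declare Ck_on.simps(2) [simp del]

lemma C1_on_cong:
  assumes "open S" "C1_on S h" "\<And>u. u \<in> S \<Longrightarrow> h u = k u"
  shows "C1_on S k"
proof (rule C1_onI)
  fix u assume u: "u \<in> S"
  show "(k has_derivative fderiv h u) (at u)"
    by (rule has_derivative_transform_within_open[OF C1_on_derivative[OF assms(2) u] assms(1) u assms(3)])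
qed (rule C1_on_continuous_derivative[OF assms(2)])

lemma C1_on_local:
  assumes "\<And>u. u \<in> S \<Longrightarrow> \<exists>T. open T \<and> u \<in> T \<and> C1_on T h"
  shows "C1_on S h"
proof (rule C1_onI)
  fix u assume "u \<in> S"
  then show "(h has_derivative fderiv h u) (at u)"
    using assms C1_on_derivative by metis
next
  fix v
  have "isCont (\<lambda>u. fderiv h u v) u" if "u \<in> S" for u
    using assms[OF that] by (metis C1_on_continuous_derivative continuous_on_eq_continuous_at)
  then show "continuous_on S (\<lambda>u. fderiv h u v)"
    by (simp add: continuous_at_imp_continuous_on)
qed

lemma C1_on_const: "C1_on S (\<lambda>_. c)"
  by (rule C1_onI[where h' = "\<lambda>_ _. 0"]) auto

lemma C1_on_linear: "bounded_linear h \<Longrightarrow> C1_on S h"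
  by (rule C1_onI[where h' = "\<lambda>_. h"]) (auto intro: bounded_linear_imp_has_derivative)

lemma C1_on_bilinear:
  assumes "bounded_bilinear B" and f: "C1_on S f" and g: "C1_on S g"
  shows "C1_on S (\<lambda>u. B (f u) (g u))"
proof -
  interpret bounded_bilinear B by fact
  show ?thesis
  proof (rule C1_onI)
    fix u assume "u \<in> S"
    then show "((\<lambda>u. B (f u) (g u)) has_derivative
      (\<lambda>v. B (f u) (fderiv g u v) + B (fderiv f u v) (g u))) (at u)"
      by (intro FDERIV C1_on_derivative[OF f] C1_on_derivative[OF g])
  next
    fix v show "continuous_on S (\<lambda>u. B (f u) (fderiv g u v)
        + B (fderiv f u v) (g u))"
      by (intro continuous_on_add continuous_on C1_on_imp_continuous_on[OF f]
          C1_on_imp_continuous_on[OF g] C1_on_continuous_derivative f g)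
  qed
qed

lemmas C1_on_mult = C1_on_bilinear[OF bounded_bilinear_mult]
lemmas C1_on_scaleR = C1_on_bilinear[OF bounded_bilinear_scaleR]
lemmas C1_on_inner = C1_on_bilinear[OF bounded_bilinear_inner]

lemma C1_on_add:
  assumes "C1_on S f" "C1_on S g"
  shows "C1_on S (\<lambda>u. f u + g u)"
  by (rule C1_onI[where h' = "\<lambda>u v. fderiv f u v + fderiv g u v"])
    (auto intro!: has_derivative_add C1_on_derivative C1_on_continuous_derivative continuous_intros assms)

lemma C1_on_diff:
  assumes "C1_on S f" "C1_on S g"
  shows "C1_on S (\<lambda>u. f u - g u)"
  by (rule C1_onI[where h' = "\<lambda>u v. fderiv f u v - fderiv g u v"])
    (auto intro!: has_derivative_diff C1_on_derivative C1_on_continuous_derivative continuous_intros assms)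

lemma C1_on_sum:
  "(\<And>i. i \<in> I \<Longrightarrow> C1_on S (f i)) \<Longrightarrow> C1_on S (\<lambda>u. \<Sum>i\<in>I. f i u)"
proof (induction I rule: infinite_finite_induct)
  case (insert i I)
  then show ?case
    unfolding sum.insert[OF insert.hyps] by (intro C1_on_add) blast+
qed (simp_all only: sum.infinite sum.empty C1_on_const not_False_eq_True)

lemma C1_on_prod:
  fixes f :: "'i \<Rightarrow> 'v::real_normed_vector \<Rightarrow> real"
  shows "(\<And>i. i \<in> I \<Longrightarrow> C1_on S (f i)) \<Longrightarrow> C1_on S (\<lambda>u. \<Prod>i\<in>I. f i u)"
proof (induction I rule: infinite_finite_induct)
  case (insert i I)
  then show ?case
    unfolding prod.insert[OF insert.hyps] by (intro C1_on_mult) blast+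
qed (simp_all only: prod.infinite prod.empty C1_on_const not_False_eq_True)

lemma C1_on_comp:
  fixes g :: "'v::real_normed_vector \<Rightarrow> 'e::euclidean_space" and h :: "'e \<Rightarrow> 'w::real_normed_vector"
  assumes h: "C1_on T h" and g: "C1_on S g" and sub: "g ` S \<subseteq> T"
  shows "C1_on S (\<lambda>u. h (g u))"
proof (rule C1_onI)
  fix u assume u: "u \<in> S"
  then have "g u \<in> T" using sub by auto
  then show "((\<lambda>u. h (g u)) has_derivative
     (\<lambda>v. fderiv h (g u) (fderiv g u v))) (at u)"
    by (intro has_derivative_compose[OF C1_on_derivative[OF g u]] C1_on_derivative[OF h])
next
  fix v
  have "continuous_on S (\<lambda>u. \<Sum>b\<in>Basis. (fderiv g u v \<bullet> b) *\<^sub>R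
      fderiv h (g u) b)"
    by (intro continuous_on_sum continuous_on_scaleR continuous_on_inner continuous_on_const
        C1_on_continuous_derivative[OF g]
        continuous_on_compose2[OF C1_on_continuous_derivative[OF h] C1_on_imp_continuous_on[OF g] sub])
  moreover have "fderiv h (g u) w =
      (\<Sum>b\<in>Basis. (w \<bullet> b) *\<^sub>R fderiv h (g u) b)" if "u \<in> S" for u w
  proof -
    have "linear (fderiv h (g u))"
      using C1_on_derivative[OF h, of "g u"] sub that has_derivative_linear by blast
    then show ?thesis
      by (subst euclidean_representation[of w, symmetric])
        (simp add: linear_sum linear_cmul)
  qed
  ultimately show "continuous_on S (\<lambda>u. fderiv h (g u) (fderiv g u v))"
    by (simp cong: continuous_on_cong)
qed

lemma C1_on_real:
  fixes h :: "real \<Rightarrow> real"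
  assumes "\<And>t. t \<in> S \<Longrightarrow> (h has_real_derivative h' t) (at t)" "continuous_on S h'"
  shows "C1_on S h"
  by (rule C1_onI[where h' = "\<lambda>t v. h' t * v"])
    (use assms in \<open>auto simp: has_field_derivative_def intro!: continuous_intros\<close>)

lemma C1_on_divide:
  fixes f g :: "'v::real_normed_vector \<Rightarrow> real"
  assumes "C1_on S f" "C1_on S g" "\<And>u. u \<in> S \<Longrightarrow> g u \<noteq> 0"
  shows "C1_on S (\<lambda>u. f u / g u)"
proof -
  have "C1_on (- {0::real}) inverse"
    by (rule C1_on_real) (auto intro!: derivative_eq_intros continuous_intros)
  then have "C1_on S (\<lambda>u. f u * inverse (g u))"
    by (intro C1_on_mult C1_on_comp[OF _ assms(2)] assms) (use assms(3) in auto)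
  then show ?thesis by (simp only: divide_inverse)
qed

lemma C1_on_sqrt:
  assumes "C1_on S f" "\<And>u. u \<in> S \<Longrightarrow> f u > 0"
  shows "C1_on S (\<lambda>u. sqrt (f u))"
proof -
  have "C1_on {0<..} sqrt"
    by (rule C1_on_real) (auto intro!: DERIV_real_sqrt continuous_intros)
  then show ?thesis
    by (rule C1_on_comp[OF _ assms(1)]) (use assms(2) in auto)
qed

lemma C1_on_det:
  fixes M :: "'v::real_normed_vector \<Rightarrow> real^'m^'m"
  assumes "\<And>i j. C1_on S (\<lambda>u. M u $ i $ j)"
  shows "C1_on S (\<lambda>u. det (M u))"
  unfolding det_def by (intro C1_on_sum C1_on_mult C1_on_const C1_on_prod assms)

lemma smooth_on_imp_C1_on: "smooth_on S h \<Longrightarrow> C1_on S h"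
  by (simp only: smooth_on_def)

lemma smooth_on_imp_C1_on_derivative:
  assumes "smooth_on S h" shows "C1_on S (\<lambda>u. fderiv h u v)"
proof -
  have "Ck_on (Suc (Suc 0)) S h" using assms by (simp only: smooth_on_def)
  then show ?thesis by (subst (asm) Ck_on.simps(2)) blast
qed

section \<open>A cutoff function of class C1\<close>

lemma has_real_derivative_max_power2:
  "((\<lambda>t. (max 0 t)\<^sup>2) has_real_derivative 2 * max 0 t) (at t)" for t :: real
proof (cases t "0::real" rule: linorder_cases)
  case less
  have "((\<lambda>_. 0) has_real_derivative 0) (at t)" by simp
  then have "((\<lambda>t. (max 0 t)\<^sup>2) has_real_derivative 0) (at t)"
    by (rule DERIV_cong_ev[THEN iffD1, OF refl _ refl, rotated])
      (use less eventually_nhds_in_open[of "{..<0}" t] in \<open>auto elim!: eventually_mono\<close>)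
  then show ?thesis using less by simp
next
  case greater
  have "((\<lambda>t. t\<^sup>2) has_real_derivative 2 * t) (at t)" by (auto intro!: derivative_eq_intros)
  then have "((\<lambda>t. (max 0 t)\<^sup>2) has_real_derivative 2 * t) (at t)"
    by (rule DERIV_cong_ev[THEN iffD1, OF refl _ refl, rotated])
      (use greater eventually_nhds_in_open[of "{0<..}" t] in \<open>auto elim!: eventually_mono\<close>)
  then show ?thesis using greater by simp
next
  case equal
  have "((\<lambda>h. (max 0 h)\<^sup>2 / h) \<longlongrightarrow> 0) (at (0::real))"
  proof (rule Lim_null_comparison)
    show "\<forall>\<^sub>F h in at 0. norm ((max 0 h)\<^sup>2 / h) \<le> \<bar>h\<bar>"
      by (auto simp: eventually_at_filter power2_eq_square max_def abs_mult intro!: always_eventually)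
    show "((\<lambda>h. \<bar>h\<bar>) \<longlongrightarrow> 0) (at (0::real))"
      using tendsto_rabs[OF tendsto_ident_at, of 0] by simp
  qed
  then show ?thesis using equal by (simp add: DERIV_def)
qed

text \<open>
  Composing \<open>(max 0 t)\<^sup>2\<close>, which is of class C1, with its reflection gives a function of class C1 that
  rises from 0 at \<open>t = 0\<close> to 1 at \<open>t = 1\<close>; \<open>cutoff'\<close> is its derivative.
\<close>

definition cutoff :: "real \<Rightarrow> real" where
  "cutoff t = 1 - (max 0 (1 - (max 0 t)\<^sup>2))\<^sup>2"

definition cutoff' :: "real \<Rightarrow> real" where
  "cutoff' t = 4 * max 0 (1 - (max 0 t)\<^sup>2) * max 0 t"

lemma has_real_derivative_cutoff: "(cutoff has_real_derivative cutoff' t) (at t)"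
proof -
  have "((\<lambda>t. (max 0 (1 - (max 0 t)\<^sup>2))\<^sup>2) has_real_derivative
     2 * max 0 (1 - (max 0 t)\<^sup>2) * (- (2 * max 0 t))) (at t)"
    by (rule DERIV_chain2[OF has_real_derivative_max_power2])
      (rule DERIV_diff[OF DERIV_const has_real_derivative_max_power2, of 1, simplified])
  then have "((\<lambda>t. 1 - (max 0 (1 - (max 0 t)\<^sup>2))\<^sup>2) has_real_derivative
     0 - 2 * max 0 (1 - (max 0 t)\<^sup>2) * (- (2 * max 0 t))) (at t)"
    by (intro DERIV_diff DERIV_const)
  then show ?thesis
    unfolding cutoff_def[abs_def] cutoff'_def by (simp add: mult.assoc)
qed

lemma cutoff_eq_0: "t \<le> 0 \<Longrightarrow> cutoff t = 0"
  and cutoff_eq_1: "1 \<le> t \<Longrightarrow> cutoff t = 1"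
  using mult_mono[of 1 t 1 t] by (auto simp: cutoff_def max_def power2_eq_square)

lemma cutoff_bounds: "0 \<le> cutoff t" "cutoff t \<le> 1"
  by (auto simp: cutoff_def max_def power_le_one)

lemma cutoff'_eq_0: "1 \<le> t \<Longrightarrow> cutoff' t = 0"
  using mult_mono[of 1 t 1 t] by (auto simp: cutoff'_def max_def power2_eq_square)

lemma cutoff'_eq_0': "t \<le> 0 \<Longrightarrow> cutoff' t = 0"
  by (auto simp: cutoff'_def)

lemma cutoff'_bounds: "0 \<le> cutoff' t" "cutoff' t \<le> 4"
proof -
  show "0 \<le> cutoff' t" by (simp add: cutoff'_def)
  show "cutoff' t \<le> 4"
  proof (cases "0 \<le> t \<and> t \<le> 1")
    case True
    then have "(1 - t\<^sup>2) * t \<le> 1 * 1"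
      by (intro mult_mono) auto
    then show ?thesis using True by (auto simp: cutoff'_def max_def)
  qed (use cutoff'_eq_0 cutoff'_eq_0' in force)
qed

lemma C1_on_cutoff: "C1_on S f \<Longrightarrow> C1_on S (\<lambda>u. cutoff (f u))"
  by (rule C1_on_comp[where T = UNIV, OF C1_on_real[where h' = cutoff']])
    (auto intro!: has_real_derivative_cutoff, auto intro!: continuous_intros simp: cutoff'_def[abs_def])


section \<open>Partial derivatives: integrals, symmetry, determinants\<close>

lemma C1_on_line_derivative:
  fixes h :: "'v::real_normed_vector \<Rightarrow> real"
  assumes "C1_on S h" "u + t *\<^sub>R v \<in> S"
  shows "((\<lambda>t. h (u + t *\<^sub>R v)) has_real_derivative fderiv h (u + t *\<^sub>R v) v) (at t)"
proof -
  let ?h' = "fderiv h (u + t *\<^sub>R v)"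
  have h: "(h has_derivative ?h') (at (u + t *\<^sub>R v))"
    by (rule C1_on_derivative[OF assms])
  have "((\<lambda>t. u + t *\<^sub>R v) has_derivative (\<lambda>s. s *\<^sub>R v)) (at t)"
    by (auto intro!: derivative_eq_intros)
  from has_derivative_compose[OF this h]
  have "((\<lambda>t. h (u + t *\<^sub>R v)) has_derivative (\<lambda>s. ?h' (s *\<^sub>R v))) (at t)" .
  then show ?thesis
    by (simp add: has_field_derivative_def linear_cmul[OF has_derivative_linear[OF h]] mult_commute_abs)
qed

text \<open>
  The difference quotients of \<open>F\<close> have integral zero, because Lebesgue measure is translation
  invariant, and they converge boundedly and with common compact support to the derivative.
\<close>

lemma integral_partial_derivative_eq_0:
  fixes F :: "'e::euclidean_space \<Rightarrow> real"
  assumes F: "C1_on UNIV F" and L: "compact L" and zero: "\<And>u. u \<notin> L \<Longrightarrow> F u = 0"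
  shows "integrable lborel (\<lambda>u. fderiv F u v)"
    and "(\<integral>u. fderiv F u v \<partial>lborel) = 0"
proof -
  define G where "G u = fderiv F u v" for u
  have contG: "continuous_on UNIV G"
    unfolding G_def by (rule C1_on_continuous_derivative[OF F])
  have contF: "continuous_on UNIV F"
    by (rule C1_on_imp_continuous_on[OF F])
  have G0: "G u = 0" if "u \<notin> L" for u
  proof -
    have "(F has_derivative (\<lambda>_. 0)) (at u)"
      by (rule has_derivative_transform_within_open[of "\<lambda>_. 0", OF _ open_Compl[OF compact_imp_closed[OF L]]])
        (use that zero in auto)
    then show ?thesis by (simp add: G_def frechet_derivative_at[symmetric])
  qed
  have integrable: "integrable lborel h" if "continuous_on UNIV h" "\<And>u. u \<notin> L \<Longrightarrow> h u = 0" for h :: "'e \<Rightarrow> real"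
  proof -
    have "integrable lborel (\<lambda>u. indicator L u *\<^sub>R h u)"
      by (rule borel_integrable_compact[OF L continuous_on_subset[OF that(1)]]) auto
    also have "(\<lambda>u. indicator L u *\<^sub>R h u) = h" by (rule ext) (use that(2) in \<open>auto simp: indicator_def\<close>)
    finally show ?thesis .
  qed
  note integrableF = integrable[OF contF zero] and integrableG = integrable[OF contG G0]
  obtain B where B: "\<And>u. \<bar>G u\<bar> \<le> B"
  proof -
    have "bounded (G ` L)"
      by (rule compact_imp_bounded[OF compact_continuous_image[OF continuous_on_subset[OF contG] L]]) auto
    then obtain B where "\<And>u. u \<in> L \<Longrightarrow> \<bar>G u\<bar> \<le> B" unfolding bounded_iff by auto
    then have "\<bar>G u\<bar> \<le> max B 0" for u using G0[of u] by (cases "u \<in> L") fastforce+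
    then show ?thesis using that by blast
  qed
  \<comment> \<open>All difference quotients below are supported in this compact set.\<close>
  define K where "K = (\<lambda>(a, t). a - t *\<^sub>R v) ` (L \<times> {0..1::real})"
  have K: "compact K"
    unfolding K_def case_prod_unfold
    by (intro compact_continuous_image compact_Times L) (auto intro!: continuous_intros)
  define h where "h n = 1 / real (Suc n)" for n
  have h: "0 < h n" "h n \<le> 1" for n by (auto simp: h_def field_simps)
  define Q where "Q n u = (F (h n *\<^sub>R v + u) - F u) / h n" for n u
  have shift: "integrable lborel (\<lambda>u. F (c + u))" "(\<integral>u. F (c + u) \<partial>lborel) = (\<integral>u. F u \<partial>lborel)" for c
  proof -
    have Fm: "F \<in> borel_measurable borel"
      using contF by (rule borel_measurable_continuous_onI)
    have "integrable (distr lborel borel ((+) c)) F" using integrableF by (simp add: lborel_distr_plus)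
    then show "integrable lborel (\<lambda>u. F (c + u))" by (subst (asm) integrable_distr_eq) (use Fm in auto)
    show "(\<integral>u. F (c + u) \<partial>lborel) = (\<integral>u. F u \<partial>lborel)"
      by (subst (2) lborel_distr_plus[symmetric, of c]) (subst integral_distr, use Fm in auto)
  qed
  have Q0: "(\<integral>u. Q n u \<partial>lborel) = 0" for n
    unfolding Q_def using shift[of "h n *\<^sub>R v"] integrableF by simp
  have Qbound: "\<bar>Q n u\<bar> \<le> B * indicator K u" for n u
  proof (cases "u \<in> K")
    case True
    have "\<exists>z>0. z < h n \<and> F (u + h n *\<^sub>R v) - F (u + 0 *\<^sub>R v) = (h n - 0) * G (u + z *\<^sub>R v)"
      using h[of n] unfolding G_def
      by (intro MVT2[where f = "\<lambda>t. F (u + t *\<^sub>R v)"] C1_on_line_derivative[OF F]) auto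
    then obtain z where "F (h n *\<^sub>R v + u) - F u = h n * G (u + z *\<^sub>R v)" by (auto simp: add.commute)
    then have "Q n u = G (u + z *\<^sub>R v)" using h[of n] by (simp add: Q_def)
    then show ?thesis using B True by simp
  next
    case False
    have "u \<notin> L" using False unfolding K_def by (force intro: image_eqI[where x = "(u, 0)"])
    moreover have "h n *\<^sub>R v + u \<notin> L"
      using False h[of n] unfolding K_def by (force intro: image_eqI[where x = "(h n *\<^sub>R v + u, h n)"])
    ultimately show ?thesis using zero False by (simp add: Q_def)
  qed
  have Qlim: "(\<lambda>n. Q n u) \<longlonglongrightarrow> G u" for u
  proof -
    have "((\<lambda>t. F (u + t *\<^sub>R v)) has_real_derivative G u) (at 0)"
      using C1_on_line_derivative[OF F, of u 0 v] by (simp add: G_def)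
    then have "((\<lambda>t. (F (u + t *\<^sub>R v) - F u) / t) \<longlongrightarrow> G u) (at 0)" by (simp add: DERIV_def)
    moreover have "filterlim h (at 0) sequentially"
      unfolding filterlim_at using h(1) LIMSEQ_Suc[OF lim_1_over_n]
      by (auto simp: h_def[abs_def])
    ultimately have "(\<lambda>n. (F (u + h n *\<^sub>R v) - F u) / h n) \<longlonglongrightarrow> G u"
      by (rule filterlim_compose)
    then show ?thesis by (simp add: Q_def add.commute)
  qed
  \<comment> \<open>Dominated convergence: the difference quotients are bounded by \<open>B\<close> and vanish outside \<open>K\<close>.\<close>
  have "(\<lambda>n. \<integral>u. Q n u \<partial>lborel) \<longlonglongrightarrow> (\<integral>u. G u \<partial>lborel)"
  proof (rule integral_dominated_convergence)
    show "integrable lborel (\<lambda>u. B * indicator K u :: real)"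
      using borel_integrable_compact[OF K continuous_on_const[of _ B]] by (simp add: mult.commute)
    show "Q n \<in> borel_measurable lborel" for n
      unfolding Q_def using contF
      by (intro borel_measurable_divide borel_measurable_diff borel_measurable_const)
        (auto intro!: borel_measurable_continuous_onI continuous_on_compose2[OF contF] continuous_intros)
  qed (use Qlim Qbound integrableG in auto)
  then have "(\<integral>u. G u \<partial>lborel) = 0"
    using Q0 by (simp add: LIMSEQ_const_iff)
  then show "integrable lborel (\<lambda>u. fderiv F u v)"
    and "(\<integral>u. fderiv F u v \<partial>lborel) = 0"
    using integrableG unfolding G_def by blast+
qed

text \<open>
  Two applications of the mean value theorem.  The left-hand side is symmetric in \<open>a\<close> and \<open>b\<close>; this
  is what makes the mixed derivatives agree in the limit.
\<close>

lemma second_difference: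
  fixes h :: "'v::real_normed_vector \<Rightarrow> real"
  assumes h: "C1_on U h" "C1_on U (\<lambda>u. fderiv h u a)"
    and "0 < s" and U: "\<And>p q. p \<in> {0..s} \<Longrightarrow> q \<in> {0..s} \<Longrightarrow> u + p *\<^sub>R a + q *\<^sub>R b \<in> U"
  shows "\<exists>p\<in>{0..s}. \<exists>q\<in>{0..s}. h (u + s *\<^sub>R a + s *\<^sub>R b) - h (u + s *\<^sub>R a) - h (u + s *\<^sub>R b) + h u
     = s * s * fderiv (\<lambda>u. fderiv h u a) (u + p *\<^sub>R a + q *\<^sub>R b) b"
proof -
  let ?D = "\<lambda>u. fderiv h u a"
  have "\<exists>p>0. p < s \<and> (h ((u + s *\<^sub>R b) + s *\<^sub>R a) - h (u + s *\<^sub>R a)) - (h ((u + s *\<^sub>R b) + 0 *\<^sub>R a) - h (u + 0 *\<^sub>R a))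
      = (s - 0) * (?D ((u + s *\<^sub>R b) + p *\<^sub>R a) - ?D (u + p *\<^sub>R a))"
    using \<open>0 < s\<close> U[of _ s] U[of _ 0]
    by (intro MVT2[where f = "\<lambda>t. h ((u + s *\<^sub>R b) + t *\<^sub>R a) - h (u + t *\<^sub>R a)"]
        DERIV_diff C1_on_line_derivative[OF h(1)]) (auto simp: algebra_simps)
  then obtain p where p: "0 < p" "p < s" and 1: "h (u + s *\<^sub>R a + s *\<^sub>R b) - h (u + s *\<^sub>R a) - h (u + s *\<^sub>R b) + h u
      = s * (?D (u + p *\<^sub>R a + s *\<^sub>R b) - ?D (u + p *\<^sub>R a))"
    by (auto simp: algebra_simps)
  have "\<exists>q>0. q < s \<and> ?D ((u + p *\<^sub>R a) + s *\<^sub>R b) - ?D ((u + p *\<^sub>R a) + 0 *\<^sub>R b)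
      = (s - 0) * fderiv ?D ((u + p *\<^sub>R a) + q *\<^sub>R b) b"
    using \<open>0 < s\<close> p U
    by (intro MVT2[where f = "\<lambda>t. ?D ((u + p *\<^sub>R a) + t *\<^sub>R b)"] C1_on_line_derivative[OF h(2)]) auto
  then obtain q where "0 < q" "q < s" "?D (u + p *\<^sub>R a + s *\<^sub>R b) - ?D (u + p *\<^sub>R a)
      = s * fderiv ?D (u + p *\<^sub>R a + q *\<^sub>R b) b"
    by auto
  with p 1 show ?thesis
    by (intro bexI[of _ p] bexI[of _ q]) auto
qed

lemma mixed_derivatives_commute_real:
  fixes h :: "'v::real_normed_vector \<Rightarrow> real"
  assumes U: "open U" "u \<in> U" and h: "C1_on U h"
    and h2: "\<And>v. C1_on U (\<lambda>u. fderiv h u v)"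
  shows "fderiv (\<lambda>u. fderiv h u a) u b
       = fderiv (\<lambda>u. fderiv h u b) u a" (is "?A u = ?B u")
proof (rule ccontr)
  assume ne: "?A u \<noteq> ?B u"
  define \<epsilon> where "\<epsilon> = \<bar>?A u - ?B u\<bar> / 2"
  have \<epsilon>: "0 < \<epsilon>" using ne by (simp add: \<epsilon>_def)
  have "isCont ?A u" "isCont ?B u"
    using C1_on_continuous_derivative[OF h2] U by (simp_all add: continuous_on_eq_continuous_at)
  then obtain d1 d2 where d: "0 < d1" "\<And>w. dist w u < d1 \<Longrightarrow> dist (?A w) (?A u) < \<epsilon>"
      "0 < d2" "\<And>w. dist w u < d2 \<Longrightarrow> dist (?B w) (?B u) < \<epsilon>"
    using \<epsilon> unfolding continuous_at_eps_delta by blast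
  obtain d3 where d3: "0 < d3" "ball u d3 \<subseteq> U" using U open_contains_ball by blast
  define d where "d = min d1 (min d2 d3)"
  define s where "s = d / (2 * (norm a + norm b + 1))"
  have dpos: "0 < d" using d d3 by (simp add: d_def)
  have npos: "0 < norm a + norm b + 1" by (simp add: add_nonneg_pos)
  have s: "0 < s" using dpos npos by (simp add: s_def)
  have near: "dist (u + p *\<^sub>R a + q *\<^sub>R b) u < d" if "p \<in> {0..s}" "q \<in> {0..s}" for p q
  proof -
    have "dist (u + p *\<^sub>R a + q *\<^sub>R b) u \<le> p * norm a + q * norm b"
      using norm_triangle_ineq[of "p *\<^sub>R a" "q *\<^sub>R b"] that by (simp add: dist_norm add.assoc)
    also have "\<dots> \<le> s * norm a + s * norm b" using that by (intro add_mono mult_right_mono) auto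
    also have "\<dots> \<le> s * (norm a + norm b + 1)" using s by (simp add: algebra_simps)
    also have "\<dots> = d / 2" using npos unfolding s_def by (simp only: times_divide_eq_left) (simp add: divide_simps)
    finally show ?thesis using dpos by simp
  qed
  have inU: "u + p *\<^sub>R a + q *\<^sub>R b \<in> U" if "p \<in> {0..s}" "q \<in> {0..s}" for p q
    using near[OF that] d3 by (auto simp: d_def dist_commute)
  obtain p q where pq: "p \<in> {0..s}" "q \<in> {0..s}"
    "h (u + s *\<^sub>R a + s *\<^sub>R b) - h (u + s *\<^sub>R a) - h (u + s *\<^sub>R b) + h u = s * s * ?A (u + p *\<^sub>R a + q *\<^sub>R b)"
    using second_difference[OF h h2 s inU] by blast
  have inU': "u + q *\<^sub>R b + p *\<^sub>R a \<in> U" if "q \<in> {0..s}" "p \<in> {0..s}" for p q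
    using inU[OF that(2,1)] by (simp add: algebra_simps)
  obtain p' q' where pq': "p' \<in> {0..s}" "q' \<in> {0..s}"
    "h (u + s *\<^sub>R b + s *\<^sub>R a) - h (u + s *\<^sub>R b) - h (u + s *\<^sub>R a) + h u = s * s * ?B (u + q' *\<^sub>R b + p' *\<^sub>R a)"
    using second_difference[OF h h2 s inU'] by blast
  have "s * s * ?A (u + p *\<^sub>R a + q *\<^sub>R b) = s * s * ?B (u + q' *\<^sub>R b + p' *\<^sub>R a)"
    using pq(3) pq'(3) by (simp add: algebra_simps)
  then have "?A (u + p *\<^sub>R a + q *\<^sub>R b) = ?B (u + p' *\<^sub>R a + q' *\<^sub>R b)"
    using s by (simp add: algebra_simps)
  moreover have "dist (?A (u + p *\<^sub>R a + q *\<^sub>R b)) (?A u) < \<epsilon>"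
    using near[OF pq(1,2)] by (intro d) (simp add: d_def)
  moreover have "dist (?B (u + p' *\<^sub>R a + q' *\<^sub>R b)) (?B u) < \<epsilon>"
    using near[OF pq'(1,2)] by (intro d) (simp add: d_def)
  ultimately show False unfolding \<epsilon>_def dist_real_def by argo
qed

lemma mixed_derivatives_commute:
  fixes h :: "'v::real_normed_vector \<Rightarrow> 'w::real_inner"
  assumes U: "open U" "u \<in> U" and h: "smooth_on U h"
  shows "fderiv (\<lambda>u. fderiv h u a) u b
       = fderiv (\<lambda>u. fderiv h u b) u a"
proof -
  have D: "fderiv (\<lambda>u. k u \<bullet> w) u v = fderiv k u v \<bullet> w"
    if "C1_on U k" "u \<in> U" for k :: "'v \<Rightarrow> 'w" and u v w
    using has_derivative_inner_left[OF C1_on_derivative[OF that], of w]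
    by (simp add: frechet_derivative_at[symmetric])
  note h1 = smooth_on_imp_C1_on[OF h] smooth_on_imp_C1_on_derivative[OF h]
  have DD: "fderiv (\<lambda>u. fderiv (\<lambda>u. h u \<bullet> w) u a) u b
    = fderiv (\<lambda>u. fderiv h u a) u b \<bullet> w" for w a b
  proof -
    have "((\<lambda>u. fderiv (\<lambda>u. h u \<bullet> w) u a) has_derivative
       (\<lambda>v. fderiv (\<lambda>u. fderiv h u a) u v \<bullet> w)) (at u)"
      by (rule has_derivative_transform_within_open[OF
            has_derivative_inner_left[OF C1_on_derivative[OF h1(2) U(2)]] U])
        (simp add: D[OF h1(1)])
    then show ?thesis by (simp add: frechet_derivative_at[symmetric])
  qed
  have "fderiv (\<lambda>u. fderiv h u a) u b \<bullet> w
      = fderiv (\<lambda>u. fderiv h u b) u a \<bullet> w" for w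
    unfolding DD[symmetric]
  proof (rule mixed_derivatives_commute_real[OF U])
    show "C1_on U (\<lambda>u. h u \<bullet> w)" by (intro C1_on_inner h1 C1_on_const)
    show "C1_on U (\<lambda>u. fderiv (\<lambda>u. h u \<bullet> w) u v)" for v
      by (rule C1_on_cong[OF U(1), of "\<lambda>u. fderiv h u v \<bullet> w"])
        (simp_all add: D h1 C1_on_inner C1_on_const)
  qed
  then show ?thesis by (metis inner_commute vector_eq_rdot)
qed

lemma matrix_inv_invertible:
  fixes A :: "real^'m^'m"
  assumes "invertible A"
  shows "A ** matrix_inv A = mat 1" "matrix_inv A ** A = mat 1"
  using someI_ex[OF assms[unfolded invertible_def]] by (simp_all add: matrix_inv_def)

text \<open>
  By the product rule every permutation contributes a sum of products with one factor
  differentiated; at the identity matrix only the identity permutation has a nonzero term.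
\<close>

lemma has_derivative_det_at_id:
  fixes B :: "'v::real_normed_vector \<Rightarrow> real^'m^'m"
  assumes B: "\<And>i j. ((\<lambda>u. B u $ i $ j) has_derivative (\<lambda>v. B' v $ i $ j)) (at u)" and "B u = mat 1"
  shows "((\<lambda>u. det (B u)) has_derivative (\<lambda>v. trace (B' v))) (at u)"
proof -
  let ?P = "{p. p permutes (UNIV::'m set)}"
  have "((\<lambda>u. det (B u)) has_derivative (\<lambda>v. \<Sum>p\<in>?P. of_int (sign p) *
      (\<Sum>i\<in>UNIV. B' v $ i $ p i * (\<Prod>j\<in>UNIV - {i}. B u $ j $ p j)))) (at u)"
    unfolding det_def by (intro has_derivative_sum has_derivative_mult_right has_derivative_prod B)
  moreover have "(\<Sum>p\<in>?P. of_int (sign p) *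
      (\<Sum>i\<in>UNIV. B' v $ i $ p i * (\<Prod>j\<in>UNIV - {i}. B u $ j $ p j))) = trace (B' v)" for v
  proof -
    have "(\<Prod>j\<in>UNIV - {i}. B u $ j $ p j) = 0" if p: "p \<in> ?P" "p \<noteq> id" for p i
    proof -
      obtain j where j: "p j \<noteq> j" using p by fastforce
      \<comment> \<open>A permutation that moves \<open>j\<close> also moves \<open>p j\<close>, so it moves an index other than \<open>i\<close>.\<close>
      moreover have "p (p j) \<noteq> p j" using j p by (auto dest: permutes_inj injD)
      ultimately obtain k where "k \<noteq> i" "p k \<noteq> k" by metis
      then show ?thesis using \<open>B u = mat 1\<close>
        by (intro prod_zero bexI[of _ k]) (auto simp: mat_def)
    qed
    then have "(\<Sum>p\<in>?P. of_int (sign p) *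
      (\<Sum>i\<in>UNIV. B' v $ i $ p i * (\<Prod>j\<in>UNIV - {i}. B u $ j $ p j)))
      = (\<Sum>p\<in>{id}. of_int (sign p) *
      (\<Sum>i\<in>UNIV. B' v $ i $ p i * (\<Prod>j\<in>UNIV - {i}. B u $ j $ p j)))"
      by (intro sum.mono_neutral_right) (auto simp: permutes_id simp del: prod_zero_iff)
    also have "\<dots> = trace (B' v)" using \<open>B u = mat 1\<close> by (simp add: trace_def mat_def)
    finally show ?thesis .
  qed
  ultimately show ?thesis by simp
qed

text \<open>
  Jacobi's formula, reduced to the identity matrix by multiplication with the inverse.
\<close>

lemma has_derivative_det:
  fixes M :: "'v::real_normed_vector \<Rightarrow> real^'m^'m"
  assumes M: "\<And>i j. ((\<lambda>u. M u $ i $ j) has_derivative (\<lambda>v. M' v $ i $ j)) (at u)"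
    and inv: "invertible (M u)"
  shows "((\<lambda>u. det (M u)) has_derivative (\<lambda>v. det (M u) * trace (matrix_inv (M u) ** M' v))) (at u)"
proof -
  let ?P = "matrix_inv (M u)"
  have "((\<lambda>w. det (?P ** M w)) has_derivative (\<lambda>v. trace (?P ** M' v))) (at u)"
    by (rule has_derivative_det_at_id)
      (simp_all add: matrix_inv_invertible[OF inv],
        auto simp: matrix_matrix_mult_def intro!: has_derivative_sum has_derivative_mult_right M)
  from has_derivative_mult_right[OF this, of "det (M u)"]
  have "((\<lambda>w. det (M u) * det (?P ** M w)) has_derivative (\<lambda>v. det (M u) * trace (?P ** M' v))) (at u)" .
  moreover have "det (M u) * det (?P ** M w) = det (M w)" for w
    by (simp add: det_mul[symmetric] matrix_mul_assoc matrix_inv_invertible[OF inv])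
  ultimately show ?thesis by simp
qed


section \<open>Change of variables for an arbitrary finite index type\<close>

text \<open>
  The change of variables theorem for \<open>real^'m\<close> is stated for a well-ordered index type.  To obtain it
  for every finite type \<open>'m\<close>, the integrals are transported to a copy of \<open>'m\<close> that is ordered by an
  enumeration.
\<close>

typedef 'm ordered_copy = "UNIV :: 'm set" by simp

instance ordered_copy :: (finite) finite
proof
  have "UNIV = range (Abs_ordered_copy :: 'a \<Rightarrow> 'a ordered_copy)"
    by (metis Abs_ordered_copy_cases UNIV_eq_I rangeI)
  then show "finite (UNIV :: 'a ordered_copy set)" by (metis finite finite_imageI)
qed

definition position :: "'m::finite ordered_copy \<Rightarrow> nat" where
  "position i = to_nat_on UNIV (Rep_ordered_copy i)"

lemma position_inject: "position i = position j \<longleftrightarrow> i = j"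
  unfolding position_def
  by (simp add: to_nat_on_inj countable_finite Rep_ordered_copy_inject)

instantiation ordered_copy :: (finite) wellorder
begin

definition "less_eq_ordered_copy (i :: 'a ordered_copy) (j :: 'a ordered_copy) \<longleftrightarrow> position i \<le> position j"
definition "less_ordered_copy (i :: 'a ordered_copy) (j :: 'a ordered_copy) \<longleftrightarrow> position i < position j"

instance
proof
  fix P :: "'a ordered_copy \<Rightarrow> bool" and a
  assume "\<And>x. (\<And>y. y < x \<Longrightarrow> P y) \<Longrightarrow> P x"
  then show "P a" unfolding less_ordered_copy_def
    by (induction "position a" arbitrary: a rule: less_induct) blast
qed (auto simp: less_eq_ordered_copy_def less_ordered_copy_def position_inject[symmetric])

end

lemma permutes_UNIV_iff_bij: "p permutes UNIV \<longleftrightarrow> bij p"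
  by (auto simp: permutes_bij intro: bij_imp_permutes)

lemma sign_conjugate:
  fixes \<phi> :: "'a::finite \<Rightarrow> 'b::finite" and p :: "'b \<Rightarrow> 'b"
  assumes \<phi>: "\<And>i. \<psi> (\<phi> i) = i" "\<And>j. \<phi> (\<psi> j) = j" and "p permutes UNIV"
  shows "sign (\<psi> \<circ> p \<circ> \<phi>) = sign p"
  using \<open>p permutes UNIV\<close> finite[of UNIV]
proof (induction rule: permutes_induct)
  case id
  have "\<psi> \<circ> id \<circ> \<phi> = id" using \<phi> by auto
  then show ?case by simp
next
  case (swap a b p)
  have eq: "\<psi> \<circ> (Transposition.transpose a b \<circ> p) \<circ> \<phi> = Transposition.transpose (\<psi> a) (\<psi> b) \<circ> (\<psi> \<circ> p \<circ> \<phi>)"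
    using \<phi> by (auto simp: fun_eq_iff Transposition.transpose_def) metis+
  have p: "permutation q" if "bij q" for q :: "'c::finite \<Rightarrow> 'c"
    using that by (auto simp: permutation_permutes permutes_UNIV_iff_bij intro!: exI[of _ UNIV])
  have "bij p" using swap by (simp add: permutes_bij)
  moreover have "bij \<phi>" "bij \<psi>" using \<phi> by (auto intro!: o_bij simp: fun_eq_iff)
  ultimately have "bij (\<psi> \<circ> p \<circ> \<phi>)" by (intro bij_comp)
  moreover have "\<psi> a = \<psi> b \<longleftrightarrow> a = b" using \<phi> by metis
  ultimately have "sign (Transposition.transpose (\<psi> a) (\<psi> b) \<circ> (\<psi> \<circ> p \<circ> \<phi>)) = sign (Transposition.transpose a b \<circ> p)"
    using swap.IH \<open>bij p\<close>
    by (subst (1 2) sign_compose) (simp_all only: p permutation_swap_id sign_swap_id)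
  then show ?case unfolding eq .
qed

lemma det_reindex:
  fixes A :: "'c::comm_ring_1^'b^'b" and \<phi> :: "'a::finite \<Rightarrow> 'b::finite"
  assumes \<phi>: "\<And>i. \<psi> (\<phi> i) = i" "\<And>j. \<phi> (\<psi> j) = j"
  shows "det (\<chi> i j. A $ \<phi> i $ \<phi> j) = det A"
proof -
  have bij: "bij \<phi>" "bij \<psi>" using \<phi> by (auto intro!: o_bij simp: fun_eq_iff)
  have "(\<Prod>j\<in>UNIV. A $ j $ \<phi> (p (\<psi> j))) = (\<Prod>i\<in>UNIV. A $ \<phi> i $ \<phi> (p i))" for p
    using prod.reindex_bij_betw[OF bij(1), of "\<lambda>j. A $ j $ \<phi> (p (\<psi> j))"] by (simp add: \<phi>)
  then show ?thesis unfolding det_def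
    by (intro sum.reindex_bij_witness[of _ "\<lambda>p. \<psi> \<circ> p \<circ> \<phi>" "\<lambda>p. \<phi> \<circ> p \<circ> \<psi>"])
      (auto simp: \<phi> fun_eq_iff sign_conjugate[of \<phi> \<psi>] sign_conjugate[of \<psi> \<phi>] permutes_UNIV_iff_bij
        bij intro!: bij_comp)
qed

text \<open>
  The two integrands are absolutely integrable at the same time, so that the integrals also agree
  when they are infinite.
\<close>

lemma nn_integral_change_of_variables_wellorder:
  fixes g :: "real^'m::{finite,wellorder} \<Rightarrow> real^'m::_" and f q :: "real^'m::_ \<Rightarrow> real"
  assumes B: "B \<in> sets borel" and gB: "g ` B \<in> sets borel"
    and f: "f \<in> borel_measurable borel" "\<And>w. 0 \<le> f w"
    and q: "q \<in> borel_measurable borel" "\<And>u. 0 \<le> q u"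
    and g: "\<And>u. u \<in> B \<Longrightarrow> (g has_derivative g' u) (at u within B)" "inj_on g B"
    and eq: "\<And>u. u \<in> B \<Longrightarrow> q u = \<bar>det (matrix (g' u))\<bar> * f (g u)"
  shows "(\<integral>\<^sup>+w\<in>g ` B. ennreal (f w) \<partial>lborel) = (\<integral>\<^sup>+u\<in>B. ennreal (q u) \<partial>lborel)"
proof -
  have key: "q absolutely_integrable_on B \<and> integral B q = b \<longleftrightarrow>
      f absolutely_integrable_on (g ` B) \<and> integral (g ` B) f = b" for b
  proof -
    have "q absolutely_integrable_on B \<and> integral B q = b \<longleftrightarrow>
      (\<lambda>u. \<bar>det (matrix (g' u))\<bar> * f (g u)) absolutely_integrable_on B \<and>
        integral B (\<lambda>u. \<bar>det (matrix (g' u))\<bar> * f (g u)) = b"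
      using eq by (metis (no_types, lifting) Henstock_Kurzweil_Integration.integral_cong
          set_integrable_cong)
    then show ?thesis
      using has_absolute_integral_change_of_variables[of B g g' "\<lambda>w. vec (f w) :: real^1" "vec b"] B g
      unfolding absolutely_integrable_on_1_iff integral_on_1_eq
      by (auto simp: sets_completionI_sets)
  qed
  have nn: "(\<integral>\<^sup>+w\<in>A. ennreal (h w) \<partial>lborel) = ennreal (integral A h)"
    if "h absolutely_integrable_on A" "A \<in> sets borel" "h \<in> borel_measurable borel" "\<And>w. 0 \<le> h w"
    for A and h :: "real^'m::_ \<Rightarrow> real"
  proof -
    have "(\<integral>\<^sup>+w. ennreal (indicator A w * h w) \<partial>lebesgue) = ennreal (integral A h)"
      using that unfolding set_lebesgue_integral_eq_integral(2)[OF that(1), symmetric]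
        set_lebesgue_integral_def set_integrable_def
      by (subst nn_integral_eq_integral) auto
    then show ?thesis
      by (simp add: nn_integral_completion ennreal_mult' that mult.commute ennreal_indicator)
  qed
  have fin: "h absolutely_integrable_on A"
    if "(\<integral>\<^sup>+w\<in>A. ennreal (h w) \<partial>lborel) \<noteq> \<infinity>" "A \<in> sets borel" "h \<in> borel_measurable borel" "\<And>w. 0 \<le> h w"
    for A and h :: "real^'m::_ \<Rightarrow> real"
    unfolding set_integrable_def
  proof (rule integrableI_nonneg)
    show "(\<lambda>x. indicat_real A x *\<^sub>R h x) \<in> borel_measurable lebesgue"
      using that by (intro measurable_completion) auto
    have "(\<integral>\<^sup>+w. ennreal (indicat_real A w *\<^sub>R h w) \<partial>lebesgue) = (\<integral>\<^sup>+w\<in>A. ennreal (h w) \<partial>lborel)"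
      by (simp add: nn_integral_completion ennreal_mult' that mult.commute ennreal_indicator)
    then show "(\<integral>\<^sup>+w. ennreal (indicat_real A w *\<^sub>R h w) \<partial>lebesgue) < \<infinity>"
      using that(1) by (simp add: less_top)
  qed (use that in auto)
  show ?thesis
  proof (cases "q absolutely_integrable_on B")
    case True
    then show ?thesis using key[of "integral B q"] nn[where h = q and A = B] nn[where h = f and A = "g ` B"] B gB f q by simp
  next
    case False
    then have "\<not> f absolutely_integrable_on (g ` B)" using key by blast
    then show ?thesis using False fin[where h = q and A = B] fin[where h = f and A = "g ` B"] B gB f q by metis
  qed
qed

definition to_copy :: "real^'m::finite \<Rightarrow> real^'m ordered_copy" where
  "to_copy u = (\<chi> i. u $ Rep_ordered_copy i)"

definition of_copy :: "real^'m ordered_copy \<Rightarrow> real^'m::finite" where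
  "of_copy w = (\<chi> i. w $ Abs_ordered_copy i)"

lemma of_to_copy [simp]: "of_copy (to_copy u) = u" and to_of_copy [simp]: "to_copy (of_copy w) = w"
  by (simp_all add: to_copy_def of_copy_def Abs_ordered_copy_inverse Rep_ordered_copy_inverse vec_eq_iff)

lemma bounded_linear_to_copy: "bounded_linear to_copy"
  unfolding linear_conv_bounded_linear[symmetric]
  by (rule linearI) (simp_all add: to_copy_def vec_eq_iff)

lemma bounded_linear_of_copy: "bounded_linear of_copy"
  unfolding linear_conv_bounded_linear[symmetric]
  by (rule linearI) (simp_all add: of_copy_def vec_eq_iff)

lemmas continuous_to_copy = linear_continuous_on[OF bounded_linear_to_copy, of UNIV]
lemmas continuous_of_copy = linear_continuous_on[OF bounded_linear_of_copy, of UNIV]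

lemma measurable_to_copy: "to_copy \<in> borel_measurable borel"
  and measurable_of_copy: "of_copy \<in> borel_measurable borel"
  by (rule borel_measurable_continuous_onI continuous_to_copy continuous_of_copy)+

text \<open>
  The relabelling of the coordinates maps boxes to boxes with the same edges.
\<close>

lemma distr_to_copy: "distr lborel borel to_copy = lborel"
proof (rule lborel_eqI[symmetric])
  fix l u :: "real^'a ordered_copy"
  assume "\<And>b. b \<in> Basis \<Longrightarrow> l \<bullet> b \<le> u \<bullet> b"
  then have le: "l $ i \<le> u $ i" for i
    by (metis axis_in_Basis_iff cart_eq_inner_axis real_inner_1_left inner_real_def mult_1 Basis_real_def insertI1)
  have "to_copy -` box l u = box (of_copy l) (of_copy u)"
  proof -
    have "(\<forall>i. l $ i < v $ Rep_ordered_copy i \<and> v $ Rep_ordered_copy i < u $ i) \<longleftrightarrow>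
      (\<forall>j. l $ Abs_ordered_copy j < v $ j \<and> v $ j < u $ Abs_ordered_copy j)" for v :: "real^'a"
      by (metis Abs_ordered_copy_inverse Rep_ordered_copy_inverse UNIV_I)
    then show ?thesis by (auto simp: mem_box_cart to_copy_def of_copy_def)
  qed
  then have "emeasure (distr lborel borel to_copy) (box l u) = emeasure lborel (box (of_copy l) (of_copy u))"
    by (simp add: emeasure_distr measurable_to_copy)
  also have "\<dots> = ennreal (\<Prod>j\<in>UNIV. u $ Abs_ordered_copy j - l $ Abs_ordered_copy j)"
    using le by (subst emeasure_lborel_box)
      (auto simp: Basis_vec_def inner_axis of_copy_def cart_eq_inner_axis[symmetric] UNION_singleton_eq_range
         prod.reindex inj_on_def axis_eq_axis)
  also have "(\<Prod>j\<in>UNIV. u $ Abs_ordered_copy j - l $ Abs_ordered_copy j) = (\<Prod>i\<in>UNIV. u $ i - l $ i)"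
    by (rule prod.reindex_bij_witness[of _ Rep_ordered_copy Abs_ordered_copy])
      (auto simp: Rep_ordered_copy_inverse Abs_ordered_copy_inverse)
  also have "\<dots> = (\<Prod>b\<in>Basis. (u - l) \<bullet> b)"
    by (simp add: Basis_vec_def inner_axis cart_eq_inner_axis[symmetric] UNION_singleton_eq_range
         prod.reindex inj_on_def axis_eq_axis)
  finally show "emeasure (distr lborel borel to_copy) (box l u) = (\<Prod>b\<in>Basis. (u - l) \<bullet> b)" .
qed simp

lemma nn_integral_of_copy:
  assumes "f \<in> borel_measurable borel"
  shows "(\<integral>\<^sup>+w. f (of_copy w) \<partial>lborel) = (\<integral>\<^sup>+u. f u \<partial>lborel)"
proof -
  have "(\<integral>\<^sup>+w. f (of_copy w) \<partial>distr lborel borel to_copy) = (\<integral>\<^sup>+u. f (of_copy (to_copy u)) \<partial>lborel)"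
    using assms measurable_of_copy measurable_to_copy
    by (intro nn_integral_distr) (auto intro: measurable_compose)
  then show ?thesis by (simp add: distr_to_copy)
qed

lemma nn_integral_change_of_variables:
  fixes g :: "real^'m::finite \<Rightarrow> real^'m" and f q :: "real^'m \<Rightarrow> real"
  assumes B: "B \<in> sets borel" and gB: "g ` B \<in> sets borel"
    and f: "f \<in> borel_measurable borel" "\<And>w. 0 \<le> f w"
    and q: "q \<in> borel_measurable borel" "\<And>u. 0 \<le> q u"
    and g: "\<And>u. u \<in> B \<Longrightarrow> (g has_derivative g' u) (at u within B)" "inj_on g B"
    and eq: "\<And>u. u \<in> B \<Longrightarrow> q u = \<bar>det (matrix (g' u))\<bar> * f (g u)"
  shows "(\<integral>\<^sup>+w\<in>g ` B. ennreal (f w) \<partial>lborel) = (\<integral>\<^sup>+u\<in>B. ennreal (q u) \<partial>lborel)"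
proof -
  have vimage: "to_copy ` A = of_copy -` A" for A :: "(real^'m) set"
    by (auto simp: image_iff) (metis to_of_copy)
  have sets: "to_copy ` A \<in> sets borel" if "A \<in> sets borel" for A :: "(real^'m) set"
    using measurable_sets[OF measurable_of_copy, of A] that by (simp add: vimage)
  have ind: "indicator (to_copy ` A) w = (indicator A (of_copy w) :: ennreal)" for A :: "(real^'m) set" and w
    by (simp add: vimage indicator_def)
  have *: "(\<integral>\<^sup>+w\<in>to_copy ` A. ennreal (h (of_copy w)) \<partial>lborel) = (\<integral>\<^sup>+u\<in>A. ennreal (h u) \<partial>lborel)"
    if "A \<in> sets borel" "h \<in> borel_measurable borel" for A and h :: "real^'m \<Rightarrow> real"
    unfolding ind using that by (intro nn_integral_of_copy[of "\<lambda>u. ennreal (h u) * indicator A u"]) auto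
  let ?g = "\<lambda>w. to_copy (g (of_copy w))"
  have img: "?g ` to_copy ` B = to_copy ` g ` B" by (simp add: image_image)
  have "(\<integral>\<^sup>+w\<in>?g ` to_copy ` B. ennreal (f (of_copy w)) \<partial>lborel)
      = (\<integral>\<^sup>+w\<in>to_copy ` B. ennreal (q (of_copy w)) \<partial>lborel)"
  proof (rule nn_integral_change_of_variables_wellorder)
    show "to_copy ` B \<in> sets borel" "?g ` to_copy ` B \<in> sets borel"
      unfolding img using sets B gB by auto
    show "(\<lambda>w. f (of_copy w)) \<in> borel_measurable borel" "(\<lambda>w. q (of_copy w)) \<in> borel_measurable borel"
      using measurable_of_copy f(1) q(1) by (auto intro: measurable_compose)
    show "inj_on ?g (to_copy ` B)" using g(2) by (auto simp: inj_on_def) (metis of_to_copy)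
    fix w :: "real^'m ordered_copy" assume w: "w \<in> to_copy ` B"
    then have u: "of_copy w \<in> B" by auto
    have "((\<lambda>w. g (of_copy w)) has_derivative (\<lambda>v. g' (of_copy w) (of_copy v))) (at w within to_copy ` B)"
      by (rule has_derivative_in_compose[OF bounded_linear_imp_has_derivative[OF bounded_linear_of_copy]])
        (use g(1)[OF u] in \<open>simp add: image_image\<close>)
    then show "(?g has_derivative (\<lambda>v. to_copy (g' (of_copy w) (of_copy v)))) (at w within to_copy ` B)"
      by (rule bounded_linear.has_derivative[OF bounded_linear_to_copy])
    have "of_copy (axis j 1) = axis (Rep_ordered_copy j) 1" for j :: "'m ordered_copy"
      by (auto simp: of_copy_def axis_def vec_eq_iff Abs_ordered_copy_inverse Rep_ordered_copy_inverse)
    then have "matrix (\<lambda>v. to_copy (g' (of_copy w) (of_copy v)))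
       = (\<chi> i j. matrix (g' (of_copy w)) $ Rep_ordered_copy i $ Rep_ordered_copy j)"
      by (simp add: matrix_def to_copy_def)
    then show "q (of_copy w) = \<bar>det (matrix (\<lambda>v. to_copy (g' (of_copy w) (of_copy v))))\<bar> * f (of_copy (?g w))"
      using eq[OF u] det_reindex[of Abs_ordered_copy Rep_ordered_copy "matrix (g' (of_copy w))"]
      by (simp add: Abs_ordered_copy_inverse Rep_ordered_copy_inverse)
  qed (use f q in auto)
  then show ?thesis unfolding img using *[OF gB f(1)] *[OF B q(1)] by simp
qed


section \<open>Charts of an immersed manifold\<close>

abbreviation chart_image :: "('a, 'm::finite) chart \<Rightarrow> (real^'m) set" where
  "chart_image c \<equiv> snd c ` fst c"

abbreviation transition :: "('a, 'm::finite) chart \<Rightarrow> ('a, 'm) chart \<Rightarrow> real^'m \<Rightarrow> real^'m" where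
  "transition c d \<equiv> snd d \<circ> chart_param c"

abbreviation C1_function ::
  "('a::topological_space, 'm::finite) chart set \<Rightarrow> ('a \<Rightarrow> 'w::real_normed_vector) \<Rightarrow> bool" where
  "C1_function \<A> h \<equiv> \<forall>c\<in>\<A>. C1_on (chart_image c) (h \<circ> chart_param c)"

locale immersed_manifold =
  fixes \<A> :: "('a::{t2_space, second_countable_topology}, 'm::finite) chart set"
    and x :: "'a \<Rightarrow> real^'n::finite"
  assumes atlas: "smooth_atlas \<A>" and immersion: "immersion \<A> x"
begin

lemma is_chart: "c \<in> \<A> \<Longrightarrow> is_chart c"
  using atlas by (simp add: smooth_atlas_def)

lemma open_domain: "c \<in> \<A> \<Longrightarrow> open (fst c)"
  and open_chart_image: "c \<in> \<A> \<Longrightarrow> open (chart_image c)"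
  and homeomorphism_chart: "c \<in> \<A> \<Longrightarrow> homeomorphism (fst c) (chart_image c) (snd c) (chart_param c)"
  using is_chart by (simp_all add: is_chart_def)

lemma chart_param_chart [simp]: "c \<in> \<A> \<Longrightarrow> p \<in> fst c \<Longrightarrow> chart_param c (snd c p) = p"
  using homeomorphism_chart homeomorphism_apply1 by blast

lemma chart_chart_param [simp]: "u \<in> chart_image c \<Longrightarrow> snd c (chart_param c u) = u"
  by (rule f_inv_into_f)

lemma chart_param_in [simp]: "u \<in> chart_image c \<Longrightarrow> chart_param c u \<in> fst c"
  by (rule inv_into_into)

lemma continuous_chart: "c \<in> \<A> \<Longrightarrow> continuous_on (fst c) (snd c)"
  and continuous_chart_param: "c \<in> \<A> \<Longrightarrow> continuous_on (chart_image c) (chart_param c)"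
  using homeomorphism_chart by (auto simp: homeomorphism_def)

lemma chart_exists: obtains c where "c \<in> \<A>" "p \<in> fst c"
proof -
  have "p \<in> (\<Union>c\<in>\<A>. fst c)" using atlas by (simp add: smooth_atlas_def)
  then show ?thesis using that by blast
qed

lemma chart_at: "chart_at \<A> p \<in> \<A>" "p \<in> fst (chart_at \<A> p)"
  using someI_ex[of "\<lambda>c. c \<in> \<A> \<and> p \<in> fst c"] chart_exists unfolding chart_at_def by blast+

lemma chart_image_eq_vimage:
  assumes "c \<in> \<A>" "B \<subseteq> fst c"
  shows "snd c ` B = chart_param c -` B \<inter> chart_image c"
proof
  show "snd c ` B \<subseteq> chart_param c -` B \<inter> chart_image c" using assms by auto
  show "chart_param c -` B \<inter> chart_image c \<subseteq> snd c ` B"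
  proof
    fix u assume "u \<in> chart_param c -` B \<inter> chart_image c"
    then have "snd c (chart_param c u) = u" "chart_param c u \<in> B" by simp_all
    then show "u \<in> snd c ` B" by (rule image_eqI[OF sym])
  qed
qed

lemma open_image: "c \<in> \<A> \<Longrightarrow> open T \<Longrightarrow> T \<subseteq> fst c \<Longrightarrow> open (snd c ` T)"
  using continuous_open_preimage[OF continuous_chart_param open_chart_image, of c T]
    chart_image_eq_vimage[of c T] by (metis Int_commute)

lemma open_param_image: "c \<in> \<A> \<Longrightarrow> open V \<Longrightarrow> V \<subseteq> chart_image c \<Longrightarrow> open (chart_param c ` V)"
proof -
  assume *: "c \<in> \<A>" "open V" "V \<subseteq> chart_image c"
  have "chart_param c ` V = fst c \<inter> snd c -` V"
  proof
    show "chart_param c ` V \<subseteq> fst c \<inter> snd c -` V"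
    proof (rule image_subsetI)
      fix u assume "u \<in> V"
      moreover from this have "u \<in> chart_image c" using *(3) by (rule subsetD[rotated])
      ultimately show "chart_param c u \<in> fst c \<inter> snd c -` V" by simp
    qed
    show "fst c \<inter> snd c -` V \<subseteq> chart_param c ` V"
    proof
      fix p assume "p \<in> fst c \<inter> snd c -` V"
      then have "chart_param c (snd c p) = p" "snd c p \<in> V" using *(1) by simp_all
      then show "p \<in> chart_param c ` V" by (rule image_eqI[OF sym])
    qed
  qed
  then show ?thesis
    using continuous_open_preimage[OF continuous_chart[OF *(1)] open_domain[OF *(1)] *(2)] by simp
qed

lemma smooth_transition:
  "c \<in> \<A> \<Longrightarrow> d \<in> \<A> \<Longrightarrow> smooth_on (snd c ` (fst c \<inter> fst d)) (transition c d)"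
  using atlas by (simp add: smooth_atlas_def)

lemma open_overlap: "c \<in> \<A> \<Longrightarrow> d \<in> \<A> \<Longrightarrow> open (snd c ` (fst c \<inter> fst d))"
  by (intro open_image open_Int open_domain) auto

lemma continuous_on_charts:
  assumes "\<And>c. c \<in> \<A> \<Longrightarrow> continuous_on (chart_image c) (h \<circ> chart_param c)"
  shows "continuous_on UNIV h"
proof (rule continuous_at_imp_continuous_on, rule ballI)
  fix p
  obtain c where c: "c \<in> \<A>" "p \<in> fst c" by (rule chart_exists)
  have "continuous_on (fst c) (\<lambda>p. (h \<circ> chart_param c) (snd c p))"
    by (rule continuous_on_compose2[OF assms[OF c(1)] continuous_chart[OF c(1)]]) simp
  then have "continuous_on (fst c) h" using c(1) by (simp cong: continuous_on_cong)
  then show "isCont h p" using c open_domain by (simp add: continuous_on_eq_continuous_at)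
qed

lemma C1_function_continuous: "C1_function \<A> h \<Longrightarrow> continuous_on UNIV h"
  using C1_on_imp_continuous_on by (blast intro: continuous_on_charts)

lemma C1_function_smooth: "smooth_map \<A> h \<Longrightarrow> C1_function \<A> h"
  by (auto simp: smooth_map_def intro: smooth_on_imp_C1_on)

lemma smooth_x: "c \<in> \<A> \<Longrightarrow> smooth_on (chart_image c) (x \<circ> chart_param c)"
  using immersion by (simp add: immersion_def smooth_map_def)

lemma C1_x: "C1_function \<A> x"
  using smooth_x smooth_on_imp_C1_on by blast

lemma C1_differential_x: "c \<in> \<A> \<Longrightarrow> C1_on (chart_image c) (\<lambda>u. differential_in c x u v)"
  unfolding differential_in_def by (rule smooth_on_imp_C1_on_derivative[OF smooth_x])

lemma has_derivative_differential:
  assumes "C1_on (chart_image c) (h \<circ> chart_param c)" "u \<in> chart_image c"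
  shows "((h \<circ> chart_param c) has_derivative differential_in c h u) (at u)"
  unfolding differential_in_def by (rule C1_on_derivative[OF assms])

lemma linear_differential:
  assumes "C1_function \<A> h" "c \<in> \<A>" "u \<in> chart_image c"
  shows "linear (differential_in c h u)"
  using has_derivative_differential assms has_derivative_linear by blast

lemma inj_differential: "c \<in> \<A> \<Longrightarrow> u \<in> chart_image c \<Longrightarrow> inj (differential_in c x u)"
  using immersion unfolding immersion_def by blast

lemma differential_transition:
  assumes c: "c \<in> \<A>" and d: "d \<in> \<A>" and u: "u \<in> snd c ` (fst c \<inter> fst d)"
    and h: "C1_function \<A> h"
  shows "differential_in c h u v =
    differential_in d h (transition c d u) (fderiv (transition c d) u v)"
proof -
  have td: "transition c d u \<in> chart_image d" using c u by auto
  have 1: "(transition c d has_derivative fderiv (transition c d) u) (at u)"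
    by (rule C1_on_derivative[OF smooth_on_imp_C1_on[OF smooth_transition[OF c d]] u])
  have 2: "((h \<circ> chart_param d) has_derivative differential_in d h (transition c d u)) (at (transition c d u))"
    using has_derivative_differential h d td by blast
  have "((h \<circ> chart_param c) has_derivative
     (\<lambda>v. differential_in d h (transition c d u) (fderiv (transition c d) u v))) (at u)"
    by (rule has_derivative_transform_within_open[OF has_derivative_compose[OF 1 2] open_overlap[OF c d] u])
      (use c d in auto)
  then show ?thesis unfolding differential_in_def using frechet_derivative_at by metis
qed

section \<open>The induced metric\<close>

abbreviation frame :: "('a, 'm) chart \<Rightarrow> real^'m \<Rightarrow> 'm \<Rightarrow> real^'n" where
  "frame c u i \<equiv> differential_in c x u (axis i 1)"

abbreviation sqrt_det :: "('a, 'm) chart \<Rightarrow> real^'m \<Rightarrow> real" where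
  "sqrt_det c u \<equiv> sqrt (det (metric_matrix c x u))"

lemma metric_matrix_nth:
  "metric_matrix c x u $ i $ j = frame c u i \<bullet> frame c u j"
  by (simp add: metric_matrix_def)

lemma linear_basis_expansion:
  fixes D :: "real^'k \<Rightarrow> 'w::real_vector"
  assumes "linear D" shows "D v = (\<Sum>i\<in>UNIV. v $ i *\<^sub>R D (axis i 1))"
proof -
  have "D v = D (\<Sum>i\<in>UNIV. v $ i *\<^sub>R axis i 1)"
    using basis_expansion[of v] by (simp add: scalar_mult_eq_scaleR)
  then show ?thesis using assms by (simp add: linear_sum linear_cmul)
qed

lemma metric_matrix_mult:
  assumes "linear (differential_in c x u)"
  shows "(metric_matrix c x u *v w) $ i = frame c u i \<bullet> differential_in c x u w"
  by (subst linear_basis_expansion[OF assms, of w])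
    (simp add: matrix_vector_mult_def metric_matrix_nth inner_sum_right mult.commute)

lemma inner_metric_matrix:
  fixes c :: "('a, 'm) chart"
  assumes "linear (differential_in c x u)"
  shows "v \<bullet> (metric_matrix c x u *v w) = differential_in c x u v \<bullet> differential_in c x u w"
  by (subst linear_basis_expansion[OF assms, of v])
    (simp add: inner_vec_def[of v] metric_matrix_mult[OF assms] inner_sum_left)

lemma inner_differential_metric_solution:
  fixes c :: "('a, 'm) chart"
  assumes lin: "linear (differential_in c x u)" "linear \<phi>"
    and b: "metric_matrix c x u *v b = (\<chi> i. \<phi> (axis i 1))"
  shows "differential_in c x u b \<bullet> differential_in c x u v = \<phi> v"
proof -
  have "differential_in c x u b \<bullet> differential_in c x u v = v \<bullet> (metric_matrix c x u *v b)"
    unfolding inner_metric_matrix[OF lin(1)] by (rule inner_commute)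
  also have "\<dots> = \<phi> v"
    unfolding b by (subst linear_basis_expansion[OF lin(2), of v]) (simp add: inner_vec_def)
  finally show ?thesis .
qed

lemma transpose_metric_matrix:
  fixes c :: "('a, 'm) chart"
  shows "transpose (metric_matrix c x u) = metric_matrix c x u"
  by (simp add: transpose_def vec_eq_iff metric_matrix_nth inner_commute)

lemma C1_metric_matrix: "c \<in> \<A> \<Longrightarrow> C1_on (chart_image c) (\<lambda>u. metric_matrix c x u $ i $ j)"
  unfolding metric_matrix_nth by (intro C1_on_inner C1_differential_x)

text \<open>
  The segment from the identity to a positive definite matrix consists of injective matrices, so
  that the determinant keeps the sign that it has at the identity.
\<close>

lemma det_positive_definite:
  fixes G :: "real^'k^'k"
  assumes pos: "\<And>v. v \<noteq> 0 \<Longrightarrow> 0 < v \<bullet> (G *v v)"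
  shows "0 < det G"
proof (rule ccontr)
  assume neg: "\<not> 0 < det G"
  define M where "M t = (1 - t) *\<^sub>R mat 1 + t *\<^sub>R G" for t :: real
  have "continuous_on UNIV (\<lambda>t. det (M t))"
    unfolding det_def M_def by (auto intro!: continuous_intros)
  then have cont: "continuous_on {0..1} (\<lambda>t. det (M t))" using continuous_on_subset by blast
  have "\<exists>t\<ge>0. t \<le> 1 \<and> det (M t) = 0"
    using neg by (intro IVT2' cont) (simp_all add: M_def)
  then obtain t where t: "0 \<le> t" "t \<le> 1" "det (M t) = 0" by blast
  then obtain v where v: "v \<noteq> 0" "M t *v v = 0"
    using invertible_det_nz[of "M t"] matrix_left_invertible_ker[of "M t"] invertible_left_inverse[of "M t"]
    by blast
  have "v \<bullet> (M t *v v) = (1 - t) * (v \<bullet> v) + t * (v \<bullet> (G *v v))"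
    by (simp add: M_def matrix_vector_mult_add_rdistrib inner_add_right scaleR_matrix_vector_assoc[symmetric])
  moreover have "0 < (1 - t) * (v \<bullet> v) + t * (v \<bullet> (G *v v))"
  proof (cases "t = 0")
    case False
    then show ?thesis using t v(1) pos[OF v(1)]
      by (intro add_nonneg_pos mult_nonneg_nonneg mult_pos_pos) auto
  qed (use v(1) in simp)
  ultimately show False using v(2) by simp
qed

lemma det_metric_matrix_pos:
  assumes "c \<in> \<A>" "u \<in> chart_image c"
  shows "0 < det (metric_matrix c x u)"
proof (rule det_positive_definite)
  fix v :: "real^'m" assume "v \<noteq> 0"
  have lin: "linear (differential_in c x u)" by (rule linear_differential[OF C1_x assms])
  have "differential_in c x u v \<noteq> 0"
    using \<open>v \<noteq> 0\<close> inj_differential[OF assms] linear_injective_0[OF lin] by blast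
  then show "0 < v \<bullet> (metric_matrix c x u *v v)"
    by (simp add: inner_metric_matrix[OF lin])
qed

lemma invertible_metric_matrix: "c \<in> \<A> \<Longrightarrow> u \<in> chart_image c \<Longrightarrow> invertible (metric_matrix c x u)"
  using det_metric_matrix_pos[of c u] by (simp add: invertible_det_nz)

lemma C1_sqrt_det:
  "c \<in> \<A> \<Longrightarrow> C1_on (chart_image c) (\<lambda>u. sqrt_det c u)"
  by (intro C1_on_sqrt C1_on_det C1_metric_matrix det_metric_matrix_pos)

lemma metric_matrix_transition:
  fixes c d u
  defines "J \<equiv> matrix (fderiv (transition c d) u)"
  assumes c: "c \<in> \<A>" and d: "d \<in> \<A>" and u: "u \<in> snd c ` (fst c \<inter> fst d)"
  shows "metric_matrix c x u = transpose J ** metric_matrix d x (transition c d u) ** J"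
proof -
  let ?w = "transition c d u"
  have td: "?w \<in> chart_image d" using c u by auto
  have lin: "linear (differential_in d x ?w)" by (rule linear_differential[OF C1_x d td])
  have T: "linear (fderiv (transition c d) u)"
    by (rule has_derivative_linear[OF C1_on_derivative[OF smooth_on_imp_C1_on[OF smooth_transition[OF c d]] u]])
  have J: "fderiv (transition c d) u v = J *v v" for v
    unfolding J_def using matrix_vector_mul(2)[OF T] by metis
  have "metric_matrix c x u $ i $ j = (transpose J ** metric_matrix d x ?w ** J) $ i $ j" for i j
  proof -
    have "metric_matrix c x u $ i $ j = (J *v axis i 1) \<bullet> (metric_matrix d x ?w *v (J *v axis j 1))"
      unfolding metric_matrix_nth inner_metric_matrix[OF lin]
      by (simp only: differential_transition[OF c d u C1_x] J)
    also have "\<dots> = axis i 1 \<bullet> ((transpose J ** metric_matrix d x ?w ** J) *v axis j 1)"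
      by (simp only: dot_lmul_matrix[symmetric, of "axis i 1"] matrix_vector_mul_assoc[symmetric]
          vector_transpose_matrix)
    also have "\<dots> = (transpose J ** metric_matrix d x ?w ** J) $ i $ j"
      by (simp add: inner_axis' matrix_vector_mult_basis column_def)
    finally show ?thesis .
  qed
  then show ?thesis by (simp add: vec_eq_iff)
qed

lemma sqrt_det_metric_transition:
  assumes "c \<in> \<A>" "d \<in> \<A>" "u \<in> snd c ` (fst c \<inter> fst d)"
  shows "sqrt_det c u =
     \<bar>det (matrix (fderiv (transition c d) u))\<bar> * sqrt (det (metric_matrix d x (transition c d u)))"
  unfolding metric_matrix_transition[OF assms]
  by (simp add: det_mul det_transpose real_sqrt_mult mult.commute mult.left_commute)

section \<open>The Riemannian measure\<close>

text \<open>
  The indicator makes the density vanish where \<open>chart_param c\<close> carries no information, so that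
  integrals in a chart can be taken over the whole of \<open>real^'m\<close>.
\<close>

definition vol_density :: "('a, 'm) chart \<Rightarrow> real^'m \<Rightarrow> real" where
  "vol_density c u = indicator (chart_image c) u * sqrt_det c u"

definition chart_measure :: "('a, 'm) chart \<Rightarrow> 'a set \<Rightarrow> ennreal" where
  "chart_measure c B = (\<integral>\<^sup>+ u \<in> snd c ` B. ennreal (sqrt_det c u) \<partial>lborel)"

lemma vol_density_nonneg: "c \<in> \<A> \<Longrightarrow> 0 \<le> vol_density c u"
  using det_metric_matrix_pos[of c u] by (cases "u \<in> chart_image c") (auto simp: vol_density_def)

lemma measurable_vol_density: "c \<in> \<A> \<Longrightarrow> vol_density c \<in> borel_measurable borel"
  unfolding vol_density_def[abs_def]
  using borel_measurable_continuous_on_indicator[OF _ C1_on_imp_continuous_on[OF C1_sqrt_det]]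
    open_chart_image by simp

lemma sets_chart_image:
  assumes "c \<in> \<A>" "B \<in> sets borel" "B \<subseteq> fst c" shows "snd c ` B \<in> sets borel"
proof -
  have "chart_param c \<in> borel_measurable (restrict_space borel (chart_image c))"
    by (intro borel_measurable_continuous_on_restrict continuous_chart_param assms)
  from measurable_sets[OF this assms(2)] show ?thesis
    using open_chart_image[OF assms(1)]
    by (simp add: sets_restrict_space_iff space_restrict_space chart_image_eq_vimage[OF assms(1,3)] borel_open)
qed

lemma chart_measure_eq_emeasure:
  assumes "c \<in> \<A>" "B \<in> sets borel" "B \<subseteq> fst c"
  shows "chart_measure c B = emeasure (density lborel (\<lambda>u. ennreal (vol_density c u))) (snd c ` B)"
proof -
  have "chart_measure c B = (\<integral>\<^sup>+ u. ennreal (vol_density c u) * indicator (snd c ` B) u \<partial>lborel)"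
    unfolding chart_measure_def vol_density_def
    by (intro nn_integral_cong) (use assms(3) in \<open>auto simp: indicator_def\<close>)
  then show ?thesis using sets_chart_image[OF assms] measurable_vol_density[OF assms(1)]
    by (simp add: emeasure_density)
qed

lemma chart_measure_UN:
  fixes B :: "nat \<Rightarrow> 'a set"
  assumes c: "c \<in> \<A>" and B: "\<And>k. B k \<in> sets borel" "\<And>k. B k \<subseteq> fst c" and "disjoint_family B"
  shows "(\<Sum>k. chart_measure c (B k)) = chart_measure c (\<Union>k. B k)"
proof -
  have inj: "inj_on (snd c) (fst c)" by (rule inj_on_inverseI[of _ "chart_param c"]) (use c in simp)
  have "disjoint_family (\<lambda>k. snd c ` B k)"
    unfolding disjoint_family_on_def
  proof (intro ballI impI)
    fix k l :: nat assume "k \<noteq> l"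
    then have "B k \<inter> B l = {}" using \<open>disjoint_family B\<close> by (auto simp: disjoint_family_on_def)
    then show "snd c ` B k \<inter> snd c ` B l = {}"
      using inj_on_image_Int[OF inj B(2)[of k] B(2)[of l]] by simp
  qed
  moreover have "(\<Union>k. B k) \<subseteq> fst c" "(\<Union>k. B k) \<in> sets borel" using B by auto
  ultimately show ?thesis
    using suminf_emeasure[of "\<lambda>k. snd c ` B k" "density lborel (\<lambda>u. ennreal (vol_density c u))"]
    by (simp add: chart_measure_eq_emeasure[OF c] B image_UN sets_chart_image[OF c] image_subset_iff)
qed

text \<open>
  The density transforms with the Jacobian determinant of the transition map, so that the change of
  variables formula makes the local definitions of the volume agree where two charts overlap.
\<close>

lemma chart_measure_unique:
  assumes c: "c \<in> \<A>" and d: "d \<in> \<A>" and B: "B \<in> sets borel" "B \<subseteq> fst c \<inter> fst d"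
  shows "chart_measure c B = chart_measure d B"
proof -
  let ?V = "snd c ` (fst c \<inter> fst d)"
  let ?T = "transition c d"
  let ?q = "\<lambda>u. indicator ?V u * vol_density c u"
  have sub: "snd c ` B \<subseteq> ?V" using B by auto
  have img: "?T ` snd c ` B = snd d ` B"
    using B c by (auto simp: image_image subset_iff intro!: image_cong)
  have "(\<integral>\<^sup>+w\<in>?T ` snd c ` B. ennreal (vol_density d w) \<partial>lborel) = (\<integral>\<^sup>+u\<in>snd c ` B. ennreal (?q u) \<partial>lborel)"
  proof (rule nn_integral_change_of_variables)
    show "snd c ` B \<in> sets borel" "?T ` snd c ` B \<in> sets borel"
      unfolding img using B c d by (auto intro: sets_chart_image)
    show "vol_density d \<in> borel_measurable borel" "?q \<in> borel_measurable borel"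
      using measurable_vol_density c d open_overlap[OF c d] by (auto intro: borel_open)
    show "inj_on ?T (snd c ` B)"
    proof (rule inj_on_inverseI[of _ "transition d c"])
      fix u assume "u \<in> snd c ` B"
      then obtain p where "p \<in> B" "u = snd c p" by blast
      moreover from this have "p \<in> fst c" "p \<in> fst d" using B(2) by auto
      ultimately show "transition d c (?T u) = u" using c d by simp
    qed
    show "0 \<le> ?q u" "0 \<le> vol_density d w" for u w
      using vol_density_nonneg c d by (auto simp: indicator_def)
    fix u assume u: "u \<in> snd c ` B"
    then have uV: "u \<in> ?V" using sub by blast
    show "(?T has_derivative fderiv ?T u) (at u within snd c ` B)"
      by (rule has_derivative_at_withinI[OF C1_on_derivative[OF smooth_on_imp_C1_on[OF smooth_transition[OF c d]] uV]])
    have "?T u \<in> chart_image d" using uV c by auto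
    then show "?q u = \<bar>det (matrix (fderiv ?T u))\<bar> * vol_density d (?T u)"
      using uV sqrt_det_metric_transition[OF c d uV] by (auto simp: vol_density_def indicator_def)
  qed
  moreover have "chart_measure c B = (\<integral>\<^sup>+u\<in>snd c ` B. ennreal (?q u) \<partial>lborel)"
    unfolding chart_measure_def vol_density_def
    by (intro nn_integral_cong) (use sub in \<open>auto simp: indicator_def\<close>)
  moreover have "chart_measure d B = (\<integral>\<^sup>+w\<in>snd d ` B. ennreal (vol_density d w) \<partial>lborel)"
    unfolding chart_measure_def vol_density_def
    by (intro nn_integral_cong) (use B in \<open>auto simp: indicator_def\<close>)
  ultimately show ?thesis unfolding img by simp
qed

lemma countable_subatlas:
  obtains e :: "nat \<Rightarrow> ('a, 'm) chart" where "\<And>n. e n \<in> \<A>" "(\<Union>n. fst (e n)) = UNIV"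
proof -
  obtain \<F> where \<F>: "\<F> \<subseteq> fst ` \<A>" "countable \<F>" "\<Union>\<F> = \<Union>(fst ` \<A>)"
    by (rule Lindelof[of "fst ` \<A>"]) (auto intro: open_domain)
  obtain \<B> where \<B>: "countable \<B>" "\<B> \<subseteq> \<A>" "\<F> = fst ` \<B>"
    using \<F>(1,2) countable_subset_image by metis
  have cover: "(\<Union>c\<in>\<B>. fst c) = UNIV" using atlas \<F> \<B> by (auto simp: smooth_atlas_def)
  then have "\<B> \<noteq> {}" by auto
  then have *: "range (from_nat_into \<B>) = \<B>" using \<B>(1) by (rule range_from_nat_into)
  have "from_nat_into \<B> n \<in> \<A>" for n using from_nat_into[OF \<open>\<B> \<noteq> {}\<close>, of n] \<B>(2) by blast
  moreover have "(\<Union>n. fst (from_nat_into \<B> n)) = UNIV"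
    using cover by (subst image_image[symmetric, of fst]) (simp only: *)
  ultimately show ?thesis by (rule that)
qed

definition chart_partition :: "(nat \<Rightarrow> ('a, 'm) chart) \<Rightarrow> nat \<Rightarrow> 'a set" where
  "chart_partition e = disjointed (\<lambda>n. fst (e n))"

lemma chart_partition:
  assumes "\<And>n. e n \<in> \<A>" "(\<Union>n. fst (e n)) = UNIV"
  shows "disjoint_family (chart_partition e)" "(\<Union>n. chart_partition e n) = UNIV"
    "chart_partition e n \<subseteq> fst (e n)" "chart_partition e n \<in> sets borel"
proof -
  show "disjoint_family (chart_partition e)" "(\<Union>n. chart_partition e n) = UNIV"
    "chart_partition e n \<subseteq> fst (e n)"
    unfolding chart_partition_def
    using assms(2) disjointed_subset[of "\<lambda>n. fst (e n)"]
    by (simp_all add: disjoint_family_disjointed UN_disjointed_eq)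
  show "chart_partition e n \<in> sets borel"
    unfolding chart_partition_def disjointed_def
    using open_domain[OF assms(1)] by (auto intro!: borel_open sets.Diff sets.finite_UN)
qed

lemma suminf_swap_ennreal: "(\<Sum>i. \<Sum>j. f i j) = (\<Sum>j. \<Sum>i. f i j)" for f :: "nat \<Rightarrow> nat \<Rightarrow> ennreal"
  unfolding nn_integral_count_space_nat[symmetric, of "\<lambda>i. \<Sum>j. f i j"]
  by (subst nn_integral_suminf) (simp_all add: nn_integral_count_space_nat)

text \<open>
  The space is cut into countably many disjoint pieces, each inside the domain of a chart, and the
  volumes of the pieces are added up.  By \<open>chart_measure_unique\<close> the result does not depend on the
  chart in which a set is measured.
\<close>

lemma riemannian_measure_exists:
  "\<exists>\<mu>. sets \<mu> = sets borel \<and> (\<forall>c\<in>\<A>. \<forall>B\<in>sets borel. B \<subseteq> fst c \<longrightarrow> emeasure \<mu> B = chart_measure c B)"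
proof -
  obtain e :: "nat \<Rightarrow> ('a, 'm) chart" where e: "\<And>n. e n \<in> \<A>" "(\<Union>n. fst (e n)) = UNIV" by (rule countable_subatlas) (rule that)
  define P where "P = chart_partition e"
  note P = chart_partition[OF e, folded P_def]
  define \<nu> where "\<nu> B = (\<Sum>n. chart_measure (e n) (B \<inter> P n))" for B
  define \<mu> where "\<mu> = measure_of UNIV (sets borel) \<nu>"
  have \<mu>: "emeasure \<mu> B = \<nu> B" if "B \<in> sets borel" for B
    unfolding \<mu>_def
  proof (rule emeasure_measure_of_sigma[OF _ _ _ that])
    show "sigma_algebra UNIV (sets borel)"
      using sets.sigma_algebra_axioms[of borel] by simp
    show "positive (sets borel) \<nu>"
      by (simp add: positive_def \<nu>_def chart_measure_def)
    show "countably_additive (sets borel) \<nu>"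
      unfolding countably_additive_def
    proof (intro allI impI)
      fix F :: "nat \<Rightarrow> 'a set"
      assume F: "range F \<subseteq> sets borel" "disjoint_family F"
      have "(\<Sum>k. chart_measure (e n) (F k \<inter> P n)) = chart_measure (e n) ((\<Union>k. F k) \<inter> P n)" for n
        using F P(3)[of n] P(4)[of n] unfolding UN_extend_simps
        by (subst chart_measure_UN[OF e(1)]) (auto simp: disjoint_family_on_def)
      then show "(\<Sum>k. \<nu> (F k)) = \<nu> (\<Union>k. F k)"
        unfolding \<nu>_def by (subst suminf_swap_ennreal) simp
    qed
  qed
  have "emeasure \<mu> B = chart_measure c B" if c: "c \<in> \<A>" and B: "B \<in> sets borel" "B \<subseteq> fst c" for c B
  proof -
    have "emeasure \<mu> B = (\<Sum>n. chart_measure c (B \<inter> P n))"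
      unfolding \<mu>[OF B(1)] \<nu>_def
    proof (intro suminf_cong chart_measure_unique e(1) c sets.Int P(4) B(1))
      show "B \<inter> P n \<subseteq> fst (e n) \<inter> fst c" for n using B(2) P(3)[of n] by blast
    qed
    also have "\<dots> = chart_measure c (\<Union>n. B \<inter> P n)"
      using B P(1,4) by (intro chart_measure_UN[OF c]) (auto simp: disjoint_family_on_def)
    also have "(\<Union>n. B \<inter> P n) = B" using P(2) by auto
    finally show ?thesis .
  qed
  moreover have "sets \<mu> = sets borel"
    unfolding \<mu>_def using sets.sigma_sets_eq[of borel] by simp
  ultimately show ?thesis by blast
qed

lemma riemannian_measure_unique:
  assumes \<mu>: "sets \<mu> = sets borel" "\<And>c B. c \<in> \<A> \<Longrightarrow> B \<in> sets borel \<Longrightarrow> B \<subseteq> fst c \<Longrightarrow> emeasure \<mu> B = chart_measure c B"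
    and \<nu>: "sets \<nu> = sets borel" "\<And>c B. c \<in> \<A> \<Longrightarrow> B \<in> sets borel \<Longrightarrow> B \<subseteq> fst c \<Longrightarrow> emeasure \<nu> B = chart_measure c B"
  shows "\<mu> = \<nu>"
proof (rule measure_eqI)
  obtain e :: "nat \<Rightarrow> ('a, 'm) chart" where e: "\<And>n. e n \<in> \<A>" "(\<Union>n. fst (e n)) = UNIV" by (rule countable_subatlas) (rule that)
  define P where "P = chart_partition e"
  note P = chart_partition[OF e, folded P_def]
  fix B assume "B \<in> sets \<mu>"
  then have B: "B \<in> sets borel" using \<mu>(1) by simp
  have *: "emeasure M B = (\<Sum>n. emeasure M (B \<inter> P n))" if "sets M = sets borel" for M
  proof -
    have "range (\<lambda>n. B \<inter> P n) \<subseteq> sets M" using P(4) B that by auto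
    moreover have "disjoint_family (\<lambda>n. B \<inter> P n)"
      using P(1) unfolding disjoint_family_on_def by blast
    ultimately have "(\<Sum>n. emeasure M (B \<inter> P n)) = emeasure M (\<Union>n. B \<inter> P n)"
      by (rule suminf_emeasure)
    also have "(\<Union>n. B \<inter> P n) = B" using P(2) by blast
    finally show ?thesis ..
  qed
  have "emeasure \<mu> (B \<inter> P n) = emeasure \<nu> (B \<inter> P n)" for n
    using P(3)[of n] P(4)[of n] B \<mu>(2)[OF e(1)[of n]] \<nu>(2)[OF e(1)[of n]] by (metis le_infI2 sets.Int)
  then show "emeasure \<mu> B = emeasure \<nu> B" using *[OF \<mu>(1)] *[OF \<nu>(1)] by simp
qed (simp add: \<mu>(1) \<nu>(1))

abbreviation vol :: "'a measure" where "vol \<equiv> riemannian_measure \<A> x"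

lemma sets_vol [measurable_cong, simp]: "sets vol = sets borel"
  and emeasure_vol: "c \<in> \<A> \<Longrightarrow> B \<in> sets borel \<Longrightarrow> B \<subseteq> fst c \<Longrightarrow> emeasure vol B = chart_measure c B"
proof -
  let ?P = "\<lambda>\<mu>. sets \<mu> = sets borel \<and>
    (\<forall>c\<in>\<A>. \<forall>B\<in>sets borel. B \<subseteq> fst c \<longrightarrow> emeasure \<mu> B = chart_measure c B)"
  have "\<exists>!\<mu>. ?P \<mu>"
  proof (rule ex_ex1I[OF riemannian_measure_exists])
    fix \<mu> \<nu> assume "?P \<mu>" "?P \<nu>"
    then show "\<mu> = \<nu>" by (intro riemannian_measure_unique) blast+
  qed
  from theI'[OF this] have "?P vol"
    unfolding riemannian_measure_def chart_measure_def .
  then show "sets vol = sets borel"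
    and "c \<in> \<A> \<Longrightarrow> B \<in> sets borel \<Longrightarrow> B \<subseteq> fst c \<Longrightarrow> emeasure vol B = chart_measure c B"
    by blast+
qed

lemma space_vol [simp]: "space vol = UNIV"
  using sets_eq_imp_space_eq[OF sets_vol] by simp

lemma measurable_chart_param: "c \<in> \<A> \<Longrightarrow> chart_param c \<in> borel_measurable borel"
proof -
  assume c: "c \<in> \<A>"
  \<comment> \<open>Outside the image of the chart, \<^const>\<open>inv_into\<close> has one constant value.\<close>
  have off: "chart_param c u = (SOME y. False)" if "u \<notin> chart_image c" for u
    using that unfolding inv_into_def by (metis (mono_tags, lifting) imageI)
  have "chart_param c \<in> borel_measurable (restrict_space borel (chart_image c))"
    by (intro borel_measurable_continuous_on_restrict continuous_chart_param c)
  then have "(\<lambda>u. if u \<in> chart_image c then chart_param c u else (SOME y. False)) \<in> borel_measurable borel"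
    using open_chart_image[OF c] by (subst measurable_restrict_space_iff[symmetric]) auto
  also have "(\<lambda>u. if u \<in> chart_image c then chart_param c u else (SOME y. False)) = chart_param c"
    using off by auto
  finally show ?thesis .
qed

text \<open>
  The restriction of the volume to the domain of a chart is the image of a measure on \<open>real^'m\<close>; this
  turns integrals of functions that are supported in the domain into Lebesgue integrals.
\<close>

lemma density_vol_chart:
  assumes c: "c \<in> \<A>"
  shows "density vol (indicator (fst c)) = distr (density lborel (\<lambda>u. ennreal (vol_density c u))) borel (chart_param c)"
proof (rule measure_eqI)
  fix B assume "B \<in> sets (density vol (indicator (fst c)))"
  then have B: "B \<in> sets borel" by simp
  have dom: "fst c \<in> sets borel" using open_domain[OF c] by simp
  have "emeasure (density vol (indicator (fst c))) B = emeasure vol (fst c \<inter> B)"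
    using B dom by (subst emeasure_density) (simp_all add: indicator_inter_arith[symmetric])
  also have "\<dots> = emeasure (density lborel (\<lambda>u. ennreal (vol_density c u))) (snd c ` (fst c \<inter> B))"
    using B dom c by (simp add: emeasure_vol chart_measure_eq_emeasure)
  also have "\<dots> = (\<integral>\<^sup>+u. ennreal (vol_density c u) * indicator (chart_param c -` B) u \<partial>lborel)"
  proof (subst emeasure_density)
    show "snd c ` (fst c \<inter> B) \<in> sets lborel" using B dom c by (auto intro: sets_chart_image)
    show "(\<integral>\<^sup>+u. ennreal (vol_density c u) * indicator (snd c ` (fst c \<inter> B)) u \<partial>lborel)
      = (\<integral>\<^sup>+u. ennreal (vol_density c u) * indicator (chart_param c -` B) u \<partial>lborel)"
    proof (intro nn_integral_cong)
      fix u
      have "u \<in> snd c ` (fst c \<inter> B) \<longleftrightarrow> u \<in> chart_param c -` B" if "u \<in> chart_image c"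
        using that chart_image_eq_vimage[OF c, of "fst c \<inter> B"] by auto
      then show "ennreal (vol_density c u) * indicator (snd c ` (fst c \<inter> B)) u
          = ennreal (vol_density c u) * indicator (chart_param c -` B) u"
        by (cases "u \<in> chart_image c") (simp_all add: vol_density_def indicator_def)
    qed
  qed (use measurable_vol_density[OF c] in simp)
  also have "\<dots> = emeasure (distr (density lborel (\<lambda>u. ennreal (vol_density c u))) borel (chart_param c)) B"
    using B measurable_vol_density[OF c] measurable_chart_param[OF c] measurable_sets[OF measurable_chart_param[OF c] B]
    by (subst emeasure_distr) (simp_all add: emeasure_density)
  finally show "emeasure (density vol (indicator (fst c))) B
      = emeasure (distr (density lborel (\<lambda>u. ennreal (vol_density c u))) borel (chart_param c)) B" .
qed simp

lemma
  fixes h :: "'a \<Rightarrow> real"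
  assumes c: "c \<in> \<A>" and h: "h \<in> borel_measurable borel" and supp: "\<And>p. p \<notin> fst c \<Longrightarrow> h p = 0"
  shows integrable_chart: "integrable vol h \<longleftrightarrow> integrable lborel (\<lambda>u. vol_density c u * h (chart_param c u))"
    and integral_chart: "(\<integral>p. h p \<partial>vol) = (\<integral>u. vol_density c u * h (chart_param c u) \<partial>lborel)"
proof -
  have dens: "density vol (\<lambda>p. ennreal (indicator (fst c) p)) = density vol (indicator (fst c))"
    by (simp add: ennreal_indicator[abs_def])
  have hm: "h \<in> borel_measurable vol" using h by simp
  have ind: "(\<lambda>p. indicator (fst c) p *\<^sub>R h p) = h" by (rule ext) (use supp in \<open>auto simp: indicator_def\<close>)
  have dom: "fst c \<in> sets borel" using open_domain[OF c] by simp
  have hp: "(\<lambda>u. h (chart_param c u)) \<in> borel_measurable borel"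
    by (rule measurable_compose[OF measurable_chart_param[OF c] h])
  have "integrable vol h \<longleftrightarrow> integrable (density vol (\<lambda>p. ennreal (indicator (fst c) p))) h"
    using hm dom by (subst integrable_density) (simp_all only: ind, simp_all)
  also have "\<dots> \<longleftrightarrow> integrable (density lborel (\<lambda>u. ennreal (vol_density c u))) (\<lambda>u. h (chart_param c u))"
    unfolding dens density_vol_chart[OF c]
    using measurable_chart_param[OF c] h by (subst integrable_distr_eq) simp_all
  also have "\<dots> \<longleftrightarrow> integrable lborel (\<lambda>u. vol_density c u * h (chart_param c u))"
    using hp measurable_vol_density[OF c] vol_density_nonneg[OF c] by (subst integrable_density) simp_all
  finally show "integrable vol h \<longleftrightarrow> integrable lborel (\<lambda>u. vol_density c u * h (chart_param c u))" .
  have "(\<integral>p. h p \<partial>vol) = (\<integral>p. h p \<partial>density vol (\<lambda>p. ennreal (indicator (fst c) p)))"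
    using hm dom by (subst integral_density) (simp_all only: ind, simp_all)
  also have "\<dots> = (\<integral>u. h (chart_param c u) \<partial>density lborel (\<lambda>u. ennreal (vol_density c u)))"
    unfolding dens density_vol_chart[OF c]
    using measurable_chart_param[OF c] h by (subst integral_distr) simp_all
  also have "\<dots> = (\<integral>u. vol_density c u * h (chart_param c u) \<partial>lborel)"
    using hp measurable_vol_density[OF c] vol_density_nonneg[OF c] by (subst integral_density) simp_all
  finally show "(\<integral>p. h p \<partial>vol) = (\<integral>u. vol_density c u * h (chart_param c u) \<partial>lborel)" .
qed

lemma param_image_subset: "L \<subseteq> chart_image c \<Longrightarrow> chart_param c ` L \<subseteq> fst c"
  by (intro image_subsetI chart_param_in) (rule subsetD)

lemma chart_param_image: "L \<subseteq> chart_image c \<Longrightarrow> snd c ` chart_param c ` L = L"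
proof -
  assume "L \<subseteq> chart_image c"
  then have "snd c ` chart_param c ` L = (\<lambda>u. u) ` L"
    unfolding image_image by (intro image_cong refl chart_chart_param) (rule subsetD)
  then show ?thesis by simp
qed

lemma compact_in_chart:
  assumes "c \<in> \<A>" "compact L" "L \<subseteq> chart_image c"
  shows "compact (chart_param c ` L)"
  using assms by (intro compact_continuous_image continuous_on_subset[OF continuous_chart_param])

lemma emeasure_compact_in_chart:
  assumes c: "c \<in> \<A>" and L: "compact L" "L \<subseteq> chart_image c"
  shows "emeasure vol (chart_param c ` L) < \<infinity>"
proof -
  let ?W = "\<lambda>u. sqrt_det c u"
  note sub = param_image_subset[OF L(2)] and img = chart_param_image[OF L(2)]
  have W: "continuous_on L ?W"
    using C1_on_imp_continuous_on[OF C1_sqrt_det[OF c]] L(2) continuous_on_subset by blast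
  have "closed (chart_param c ` L)" by (rule compact_imp_closed[OF compact_in_chart[OF assms]])
  then have "emeasure vol (chart_param c ` L) = chart_measure c (chart_param c ` L)"
    by (intro emeasure_vol[OF c _ sub]) (rule borel_closed)
  also have "\<dots> = (\<integral>\<^sup>+u\<in>L. ennreal (?W u) \<partial>lborel)"
    unfolding chart_measure_def img ..
  also have "\<dots> = (\<integral>\<^sup>+u. ennreal (indicator L u *\<^sub>R ?W u) \<partial>lborel)"
    by (intro nn_integral_cong) (simp add: indicator_def)
  also have "\<dots> \<le> (\<integral>\<^sup>+u. ennreal (norm (indicator L u *\<^sub>R ?W u)) \<partial>lborel)"
    by (intro nn_integral_mono ennreal_leI) simp
  also have "\<dots> < \<infinity>"
    using borel_integrable_compact[OF L(1) W] by (simp only: integrable_iff_bounded)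
  finally show ?thesis .
qed

lemma coordinate_ball:
  obtains c r where "c \<in> \<A>" "p \<in> fst c" "0 < r" "cball (snd c p) r \<subseteq> chart_image c"
    "open (chart_param c ` ball (snd c p) r)" "p \<in> chart_param c ` ball (snd c p) r"
proof -
  obtain c where c: "c \<in> \<A>" "p \<in> fst c" by (rule chart_exists)
  then obtain r where r: "0 < r" "cball (snd c p) r \<subseteq> chart_image c"
    using open_contains_cball open_chart_image by (metis imageI)
  have "p = chart_param c (snd c p)" using c by simp
  then have "p \<in> chart_param c ` ball (snd c p) r" using r(1) by (metis centre_in_ball imageI)
  moreover have "open (chart_param c ` ball (snd c p) r)"
    using r(2) ball_subset_cball[of "snd c p" r] by (intro open_param_image c open_ball) (rule subset_trans)
  ultimately show ?thesis using that c r by blast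
qed

lemma emeasure_compact:
  assumes "compact K" shows "emeasure vol K < \<infinity>"
proof -
  have "\<exists>T Q. open T \<and> p \<in> T \<and> T \<subseteq> Q \<and> compact Q \<and> emeasure vol Q < \<infinity>" for p
  proof -
    obtain c r where c: "c \<in> \<A>" "p \<in> fst c" "0 < r" "cball (snd c p) r \<subseteq> chart_image c"
      "open (chart_param c ` ball (snd c p) r)" "p \<in> chart_param c ` ball (snd c p) r"
      by (rule coordinate_ball)
    have "chart_param c ` ball (snd c p) r \<subseteq> chart_param c ` cball (snd c p) r"
      by (intro image_mono ball_subset_cball)
    then show ?thesis
      using c emeasure_compact_in_chart[OF c(1) compact_cball c(4)] compact_in_chart[OF c(1) compact_cball c(4)]
      by blast
  qed
  then obtain T Q where TQ: "\<And>p. open (T p)" "\<And>p. p \<in> T p" "\<And>p. T p \<subseteq> Q p" "\<And>p. compact (Q p)"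
      "\<And>p. emeasure vol (Q p) < \<infinity>"
    by metis
  obtain D where D: "D \<subseteq> K" "finite D" "K \<subseteq> (\<Union>p\<in>D. T p)"
    using compactE_image[OF assms, of K T] TQ(1,2) by (metis UN_I subsetI)
  have sets: "Q p \<in> sets vol" for p using TQ(4)[of p] by (simp add: compact_imp_closed)
  have "emeasure vol K \<le> emeasure vol (\<Union>p\<in>D. Q p)"
  proof (rule emeasure_mono)
    show "K \<subseteq> (\<Union>p\<in>D. Q p)" using D(3) TQ(3) by blast
    show "(\<Union>p\<in>D. Q p) \<in> sets vol" using D(2) sets by (intro sets.finite_UN) auto
  qed
  also have "\<dots> \<le> (\<Sum>p\<in>D. emeasure vol (Q p))"
    using sets by (intro emeasure_subadditive_finite D(2)) auto
  also have "\<dots> < \<infinity>" using D(2) TQ(5) by (induction D rule: finite_induct) simp_all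
  finally show ?thesis .
qed

lemma integrable_compact_support:
  fixes h :: "'a \<Rightarrow> real"
  assumes "continuous_on UNIV h" "compact K" "\<And>p. p \<notin> K \<Longrightarrow> h p = 0"
  shows "integrable vol h"
proof -
  have "bounded (h ` K)"
    by (rule compact_imp_bounded[OF compact_continuous_image[OF continuous_on_subset[OF assms(1)] assms(2)]]) simp
  then obtain B where "\<And>p. p \<in> K \<Longrightarrow> norm (h p) \<le> B"
    unfolding bounded_iff by auto
  moreover have "h \<in> borel_measurable vol"
    using borel_measurable_continuous_onI[OF assms(1)] by (simp cong: measurable_cong_sets)
  ultimately show ?thesis
    using assms by (intro integrableI_bounded_set[of K _ h B] emeasure_compact)
      (auto intro: compact_imp_closed borel_closed)
qed

lemma emeasure_open_pos:
  assumes "open T" "T \<noteq> {}" shows "0 < emeasure vol T"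
proof -
  obtain p where p: "p \<in> T" using assms by blast
  obtain c where c: "c \<in> \<A>" "p \<in> fst c" by (rule chart_exists)
  let ?S = "snd c ` (T \<inter> fst c)"
  have S: "open ?S" "?S \<noteq> {}" "?S \<subseteq> chart_image c"
    using assms p c open_domain[OF c(1)] by (auto intro!: open_image)
  have Sb: "?S \<in> sets lborel" using S(1) by simp
  have "emeasure vol (T \<inter> fst c) \<noteq> 0"
  proof
    assume "emeasure vol (T \<inter> fst c) = 0"
    then have "emeasure (density lborel (\<lambda>u. ennreal (vol_density c u))) ?S = 0"
      using c assms(1) open_domain[OF c(1)] by (simp add: emeasure_vol chart_measure_eq_emeasure borel_open)
    then have "AE u in lborel. ennreal (vol_density c u) * indicator ?S u = 0"
      using Sb measurable_vol_density[OF c(1)] by (simp add: emeasure_density nn_integral_0_iff_AE)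
    then have "AE u in lborel. u \<notin> ?S"
    proof eventually_elim
      case (elim u)
      show ?case
      proof
        assume u: "u \<in> ?S"
        then have "0 < vol_density c u"
          using S(3) det_metric_matrix_pos[OF c(1), of u] by (auto simp: vol_density_def)
        then show False using elim u by simp
      qed
    qed
    then have "?S \<in> null_sets lborel" using AE_iff_null_sets[OF Sb] by simp
    then have "negligible ?S" by (simp add: negligible_iff_null_sets null_sets_completionI)
    then show False using open_not_negligible S by blast
  qed
  then have "0 < emeasure vol (T \<inter> fst c)" by (simp add: zero_less_iff_neq_zero)
  also have "\<dots> \<le> emeasure vol T" using assms(1) by (intro emeasure_mono) auto
  finally show ?thesis .
qed

end


context immersed_manifold
begin

section \<open>Tangential and normal parts\<close>

lemma differential_transition_point:
  assumes "c \<in> \<A>" "d \<in> \<A>" "p \<in> fst c" "p \<in> fst d" "C1_function \<A> h"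
  shows "differential_in c h (snd c p) v =
    differential_in d h (snd d p) (fderiv (transition c d) (snd c p) v)"
  using differential_transition[OF assms(1,2) _ assms(5), of "snd c p" v] assms(1,3,4) by simp

lemma tangent_space_chart:
  assumes "c \<in> \<A>" "p \<in> fst c"
  shows "tangent_space \<A> x p = range (differential_in c x (snd c p))"
proof -
  have sub: "range (differential_in c x (snd c p)) \<subseteq> range (differential_in d x (snd d p))"
    if "c \<in> \<A>" "d \<in> \<A>" "p \<in> fst c" "p \<in> fst d" for c d
    using differential_transition_point[OF that C1_x] by (intro image_subsetI) simp
  show ?thesis unfolding tangent_space_def
    by (intro equalityI sub assms chart_at)
qed

text \<open>The coordinates of the orthogonal projection of an ambient vector to the tangent space.\<close>

definition tangent_coords :: "('a, 'm) chart \<Rightarrow> real^'m \<Rightarrow> real^'n \<Rightarrow> real^'m" where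
  "tangent_coords c u w = matrix_inv (metric_matrix c x u) *v (\<chi> i. frame c u i \<bullet> w)"

lemma metric_matrix_tangent_coords:
  assumes "c \<in> \<A>" "u \<in> chart_image c"
  shows "metric_matrix c x u *v tangent_coords c u w = (\<chi> i. frame c u i \<bullet> w)"
  unfolding tangent_coords_def
  by (simp add: matrix_vector_mul_assoc matrix_inv_invertible[OF invertible_metric_matrix[OF assms]])

lemma zero_in_tangent_space: "0 \<in> tangent_space \<A> x p"
  unfolding tangent_space_def
  using linear_0[OF linear_differential[OF C1_x chart_at(1)]] chart_at by (metis imageI rangeI)

lemma inner_differential_tangent_coords:
  assumes "c \<in> \<A>" "u \<in> chart_image c"
  shows "differential_in c x u v \<bullet> differential_in c x u (tangent_coords c u w) = differential_in c x u v \<bullet> w"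
proof -
  have lin: "linear (differential_in c x u)" by (rule linear_differential[OF C1_x assms])
  show ?thesis
    unfolding inner_metric_matrix[OF lin, symmetric] metric_matrix_tangent_coords[OF assms]
    by (subst linear_basis_expansion[OF lin, of v]) (simp add: inner_vec_def[of v] inner_sum_left)
qed

lemma normal_proj_chart:
  assumes c: "c \<in> \<A>" and p: "p \<in> fst c"
  shows "normal_proj \<A> x p w = w - differential_in c x (snd c p) (tangent_coords c (snd c p) w)"
  unfolding normal_proj_def
proof (rule the_equality)
  let ?D = "differential_in c x (snd c p)" and ?a = "tangent_coords c (snd c p) w"
  have u: "snd c p \<in> chart_image c" using p by simp
  have lin: "linear ?D" by (rule linear_differential[OF C1_x c u])
  note T = tangent_space_chart[OF c p]
  show "w - ?D ?a \<in> orthogonal_comp (tangent_space \<A> x p) \<and> w - (w - ?D ?a) \<in> tangent_space \<A> x p"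
    unfolding T by (auto simp: orthogonal_comp_def orthogonal_def inner_diff_right
        inner_differential_tangent_coords[OF c u])
  fix n assume n: "n \<in> orthogonal_comp (tangent_space \<A> x p) \<and> w - n \<in> tangent_space \<A> x p"
  then obtain v where v: "w - n = ?D v" unfolding T by auto
  have orth: "?D v' \<bullet> n = 0" for v' using n unfolding T by (auto simp: orthogonal_comp_def orthogonal_def)
  have "n - (w - ?D ?a) = ?D (?a - v)"
    using v by (simp add: linear_diff[OF lin] algebra_simps)
  moreover have "?D (?a - v) \<bullet> (n - (w - ?D ?a)) = 0"
    using orth by (simp add: inner_diff_right inner_differential_tangent_coords[OF c u])
  ultimately have "(n - (w - ?D ?a)) \<bullet> (n - (w - ?D ?a)) = 0" by simp
  then show "n = w - ?D ?a" by simp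
qed

lemma inner_differential_normal_proj:
  assumes c: "c \<in> \<A>" and p: "p \<in> fst c"
  shows "differential_in c x (snd c p) v \<bullet> normal_proj \<A> x p w = 0"
  using inner_differential_tangent_coords[OF c, of "snd c p"] p
  by (simp add: normal_proj_chart[OF c p] inner_diff_right)

lemma inner_normal_proj_normal_proj:
  "normal_proj \<A> x p w \<bullet> normal_proj \<A> x p w' = w \<bullet> normal_proj \<A> x p w'"
proof -
  obtain c where c: "c \<in> \<A>" "p \<in> fst c" by (rule chart_exists)
  show ?thesis
    by (subst normal_proj_chart[OF c, of w])
      (simp add: inner_diff_left inner_differential_normal_proj[OF c])
qed

definition tangential :: "'a \<Rightarrow> real^'n" where
  "tangential p = x p - normal_proj \<A> x p (x p)"

definition position_coords :: "('a, 'm) chart \<Rightarrow> real^'m \<Rightarrow> real^'m" where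
  "position_coords c u = tangent_coords c u (x (chart_param c u))"

lemma tangential_chart:
  assumes "c \<in> \<A>" "u \<in> chart_image c"
  shows "tangential (chart_param c u) = differential_in c x u (position_coords c u)"
  using normal_proj_chart[OF assms(1) chart_param_in[OF assms(2)]] assms(2)
  by (simp add: tangential_def position_coords_def)

lemma tangential_expansion:
  assumes "c \<in> \<A>" "u \<in> chart_image c"
  shows "(\<Sum>k\<in>UNIV. position_coords c u $ k *\<^sub>R frame c u k) = (tangential \<circ> chart_param c) u"
  unfolding o_apply tangential_chart[OF assms]
  by (rule linear_basis_expansion[OF linear_differential[OF C1_x assms], symmetric])

text \<open>
  By Cramer's rule the coordinates are quotients of determinants of functions of class C1.
\<close>

lemma C1_position_coords:
  assumes c: "c \<in> \<A>"
  shows "C1_on (chart_image c) (\<lambda>u. position_coords c u $ k)"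
proof -
  let ?M = "\<lambda>u. \<chi> i j. if j = k then frame c u i \<bullet> x (chart_param c u)
      else metric_matrix c x u $ i $ j"
  have C1: "C1_on (chart_image c) (\<lambda>u. x (chart_param c u))"
    using C1_x c by (simp add: o_def)
  have "C1_on (chart_image c) (\<lambda>u. det (?M u) / det (metric_matrix c x u))"
  proof (intro C1_on_divide C1_on_det C1_metric_matrix c)
    show "C1_on (chart_image c) (\<lambda>u. ?M u $ i $ j)" for i j
    proof (cases "j = k")
      case True
      then show ?thesis by (simp add: C1_on_inner[OF C1_differential_x[OF c] C1])
    next
      case False
      then show ?thesis by (simp add: C1_metric_matrix[OF c])
    qed
    show "det (metric_matrix c x u) \<noteq> 0" if "u \<in> chart_image c" for u
      using det_metric_matrix_pos[OF c that] by simp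
  qed
  then show ?thesis
  proof (rule C1_on_cong[OF open_chart_image[OF c]])
    fix u assume u: "u \<in> chart_image c"
    then have "det (metric_matrix c x u) \<noteq> 0" using det_metric_matrix_pos[OF c] by fastforce
    from cramer[OF this, THEN iffD1, OF metric_matrix_tangent_coords[OF c u]]
    show "det (?M u) / det (metric_matrix c x u) = position_coords c u $ k"
      by (simp add: position_coords_def cong: if_cong)
  qed
qed

lemma C1_tangential: "C1_function \<A> tangential"
proof
  fix c assume c: "c \<in> \<A>"
  have "C1_on (chart_image c) (\<lambda>u. \<Sum>k\<in>UNIV. position_coords c u $ k *\<^sub>R frame c u k)"
    by (intro C1_on_sum C1_on_scaleR C1_position_coords C1_differential_x c)
  then show "C1_on (chart_image c) (tangential \<circ> chart_param c)"
    by (rule C1_on_cong[OF open_chart_image[OF c]]) (rule tangential_expansion[OF c])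
qed

section \<open>The gradient\<close>

lemma gradient_chart:
  assumes h: "C1_function \<A> h" and c: "c \<in> \<A>" and p: "p \<in> fst c"
  shows "gradient \<A> x h p \<in> tangent_space \<A> x p"
    and "gradient \<A> x h p \<bullet> differential_in c x (snd c p) v = differential_in c h (snd c p) v"
proof -
  let ?d = "chart_at \<A> p"
  let ?P = "\<lambda>w. w \<in> tangent_space \<A> x p \<and>
     (\<forall>v. w \<bullet> differential_in ?d x (snd ?d p) v = differential_in ?d h (snd ?d p) v)"
  have u: "snd ?d p \<in> chart_image ?d" using chart_at by simp
  let ?D = "differential_in ?d x (snd ?d p)" and ?H = "differential_in ?d h (snd ?d p)"
    and ?G = "metric_matrix ?d x (snd ?d p)"
  have lin: "linear ?D" "linear ?H"
    by (rule linear_differential[OF C1_x chart_at(1) u], rule linear_differential[OF h chart_at(1) u])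
  define b where "b = matrix_inv ?G *v (\<chi> i. ?H (axis i 1))"
  have Gb: "?G *v b = (\<chi> i. ?H (axis i 1))" unfolding b_def
    by (simp add: matrix_vector_mul_assoc matrix_inv_invertible[OF invertible_metric_matrix[OF chart_at(1) u]])
  have "?D b \<bullet> ?D v = ?H v" for v by (rule inner_differential_metric_solution[OF lin Gb])
  then have ex: "?P (?D b)" by (simp add: tangent_space_def)
  have "?P (THE w. ?P w)"
  proof (rule theI[of ?P, OF ex])
    fix w assume w: "?P w"
    then obtain b' where b': "w = ?D b'" unfolding tangent_space_def by auto
    have "(?D b' - ?D b) \<bullet> ?D (b' - b) = 0"
      using w ex unfolding b' by (simp add: inner_diff_left)
    then show "w = ?D b" unfolding b' by (simp add: linear_diff[OF lin(1)])
  qed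
  then have P: "?P (gradient \<A> x h p)" unfolding gradient_def Let_def .
  then show "gradient \<A> x h p \<in> tangent_space \<A> x p" by blast
  show "gradient \<A> x h p \<bullet> differential_in c x (snd c p) v = differential_in c h (snd c p) v"
    unfolding differential_transition_point[OF c chart_at(1) p chart_at(2) C1_x]
      differential_transition_point[OF c chart_at(1) p chart_at(2) h]
    using P by simp
qed

lemma gradient_unique:
  assumes h: "C1_function \<A> h" and c: "c \<in> \<A>" and p: "p \<in> fst c"
    and w: "w \<in> tangent_space \<A> x p"
      "\<And>v. w \<bullet> differential_in c x (snd c p) v = differential_in c h (snd c p) v"
  shows "gradient \<A> x h p = w"
proof -
  have u: "snd c p \<in> chart_image c" using p by simp
  have lin: "linear (differential_in c x (snd c p))" by (rule linear_differential[OF C1_x c u])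
  obtain v where v: "gradient \<A> x h p = differential_in c x (snd c p) v"
    using gradient_chart(1)[OF h c p] tangent_space_chart[OF c p] by auto
  obtain v' where v': "w = differential_in c x (snd c p) v'"
    using w(1) tangent_space_chart[OF c p] by auto
  have "(gradient \<A> x h p - w) \<bullet> differential_in c x (snd c p) (v - v') = 0"
    using gradient_chart(2)[OF h c p] w(2) by (simp add: inner_diff_left)
  then have "(gradient \<A> x h p - w) \<bullet> (gradient \<A> x h p - w) = 0"
    by (simp add: v v' linear_diff[OF lin])
  then show ?thesis by simp
qed

lemma inner_gradient_tangential:
  assumes "C1_function \<A> h" "c \<in> \<A>" "u \<in> chart_image c"
  shows "gradient \<A> x h (chart_param c u) \<bullet> tangential (chart_param c u)
    = differential_in c h u (position_coords c u)"
  using gradient_chart(2)[OF assms(1,2) chart_param_in[OF assms(3)]] assms(3)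
  by (simp add: tangential_chart[OF assms(2,3)])

lemma gradient_eq_0:
  assumes h: "C1_function \<A> h" and "open T" "p \<in> T" "\<And>q. q \<in> T \<Longrightarrow> h q = 0"
  shows "gradient \<A> x h p = 0"
proof -
  obtain c where c: "c \<in> \<A>" "p \<in> fst c" by (rule chart_exists)
  let ?V = "snd c ` (T \<inter> fst c)"
  have V: "open ?V" using assms(2) c open_domain by (intro open_image open_Int) auto
  have "((h \<circ> chart_param c) has_derivative (\<lambda>_. 0)) (at (snd c p))"
  proof (rule has_derivative_transform_within_open[of "\<lambda>_. 0", OF _ V])
    show "0 = (h \<circ> chart_param c) u" if "u \<in> ?V" for u using that c assms(4) by auto
  qed (use c assms(3) in auto)
  then have D: "differential_in c h (snd c p) = (\<lambda>_. 0)"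
    unfolding differential_in_def by (rule frechet_derivative_at[symmetric])
  show ?thesis
  proof (rule gradient_unique[OF h c])
    show "0 \<in> tangent_space \<A> x p" by (rule zero_in_tangent_space)
  qed (simp add: D)
qed

section \<open>The divergence of the tangential position vector\<close>

text \<open>
  The trace over the tangent space of the differential of an ambient vector field along the
  hypersurface.
\<close>

definition tangential_divergence :: "('a, 'm) chart \<Rightarrow> ('a \<Rightarrow> real^'n) \<Rightarrow> real^'m \<Rightarrow> real" where
  "tangential_divergence c Y u = trace (matrix_inv (metric_matrix c x u) **
     (\<chi> i j. differential_in c Y u (axis i 1) \<bullet> frame c u j))"

lemma matrix_inv_eq:
  fixes A :: "real^'k^'k"
  assumes "A ** B = mat 1" shows "matrix_inv A = B"
proof -
  have inv: "invertible A" using assms invertible_right_inverse by blast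
  have "matrix_inv A ** (A ** B) = matrix_inv A" by (simp add: assms)
  then show ?thesis unfolding matrix_mul_assoc matrix_inv_invertible[OF inv] by simp
qed

text \<open>
  The metric matrix and the matrix of inner products transform in the same way, with the Jacobian
  matrix on both sides, so that the Jacobian matrices cancel in the trace.
\<close>

lemma tangential_divergence_transition:
  assumes c: "c \<in> \<A>" and d: "d \<in> \<A>" and u: "u \<in> snd c ` (fst c \<inter> fst d)" and Y: "C1_function \<A> Y"
  shows "tangential_divergence c Y u = tangential_divergence d Y (transition c d u)"
proof -
  let ?w = "transition c d u"
  define J where "J = matrix (fderiv (transition c d) u)"
  define Gc Gd where "Gc = metric_matrix c x u" and "Gd = metric_matrix d x ?w"
  define Mc where "Mc = (\<chi> i j. differential_in c Y u (axis i 1) \<bullet> frame c u j)"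
  define Md where "Md = (\<chi> i j. differential_in d Y ?w (axis i 1) \<bullet> differential_in d x ?w (axis j 1))"
  have uc: "u \<in> chart_image c" and wd: "?w \<in> chart_image d" using c u by auto
  have T: "linear (fderiv (transition c d) u)"
    by (rule has_derivative_linear[OF C1_on_derivative[OF smooth_on_imp_C1_on[OF smooth_transition[OF c d]] u]])
  have J: "fderiv (transition c d) u (axis i 1) $ k = J $ k $ i" for i k
    by (simp add: J_def matrix_def)
  have G: "Gc = transpose J ** Gd ** J"
    unfolding Gc_def Gd_def J_def by (rule metric_matrix_transition[OF c d u])
  have M: "Mc = transpose J ** Md ** J"
  proof -
    have D: "differential_in c h u (axis i 1) = (\<Sum>k\<in>UNIV. J $ k $ i *\<^sub>R differential_in d h ?w (axis k 1))"
      if "C1_function \<A> h" for h :: "'a \<Rightarrow> real^'n" and i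
      unfolding differential_transition[OF c d u that] J[symmetric]
      by (rule linear_basis_expansion[OF linear_differential[OF that d wd]])
    show ?thesis
      unfolding Mc_def Md_def
      by (simp add: vec_eq_iff D[OF Y] D[OF C1_x] matrix_matrix_mult_def transpose_def
          inner_sum_left inner_sum_right sum_distrib_left sum_distrib_right mult_ac)
  qed
  have "det J \<noteq> 0"
    using det_metric_matrix_pos[OF c uc, folded Gc_def] unfolding G by (auto simp: det_mul)
  then have "invertible J" by (simp add: invertible_det_nz)
  define K where "K = matrix_inv J"
  have K: "J ** K = mat 1" "K ** J = mat 1"
    unfolding K_def by (rule matrix_inv_invertible[OF \<open>invertible J\<close>])+
  have tK: "transpose K ** transpose J = mat 1" "transpose J ** transpose K = mat 1"
    using K by (simp_all add: matrix_transpose_mul[symmetric])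
  define P where "P = matrix_inv Gd"
  have P: "Gd ** P = mat 1"
    unfolding P_def Gd_def by (rule matrix_inv_invertible[OF invertible_metric_matrix[OF d wd]])
  have "Gc ** (K ** P ** transpose K) = transpose J ** (Gd ** ((J ** K) ** P)) ** transpose K"
    unfolding G by (simp only: matrix_mul_assoc)
  also have "\<dots> = mat 1" by (simp add: K P tK)
  finally have "matrix_inv Gc = K ** P ** transpose K" by (rule matrix_inv_eq)
  then have "matrix_inv Gc ** Mc = K ** (P ** ((transpose K ** transpose J) ** Md)) ** J"
    unfolding M by (simp only: matrix_mul_assoc)
  then have "trace (matrix_inv Gc ** Mc) = trace (J ** (K ** (P ** Md)))"
    unfolding tK matrix_mul_lid by (simp only: trace_mul_sym[of "K ** (P ** Md)" J])
  also have "\<dots> = trace (P ** Md)" by (simp add: matrix_mul_assoc K)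
  finally show ?thesis
    unfolding tangential_divergence_def Gc_def Gd_def Mc_def Md_def P_def .
qed

lemma matrix_inv_metric_sym:
  assumes "c \<in> \<A>" "u \<in> chart_image c"
  shows "matrix_inv (metric_matrix c x u) $ i $ j = matrix_inv (metric_matrix c x u) $ j $ i"
proof -
  let ?G = "metric_matrix c x u" and ?P = "matrix_inv (metric_matrix c x u)"
  have "?G ** transpose ?P = transpose (?P ** ?G)"
    by (simp add: matrix_transpose_mul transpose_metric_matrix)
  also have "\<dots> = mat 1" by (simp add: matrix_inv_invertible[OF invertible_metric_matrix[OF assms]])
  finally have "?P = transpose ?P" by (rule matrix_inv_eq)
  then have "?P $ i $ j = transpose ?P $ i $ j" by simp
  then show ?thesis by (simp add: transpose_def)
qed

abbreviation second_partial :: "('a, 'm) chart \<Rightarrow> real^'m \<Rightarrow> 'm \<Rightarrow> 'm \<Rightarrow> real^'n" where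
  "second_partial c u i j \<equiv> fderiv (\<lambda>u. frame c u j) u (axis i 1)"

lemma second_partial_commute:
  "c \<in> \<A> \<Longrightarrow> u \<in> chart_image c \<Longrightarrow> second_partial c u i j = second_partial c u j i"
  unfolding differential_in_def by (rule mixed_derivatives_commute[OF open_chart_image _ smooth_x])

lemma second_partial_has_derivative:
  "c \<in> \<A> \<Longrightarrow> u \<in> chart_image c \<Longrightarrow> ((\<lambda>u. frame c u j) has_derivative
     fderiv (\<lambda>u. frame c u j) u) (at u)"
  by (rule C1_on_derivative[OF C1_differential_x])

text \<open>
  The differential of the identity has trace \<open>m\<close>; the normal part of the position vector contributes
  its inner product with the trace of the second derivatives, because it is orthogonal to the
  coordinate vectors.
\<close>

lemma tangential_divergence_tangential_chart:
  assumes c: "c \<in> \<A>" and p: "p \<in> fst c"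
  shows "tangential_divergence c tangential (snd c p) = real CARD('m) +
    (\<Sum>i\<in>UNIV. \<Sum>j\<in>UNIV. matrix_inv (metric_matrix c x (snd c p)) $ i $ j *
       (second_partial c (snd c p) i j \<bullet> normal_proj \<A> x p (x p)))"
proof -
  let ?u = "snd c p"
  let ?N = "\<lambda>u. normal_proj \<A> x (chart_param c u) (x (chart_param c u))"
  let ?G = "metric_matrix c x ?u" and ?P = "matrix_inv (metric_matrix c x ?u)"
  have u: "?u \<in> chart_image c" using p by simp
  have x': "((\<lambda>u. x (chart_param c u)) has_derivative differential_in c x ?u) (at ?u)"
    using has_derivative_differential[OF _ u, of x] C1_x c by (simp add: o_def)
  have t': "((\<lambda>u. tangential (chart_param c u)) has_derivative differential_in c tangential ?u) (at ?u)"
    using has_derivative_differential[OF _ u, of tangential] C1_tangential c by (simp add: o_def)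
  have N': "(?N has_derivative (\<lambda>v. differential_in c x ?u v - differential_in c tangential ?u v)) (at ?u)"
    using has_derivative_diff[OF x' t'] by (simp add: tangential_def)
  have M: "differential_in c tangential ?u (axis i 1) \<bullet> frame c ?u j
      = ?G $ i $ j + second_partial c ?u i j \<bullet> normal_proj \<A> x p (x p)" for i j
  proof -
    have "((\<lambda>u. ?N u \<bullet> frame c u j) has_derivative
       (\<lambda>v. ?N ?u \<bullet> fderiv (\<lambda>u. frame c u j) ?u v +
         (differential_in c x ?u v - differential_in c tangential ?u v) \<bullet> frame c ?u j)) (at ?u)"
      by (rule has_derivative_inner[OF N' second_partial_has_derivative[OF c u]])
    moreover have "((\<lambda>u. ?N u \<bullet> frame c u j) has_derivative (\<lambda>_. 0)) (at ?u)"
    proof (rule has_derivative_transform_within_open[of "\<lambda>_. 0", OF _ open_chart_image[OF c] u])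
      show "0 = ?N u \<bullet> frame c u j" if "u \<in> chart_image c" for u
        using inner_differential_normal_proj[OF c chart_param_in[OF that]] that by (simp add: inner_commute)
    qed simp
    ultimately have "?N ?u \<bullet> second_partial c ?u i j +
         (frame c ?u i - differential_in c tangential ?u (axis i 1)) \<bullet> frame c ?u j = 0"
      by (metis (no_types, lifting) has_derivative_unique)
    then show ?thesis
      using c p by (simp add: inner_diff_left metric_matrix_nth inner_commute algebra_simps)
  qed
  have "tangential_divergence c tangential ?u = trace (?P ** ?G) +
     (\<Sum>i\<in>UNIV. \<Sum>j\<in>UNIV. ?P $ i $ j * (second_partial c ?u j i \<bullet> normal_proj \<A> x p (x p)))"
    unfolding tangential_divergence_def M trace_def
    by (simp add: matrix_matrix_mult_def distrib_left sum.distrib)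
  also have "trace (?P ** ?G) = real CARD('m)"
    by (simp add: matrix_inv_invertible[OF invertible_metric_matrix[OF c u]] trace_I)
  finally show ?thesis by (simp add: second_partial_commute[OF c u])
qed

text \<open>
  In Jacobi's formula both factors of the inner products in the metric matrix are differentiated.  As
  the inverse matrix is symmetric, the two contributions are equal, and the square root takes half of
  their sum.
\<close>

lemma sqrt_det_derivative:
  assumes c: "c \<in> \<A>" and u: "u \<in> chart_image c"
  shows "fderiv (\<lambda>u. sqrt_det c u) u (axis k 1) =
    sqrt_det c u * (\<Sum>i\<in>UNIV. \<Sum>j\<in>UNIV. matrix_inv (metric_matrix c x u) $ i $ j *
       (second_partial c u k j \<bullet> frame c u i))"
proof -
  let ?G = "metric_matrix c x u" and ?P = "matrix_inv (metric_matrix c x u)"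
  let ?E = "\<lambda>i. frame c u i"
  let ?E' = "\<lambda>i. fderiv (\<lambda>u. frame c u i) u"
  define G' where "G' v = (\<chi> i j. ?E i \<bullet> ?E' j v + ?E' i v \<bullet> ?E j)" for v
  have "((\<lambda>u. metric_matrix c x u $ i $ j) has_derivative (\<lambda>v. G' v $ i $ j)) (at u)" for i j
    unfolding metric_matrix_nth G'_def
    using has_derivative_inner[OF second_partial_has_derivative[OF c u] second_partial_has_derivative[OF c u], of i j]
    by simp
  then have "((\<lambda>u. det (metric_matrix c x u)) has_derivative (\<lambda>v. det ?G * trace (?P ** G' v))) (at u)"
    by (rule has_derivative_det[where M = "metric_matrix c x" and M' = G',
          OF _ invertible_metric_matrix[OF c u]])
  from has_derivative_real_sqrt[OF det_metric_matrix_pos[OF c u] this]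
  have "((\<lambda>u. sqrt_det c u) has_derivative
      (\<lambda>v. (1 / (sqrt (det ?G) * 2)) * (det ?G * trace (?P ** G' v)))) (at u)"
    by (simp add: field_simps)
  then have "fderiv (\<lambda>u. sqrt_det c u) u (axis k 1)
    = (1 / (sqrt (det ?G) * 2)) * (det ?G * trace (?P ** G' (axis k 1)))"
    by (simp only: frechet_derivative_at[symmetric])
  also have "\<dots> = sqrt (det ?G) * (trace (?P ** G' (axis k 1)) / 2)"
  proof -
    have *: "(1 / (w * 2)) * (d * t) = w * (t / 2)" if "d = w * w" "w \<noteq> 0" for w d t :: real
      using that by (simp add: field_simps)
    show ?thesis by (rule *) (use det_metric_matrix_pos[OF c u] in simp_all)
  qed
  also have "trace (?P ** G' (axis k 1)) =
     (\<Sum>i\<in>UNIV. \<Sum>j\<in>UNIV. ?P $ i $ j * (?E' j (axis k 1) \<bullet> ?E i)) +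
     (\<Sum>i\<in>UNIV. \<Sum>j\<in>UNIV. ?P $ i $ j * (?E' i (axis k 1) \<bullet> ?E j))"
    unfolding trace_def G'_def
    by (simp add: matrix_matrix_mult_def distrib_left sum.distrib inner_commute)
  also have "(\<Sum>i\<in>UNIV. \<Sum>j\<in>UNIV. ?P $ i $ j * (?E' i (axis k 1) \<bullet> ?E j)) =
     (\<Sum>i\<in>UNIV. \<Sum>j\<in>UNIV. ?P $ i $ j * (?E' j (axis k 1) \<bullet> ?E i))"
    by (subst sum.swap) (simp add: matrix_inv_metric_sym[OF c u])
  finally show ?thesis by simp
qed

text \<open>
  The coordinate formula for the divergence of the tangential position vector.  The derivatives of
  the density and the Christoffel terms of the trace are the same second derivatives of the
  immersion, taken in the opposite order.
\<close>

lemma divergence_chart: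
  assumes c: "c \<in> \<A>" and u: "u \<in> chart_image c"
  shows "(\<Sum>k\<in>UNIV. fderiv (\<lambda>u. sqrt_det c u * position_coords c u $ k) u (axis k 1))
    = sqrt_det c u * tangential_divergence c tangential u"
proof -
  let ?W = "\<lambda>u. sqrt_det c u"
  let ?G = "metric_matrix c x u" and ?P = "matrix_inv (metric_matrix c x u)"
  let ?E = "\<lambda>i. frame c u i"
  let ?a = "\<lambda>k u. position_coords c u $ k"
  let ?a' = "\<lambda>k. fderiv (?a k) u"
  have a': "(?a k has_derivative ?a' k) (at u)" for k
    by (rule C1_on_derivative[OF C1_position_coords[OF c] u])
  have W': "(?W has_derivative fderiv ?W u) (at u)"
    by (rule C1_on_derivative[OF C1_sqrt_det[OF c] u])
  have prod: "fderiv (\<lambda>u. ?W u * ?a k u) u v = ?W u * ?a' k v + fderiv ?W u v * ?a k u" for k v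
    unfolding frechet_derivative_at[OF has_derivative_mult[OF W' a'], symmetric] ..
  have t: "((\<lambda>u. \<Sum>k\<in>UNIV. ?a k u *\<^sub>R frame c u k) has_derivative
      (\<lambda>v. \<Sum>k\<in>UNIV. ?a k u *\<^sub>R fderiv (\<lambda>u. frame c u k) u v + ?a' k v *\<^sub>R ?E k)) (at u)"
    by (intro has_derivative_sum has_derivative_scaleR a' second_partial_has_derivative[OF c u])
  have "((tangential \<circ> chart_param c) has_derivative
      (\<lambda>v. \<Sum>k\<in>UNIV. ?a k u *\<^sub>R fderiv (\<lambda>u. frame c u k) u v + ?a' k v *\<^sub>R ?E k)) (at u)"
    by (rule has_derivative_transform_within_open[OF t open_chart_image[OF c] u]) (rule tangential_expansion[OF c])
  then have "differential_in c tangential u v =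
      (\<Sum>k\<in>UNIV. ?a k u *\<^sub>R fderiv (\<lambda>u. frame c u k) u v + ?a' k v *\<^sub>R ?E k)" for v
    unfolding differential_in_def by (simp only: frechet_derivative_at[symmetric])
  then have M: "differential_in c tangential u (axis j 1) \<bullet> ?E i =
      (\<Sum>k\<in>UNIV. ?a k u * (second_partial c u j k \<bullet> ?E i)) + (\<Sum>k\<in>UNIV. ?a' k (axis j 1) * ?G $ k $ i)" for i j
    by (simp add: inner_sum_left inner_add_left sum.distrib metric_matrix_nth)
  have "tangential_divergence c tangential u = (\<Sum>i\<in>UNIV. \<Sum>j\<in>UNIV. ?P $ i $ j * (differential_in c tangential u (axis j 1) \<bullet> ?E i))"
    unfolding tangential_divergence_def trace_def by (simp add: matrix_matrix_mult_def)
  also have "\<dots> = (\<Sum>i\<in>UNIV. \<Sum>j\<in>UNIV. \<Sum>k\<in>UNIV. ?a k u * (?P $ i $ j * (second_partial c u j k \<bullet> ?E i)))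
     + (\<Sum>i\<in>UNIV. \<Sum>j\<in>UNIV. \<Sum>k\<in>UNIV. ?a' k (axis j 1) * (?G $ k $ i * ?P $ i $ j))"
    unfolding M by (simp add: distrib_left sum.distrib sum_distrib_left mult_ac)
  also have "(\<Sum>i\<in>UNIV. \<Sum>j\<in>UNIV. \<Sum>k\<in>UNIV. ?a k u * (?P $ i $ j * (second_partial c u j k \<bullet> ?E i)))
     = (\<Sum>k\<in>UNIV. ?a k u * (\<Sum>i\<in>UNIV. \<Sum>j\<in>UNIV. ?P $ i $ j * (second_partial c u k j \<bullet> ?E i)))"
  proof -
    have "(\<Sum>i\<in>UNIV. \<Sum>j\<in>UNIV. \<Sum>k\<in>UNIV. ?a k u * (?P $ i $ j * (second_partial c u j k \<bullet> ?E i)))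
       = (\<Sum>i\<in>UNIV. \<Sum>k\<in>UNIV. \<Sum>j\<in>UNIV. ?a k u * (?P $ i $ j * (second_partial c u k j \<bullet> ?E i)))"
    proof (rule sum.cong[OF refl])
      fix i
      show "(\<Sum>j\<in>UNIV. \<Sum>k\<in>UNIV. ?a k u * (?P $ i $ j * (second_partial c u j k \<bullet> ?E i)))
       = (\<Sum>k\<in>UNIV. \<Sum>j\<in>UNIV. ?a k u * (?P $ i $ j * (second_partial c u k j \<bullet> ?E i)))"
        by (subst sum.swap) (simp add: second_partial_commute[OF c u])
    qed
    also have "\<dots> = (\<Sum>k\<in>UNIV. \<Sum>i\<in>UNIV. \<Sum>j\<in>UNIV. ?a k u * (?P $ i $ j * (second_partial c u k j \<bullet> ?E i)))"
      by (rule sum.swap)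
    finally show ?thesis by (simp add: sum_distrib_left)
  qed
  also have "(\<Sum>i\<in>UNIV. \<Sum>j\<in>UNIV. \<Sum>k\<in>UNIV. ?a' k (axis j 1) * (?G $ k $ i * ?P $ i $ j)) = (\<Sum>k\<in>UNIV. ?a' k (axis k 1))"
  proof -
    have "(\<Sum>i\<in>UNIV. \<Sum>j\<in>UNIV. \<Sum>k\<in>UNIV. ?a' k (axis j 1) * (?G $ k $ i * ?P $ i $ j))
      = (\<Sum>j\<in>UNIV. \<Sum>i\<in>UNIV. \<Sum>k\<in>UNIV. ?a' k (axis j 1) * (?G $ k $ i * ?P $ i $ j))"
      by (rule sum.swap)
    also have "\<dots> = (\<Sum>j\<in>UNIV. \<Sum>k\<in>UNIV. ?a' k (axis j 1) * (?G ** ?P) $ k $ j)"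
      by (rule sum.cong[OF refl], subst sum.swap) (simp add: matrix_matrix_mult_def sum_distrib_left)
    also have "\<dots> = (\<Sum>j\<in>UNIV. ?a' j (axis j 1))"
      by (simp add: matrix_inv_invertible[OF invertible_metric_matrix[OF c u]] mat_def if_distrib cong: if_cong)
    finally show ?thesis .
  qed
  finally have "?W u * tangential_divergence c tangential u =
     (\<Sum>k\<in>UNIV. ?W u * (?a k u * (\<Sum>i\<in>UNIV. \<Sum>j\<in>UNIV. ?P $ i $ j * (second_partial c u k j \<bullet> ?E i))))
     + (\<Sum>k\<in>UNIV. ?W u * ?a' k (axis k 1))"
    by (simp only: distrib_left sum_distrib_left[symmetric])
  also have "\<dots> = (\<Sum>k\<in>UNIV. fderiv (\<lambda>u. ?W u * ?a k u) u (axis k 1))"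
    unfolding sum.distrib[symmetric] prod sqrt_det_derivative[OF c u]
    by (intro sum.cong refl) (simp only: mult_ac add_ac)
  finally show ?thesis ..
qed

end


section \<open>The first variation identity of a self-expander\<close>

locale self_expanding_hypersurface = immersed_manifold \<A> x
  for \<A> :: "('a::{t2_space, second_countable_topology}, 'm::finite) chart set"
    and x :: "'a \<Rightarrow> real^'n::finite" +
  assumes codimension: "CARD('n) = CARD('m) + 1"
    and expander: "mean_curvature_vector \<A> x p = normal_proj \<A> x p (x p)"
begin

abbreviation normal_part :: "'a \<Rightarrow> real^'n" where
  "normal_part p \<equiv> normal_proj \<A> x p (x p)"

lemma tangential_divergence_tangential:
  assumes c: "c \<in> \<A>" and u: "u \<in> chart_image c"
  shows "tangential_divergence c tangential u = real CARD('m) + (norm (normal_part (chart_param c u)))\<^sup>2"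
proof -
  define p where "p = chart_param c u"
  define d where "d = chart_at \<A> p"
  have d: "d \<in> \<A>" "p \<in> fst d" unfolding d_def by (rule chart_at)+
  have p: "p \<in> fst c" "snd c p = u" using u by (simp_all add: p_def)
  have "tangential_divergence c tangential u = tangential_divergence d tangential (snd d p)"
  proof -
    have "u \<in> snd c ` (fst c \<inter> fst d)" using p d(2) by (intro image_eqI[of _ _ p]) auto
    from tangential_divergence_transition[OF c d(1) this C1_tangential] show ?thesis
      by (simp add: p_def)
  qed
  also have "\<dots> = real CARD('m) + (\<Sum>i\<in>UNIV. \<Sum>j\<in>UNIV. matrix_inv (metric_matrix d x (snd d p)) $ i $ j *
       (second_partial d (snd d p) i j \<bullet> normal_part p))"
    by (rule tangential_divergence_tangential_chart[OF d])
  also have "(\<Sum>i\<in>UNIV. \<Sum>j\<in>UNIV. matrix_inv (metric_matrix d x (snd d p)) $ i $ j *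
       (second_partial d (snd d p) i j \<bullet> normal_part p)) = mean_curvature_vector \<A> x p \<bullet> normal_part p"
    unfolding mean_curvature_vector_def second_fundamental_form_def Let_def d_def[symmetric]
    by (simp add: inner_sum_left inner_normal_proj_normal_proj)
  finally show ?thesis by (simp add: expander p_def power2_norm_eq_inner)
qed

text \<open>
  The normal space is spanned by the unit normal, as the codimension is one.
\<close>

lemma scalar_mean_curvature_power2:
  assumes \<nu>: "unit_normal \<A> x \<nu>"
  shows "(scalar_mean_curvature \<A> x \<nu> p)\<^sup>2 = (norm (normal_part p))\<^sup>2"
proof -
  obtain c where c: "c \<in> \<A>" "p \<in> fst c" by (rule chart_exists)
  let ?T = "tangent_space \<A> x p"
  let ?S = "{y \<in> UNIV. \<forall>t\<in>?T. orthogonal t y}"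
  have u: "snd c p \<in> chart_image c" using c by simp
  have lin: "linear (differential_in c x (snd c p))" by (rule linear_differential[OF C1_x c(1) u])
  have T: "?T = range (differential_in c x (snd c p))" by (rule tangent_space_chart[OF c])
  have "dim ?T = CARD('m)"
    using dim_image_eq[OF lin, of UNIV] inj_differential[OF c(1) u] by (simp add: T)
  moreover have subT: "subspace ?T" unfolding T using linear_subspace_image[OF lin subspace_UNIV] .
  ultimately have dimS: "dim ?S = 1"
    using dim_subspace_orthogonal_to_vectors[OF subT subspace_UNIV] codimension by simp
  have \<nu>p: "norm (\<nu> p) = 1" "\<nu> p \<in> ?S"
    using \<nu> by (auto simp: unit_normal_def orthogonal_comp_def)
  have subS: "subspace ?S"
    by (auto simp: subspace_def orthogonal_def inner_add_right)
  have "span {\<nu> p} = ?S"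
  proof (rule subspace_dim_equal)
    show "span {\<nu> p} \<subseteq> ?S" using \<nu>p(2) subS by (intro span_minimal) auto
    have "\<nu> p \<noteq> 0" using \<nu>p(1) by auto
    then show "dim ?S \<le> dim (span {\<nu> p})" unfolding dimS by (simp add: dim_singleton)
  qed (simp_all only: subspace_span subS)
  moreover have "normal_part p \<in> ?S"
    unfolding T by (auto simp: orthogonal_def inner_differential_normal_proj[OF c])
  ultimately have "normal_part p \<in> span {\<nu> p}" by blast
  then obtain k where "normal_part p = k *\<^sub>R \<nu> p" by (auto simp: span_singleton)
  then show ?thesis using \<nu>p(1)
    by (simp add: scalar_mean_curvature_def expander power_mult_distrib dot_square_norm)
qed

text \<open>
  The integrand of the first variation identity.
\<close>

definition variation_density :: "('a \<Rightarrow> real) \<Rightarrow> 'a \<Rightarrow> real" where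
  "variation_density g p =
     (real CARD('m) + (norm (normal_part p))\<^sup>2) * g p + gradient \<A> x g p \<bullet> tangential p"

lemma variation_density_chart:
  assumes "C1_function \<A> g" "c \<in> \<A>" "u \<in> chart_image c"
  shows "variation_density g (chart_param c u) =
    tangential_divergence c tangential u * g (chart_param c u) + differential_in c g u (position_coords c u)"
  by (simp add: variation_density_def tangential_divergence_tangential[OF assms(2,3)]
      inner_gradient_tangential[OF assms])

lemma continuous_normal_part: "continuous_on UNIV normal_part"
proof -
  have "continuous_on UNIV (\<lambda>p. x p - tangential p)"
    by (intro continuous_on_diff C1_function_continuous C1_x C1_tangential)
  then show ?thesis by (simp add: tangential_def)
qed

lemma continuous_gradient_tangential:
  assumes g: "C1_function \<A> g"
  shows "continuous_on UNIV (\<lambda>p. gradient \<A> x g p \<bullet> tangential p)"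
proof (rule continuous_on_charts)
  fix c assume c: "c \<in> \<A>"
  have "continuous_on (chart_image c) (\<lambda>u. \<Sum>k\<in>UNIV. position_coords c u $ k *\<^sub>R differential_in c g u (axis k 1))"
    unfolding differential_in_def
    by (intro continuous_on_sum continuous_on_scaleR C1_on_imp_continuous_on[OF C1_position_coords[OF c]]
        C1_on_continuous_derivative) (use g c in blast)
  moreover have "(\<Sum>k\<in>UNIV. position_coords c u $ k *\<^sub>R differential_in c g u (axis k 1))
      = ((\<lambda>p. gradient \<A> x g p \<bullet> tangential p) \<circ> chart_param c) u" if u: "u \<in> chart_image c" for u
    unfolding o_apply inner_gradient_tangential[OF g c u]
    by (rule linear_basis_expansion[OF linear_differential[OF g c u], symmetric])
  ultimately show "continuous_on (chart_image c) ((\<lambda>p. gradient \<A> x g p \<bullet> tangential p) \<circ> chart_param c)"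
    by (rule continuous_on_eq)
qed

lemma continuous_variation_density:
  "C1_function \<A> g \<Longrightarrow> continuous_on UNIV (variation_density g)"
  unfolding variation_density_def[abs_def]
  by (intro continuous_on_add continuous_on_mult continuous_on_power continuous_on_norm
      continuous_on_const continuous_normal_part continuous_gradient_tangential C1_function_continuous)

lemma variation_density_eq_0:
  assumes "C1_function \<A> g" "closed K" "\<And>q. q \<notin> K \<Longrightarrow> g q = 0" "p \<notin> K"
  shows "variation_density g p = 0"
  using gradient_eq_0[OF assms(1), of "- K" p] assms by (simp add: variation_density_def open_Compl)

lemma integrable_variation_density:
  assumes "C1_function \<A> g" "compact K" "\<And>q. q \<notin> K \<Longrightarrow> g q = 0"
  shows "integrable vol (variation_density g)"
  using assms by (intro integrable_compact_support continuous_variation_density variation_density_eq_0)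
    (auto intro: compact_imp_closed)

text \<open>
  In one chart the density of the integrand is the divergence of a vector field of class C1 with
  compact support.
\<close>

lemma first_variation_chart:
  assumes g: "C1_function \<A> g" and c: "c \<in> \<A>" and L: "compact L" "L \<subseteq> chart_image c"
    and zero: "\<And>q. q \<notin> chart_param c ` L \<Longrightarrow> g q = 0"
  shows "(\<integral>p. variation_density g p \<partial>vol) = 0"
proof -
  let ?W = "\<lambda>u. sqrt_det c u"
  let ?g = "\<lambda>u. g (chart_param c u)"
  define F where "F k u = (if u \<in> chart_image c then ?W u * position_coords c u $ k * ?g u else 0)" for k u
  have gC1: "C1_on (chart_image c) ?g" using g c by (simp add: o_def)
  have WaC1: "C1_on (chart_image c) (\<lambda>u. ?W u * position_coords c u $ k)" for k
    by (intro C1_on_mult C1_sqrt_det C1_position_coords c)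
  note img = chart_param_image[OF L(2)]
  have g0: "?g u = 0" if "u \<in> chart_image c" "u \<notin> L" for u
  proof (rule zero)
    show "chart_param c u \<notin> chart_param c ` L"
    proof
      assume "chart_param c u \<in> chart_param c ` L"
      then have "snd c (chart_param c u) \<in> L" using img by blast
      then show False using that by simp
    qed
  qed
  have F0: "F k u = 0" if "u \<notin> L" for k u using g0 that by (auto simp: F_def)
  have FC1: "C1_on UNIV (F k)" for k
  proof (rule C1_on_local)
    fix u :: "real^'m"
    show "\<exists>T. open T \<and> u \<in> T \<and> C1_on T (F k)"
    proof (cases "u \<in> chart_image c")
      case True
      have "C1_on (chart_image c) (F k)"
        by (rule C1_on_cong[OF open_chart_image[OF c] C1_on_mult[OF WaC1[of k] gC1]]) (simp add: F_def)
      then show ?thesis using True open_chart_image[OF c] by (intro exI[of _ "chart_image c"] conjI)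
    next
      case False
      have op: "open (- L)" using L(1) by (simp add: compact_imp_closed open_Compl)
      moreover have "C1_on (- L) (F k)"
        by (rule C1_on_cong[OF op C1_on_const[of _ 0]]) (simp add: F0)
      moreover have "u \<in> - L" using False L(2) by auto
      ultimately show ?thesis by (intro exI[of _ "- L"] conjI)
    qed
  qed
  note int = integral_partial_derivative_eq_0[OF FC1 L(1) F0]
  have eq: "vol_density c u * variation_density g (chart_param c u)
      = (\<Sum>k\<in>UNIV. fderiv (F k) u (axis k 1))" for u
  proof (cases "u \<in> chart_image c")
    case True
    have g': "(?g has_derivative differential_in c g u) (at u)"
      using has_derivative_differential[OF _ True, of g] g c by (simp add: o_def)
    have F': "fderiv (F k) u v = ?W u * position_coords c u $ k * differential_in c g u v
        + fderiv (\<lambda>u. ?W u * position_coords c u $ k) u v * ?g u" for k v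
    proof -
      have "(F k has_derivative (\<lambda>v. ?W u * position_coords c u $ k * differential_in c g u v
        + fderiv (\<lambda>u. ?W u * position_coords c u $ k) u v * ?g u)) (at u)"
        by (rule has_derivative_transform_within_open[OF has_derivative_mult[OF C1_on_derivative[OF WaC1 True] g']
              open_chart_image[OF c] True]) (simp add: F_def)
      then show ?thesis by (simp only: frechet_derivative_at[symmetric])
    qed
    have "(\<Sum>k\<in>UNIV. fderiv (F k) u (axis k 1)) =
        ?W u * (\<Sum>k\<in>UNIV. position_coords c u $ k * differential_in c g u (axis k 1))
      + (\<Sum>k\<in>UNIV. fderiv (\<lambda>u. ?W u * position_coords c u $ k) u (axis k 1)) * ?g u"
      unfolding F' by (simp add: sum.distrib sum_distrib_left sum_distrib_right mult.assoc)
    also have "(\<Sum>k\<in>UNIV. position_coords c u $ k * differential_in c g u (axis k 1))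
        = differential_in c g u (position_coords c u)"
      by (subst (2) linear_basis_expansion[OF linear_differential[OF g c True]]) simp
    finally show ?thesis
      unfolding divergence_chart[OF c True] variation_density_chart[OF g c True]
      using True by (simp add: vol_density_def algebra_simps)
  next
    case False
    then have "u \<in> - L" using L(2) by auto
    have "fderiv (F k) u = (\<lambda>_. 0)" for k
    proof (rule frechet_derivative_at[symmetric],
        rule has_derivative_transform_within_open[of "\<lambda>_. 0", OF _ _ \<open>u \<in> - L\<close>])
      show "open (- L)" using L(1) by (simp add: compact_imp_closed open_Compl)
    qed (simp_all add: F0)
    then show ?thesis using False by (simp add: vol_density_def)
  qed
  note sub = param_image_subset[OF L(2)]
  have cl: "closed (chart_param c ` L)" by (rule compact_imp_closed[OF compact_in_chart[OF c L]])
  have "(\<integral>p. variation_density g p \<partial>vol) = (\<integral>u. vol_density c u * variation_density g (chart_param c u) \<partial>lborel)"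
  proof (rule integral_chart[OF c])
    show "variation_density g \<in> borel_measurable borel"
      by (rule borel_measurable_continuous_onI[OF continuous_variation_density[OF g]])
    show "variation_density g p = 0" if "p \<notin> fst c" for p
      by (rule variation_density_eq_0[OF g cl zero]) (use that sub in auto)
  qed
  also have "\<dots> = (\<Sum>k\<in>UNIV. \<integral>u. fderiv (F k) u (axis k 1) \<partial>lborel)"
    unfolding eq by (rule Bochner_Integration.integral_sum[OF int(1)])
  also have "\<dots> = 0" by (simp add: int(2))
  finally show ?thesis .
qed

lemma C1_function_mult:
  fixes f g :: "'a \<Rightarrow> real"
  shows "C1_function \<A> f \<Longrightarrow> C1_function \<A> g \<Longrightarrow> C1_function \<A> (\<lambda>p. f p * g p)"
  by (simp add: o_def C1_on_mult)

lemma C1_function_diff: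
  "C1_function \<A> f \<Longrightarrow> C1_function \<A> g \<Longrightarrow> C1_function \<A> (\<lambda>p. f p - g p)"
  by (simp add: o_def C1_on_diff)

lemma variation_density_diff:
  assumes f: "C1_function \<A> f" and g: "C1_function \<A> g"
  shows "variation_density (\<lambda>p. f p - g p) p = variation_density f p - variation_density g p"
proof -
  obtain c where c: "c \<in> \<A>" "p \<in> fst c" by (rule chart_exists)
  have u: "snd c p \<in> chart_image c" using c by simp
  have "differential_in c (\<lambda>p. f p - g p) (snd c p) = (\<lambda>v. differential_in c f (snd c p) v - differential_in c g (snd c p) v)"
    unfolding differential_in_def[of c "\<lambda>p. f p - g p"]
  proof (rule frechet_derivative_at[symmetric])
    have "((\<lambda>u. (f \<circ> chart_param c) u - (g \<circ> chart_param c) u) has_derivative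
       (\<lambda>v. differential_in c f (snd c p) v - differential_in c g (snd c p) v)) (at (snd c p))"
      by (intro has_derivative_diff has_derivative_differential u) (use f g c in blast)+
    then show "((\<lambda>p. f p - g p) \<circ> chart_param c has_derivative
       (\<lambda>v. differential_in c f (snd c p) v - differential_in c g (snd c p) v)) (at (snd c p))"
      by (simp add: o_def)
  qed
  then show ?thesis
    using variation_density_chart[OF C1_function_diff[OF f g] c(1) u] variation_density_chart[OF f c(1) u]
      variation_density_chart[OF g c(1) u] c
    by (simp add: algebra_simps)
qed

text \<open>
  The support condition is phrased with a compact subset of the image of a chart, because that is what
  \<open>first_variation_chart\<close> needs after multiplication with \<open>b\<close>.
\<close>

definition bump :: "('a \<Rightarrow> real) \<Rightarrow> bool" where
  "bump b \<longleftrightarrow> C1_function \<A> b \<and> (\<exists>c\<in>\<A>. \<exists>L. compact L \<and> L \<subseteq> chart_image c \<and> (\<forall>q. q \<notin> chart_param c ` L \<longrightarrow> b q = 0))"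

lemma bump_exists: "\<exists>b T. bump b \<and> open T \<and> p \<in> T \<and> (\<forall>q\<in>T. b q = 1)"
proof -
  obtain c r where c: "c \<in> \<A>" "p \<in> fst c" "0 < r" "cball (snd c p) r \<subseteq> chart_image c"
    by (rule coordinate_ball)
  define \<psi> where "\<psi> u = cutoff (2 - 4 / r\<^sup>2 * ((u - snd c p) \<bullet> (u - snd c p)))" for u
  have \<psi>: "C1_on S \<psi>" for S
    unfolding \<psi>_def[abs_def]
    by (intro C1_on_cutoff C1_on_diff C1_on_mult C1_on_const C1_on_inner C1_on_linear bounded_linear_ident)
  have \<psi>0: "\<psi> u = 0" if "u \<notin> cball (snd c p) r" for u
  proof -
    have "r\<^sup>2 \<le> (norm (u - snd c p))\<^sup>2"
      using that c(3) by (intro power_mono) (auto simp: dist_norm norm_minus_commute)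
    then have "1 \<le> (norm (u - snd c p))\<^sup>2 / r\<^sup>2"
      using c(3) by (subst le_divide_eq_1_pos) simp_all
    then have "2 \<le> 4 / r\<^sup>2 * ((u - snd c p) \<bullet> (u - snd c p))"
      by (simp add: power2_norm_eq_inner[symmetric])
    then show ?thesis unfolding \<psi>_def by (intro cutoff_eq_0) simp
  qed
  have \<psi>1: "\<psi> u = 1" if "u \<in> ball (snd c p) (r / 2)" for u
  proof -
    have "(norm (u - snd c p))\<^sup>2 \<le> (r / 2)\<^sup>2"
      using that by (intro power_mono) (auto simp: dist_norm norm_minus_commute)
    then have "4 / r\<^sup>2 * ((u - snd c p) \<bullet> (u - snd c p)) \<le> 1"
      using c(3) by (simp add: power2_norm_eq_inner[symmetric] field_simps power2_eq_square)
    then show ?thesis unfolding \<psi>_def by (intro cutoff_eq_1) simp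
  qed
  define b where "b q = (if q \<in> fst c then \<psi> (snd c q) else 0)" for q
  let ?K = "chart_param c ` cball (snd c p) r"
  have K: "closed ?K" by (rule compact_imp_closed[OF compact_in_chart[OF c(1) compact_cball c(4)]])
  note KD = param_image_subset[OF c(4)]
  have b0: "b q = 0" if "q \<notin> ?K" for q
  proof (cases "q \<in> fst c")
    case True
    then have "q = chart_param c (snd c q)" using c(1) by simp
    then have "snd c q \<notin> cball (snd c p) r" using that by (metis imageI)
    then show ?thesis by (simp add: b_def \<psi>0)
  qed (simp add: b_def)
  have "C1_function \<A> b"
  proof (intro ballI C1_on_local)
    fix d u assume d: "d \<in> \<A>" and u: "u \<in> chart_image d"
    show "\<exists>T. open T \<and> u \<in> T \<and> C1_on T (b \<circ> chart_param d)"
    proof (cases "chart_param d u \<in> fst c")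
      case True
      let ?T = "snd d ` (fst d \<inter> fst c)"
      have "C1_on ?T (\<lambda>u. \<psi> (transition d c u))"
        by (rule C1_on_comp[OF \<psi>[of UNIV] smooth_on_imp_C1_on[OF smooth_transition[OF d c(1)]] subset_UNIV])
      then have "C1_on ?T (b \<circ> chart_param d)"
        by (rule C1_on_cong[OF open_overlap[OF d c(1)]]) (use d in \<open>auto simp: b_def\<close>)
      moreover have "u \<in> ?T"
        using chart_chart_param[OF u] chart_param_in[OF u] True by (intro image_eqI[of _ _ "chart_param d u"]) auto
      ultimately show ?thesis using open_overlap[OF d c(1)] by (intro exI[of _ ?T] conjI)
    next
      case False
      let ?T = "snd d ` (fst d - ?K)"
      have op: "open ?T" using K by (intro open_image[OF d] open_Diff open_domain[OF d]) auto
      have "C1_on ?T (b \<circ> chart_param d)"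
        by (rule C1_on_cong[OF op C1_on_const[of _ 0]]) (use d b0 in auto)
      moreover have "u \<in> ?T"
        using chart_chart_param[OF u] chart_param_in[OF u] False KD
        by (intro image_eqI[of _ _ "chart_param d u"]) auto
      ultimately show ?thesis using op by (intro exI[of _ ?T] conjI)
    qed
  qed
  then have "bump b"
    unfolding bump_def using c(1,4) b0 by (intro conjI bexI[of _ c] exI[of _ "cball (snd c p) r"]) auto
  moreover have "open (chart_param c ` ball (snd c p) (r / 2))"
    using c(3) by (intro open_param_image[OF c(1)] subset_trans[OF _ c(4)]) auto
  moreover have "p \<in> chart_param c ` ball (snd c p) (r / 2)"
    using c by (intro image_eqI[of _ _ "snd c p"]) auto
  moreover have "b q = 1" if q: "q \<in> chart_param c ` ball (snd c p) (r / 2)" for q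
  proof -
    obtain u where u: "q = chart_param c u" "u \<in> ball (snd c p) (r / 2)" using q by (rule imageE)
    then have "u \<in> chart_image c" using c(3) by (intro subsetD[OF c(4)]) auto
    then show ?thesis using u by (simp add: b_def \<psi>1 chart_param_in)
  qed
  ultimately show ?thesis by blast
qed

text \<open>
  The chart version is globalised by splitting off one bump function \<open>b\<close> after the other,
  \<open>g = b g + (g - b g)\<close>: the second summand vanishes where \<open>b = 1\<close>.
\<close>

theorem first_variation:
  assumes g: "C1_function \<A> g" and K: "compact K" and zero: "\<And>q. q \<notin> K \<Longrightarrow> g q = 0"
  shows "(\<integral>p. variation_density g p \<partial>vol) = 0"
proof -
  obtain b T where bT: "\<And>p. bump (b p)" "\<And>p. open (T p)" "\<And>p. p \<in> T p" "\<And>p q. q \<in> T p \<Longrightarrow> b p q = 1"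
    using bump_exists by metis
  obtain D where D: "D \<subseteq> K" "finite D" "K \<subseteq> (\<Union>p\<in>D. T p)"
    using compactE_image[OF K, of K T] bT(2,3) by (metis UN_I subsetI)
  have *: "(\<integral>p. variation_density g p \<partial>vol) = 0"
    if "finite B" "\<And>b. b \<in> B \<Longrightarrow> bump b" "\<And>q. g q \<noteq> 0 \<Longrightarrow> \<exists>b\<in>B. b q = 1" "C1_function \<A> g" "\<And>q. q \<notin> K \<Longrightarrow> g q = 0"
    for B g
    using that
  proof (induction B arbitrary: g rule: finite_induct)
    case empty
    then have "g = (\<lambda>_. 0)" by auto
    then have "variation_density g p = 0" for p
      using variation_density_eq_0[OF empty.prems(3), of "{}" p] by simp
    then show ?case by simp
  next
    case (insert b B)
    note g = insert.prems(3)
    have b: "bump b" using insert.prems(1) by simp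
    then obtain c L where c: "C1_function \<A> b" "c \<in> \<A>" "compact L" "L \<subseteq> chart_image c"
        "\<And>q. q \<notin> chart_param c ` L \<Longrightarrow> b q = 0"
      unfolding bump_def by blast
    let ?g1 = "\<lambda>p. b p * g p" and ?g2 = "\<lambda>p. g p - b p * g p"
    have g1: "C1_function \<A> ?g1" by (rule C1_function_mult[OF c(1) g])
    have g2: "C1_function \<A> ?g2" by (rule C1_function_diff[OF g g1])
    have i1: "(\<integral>p. variation_density ?g1 p \<partial>vol) = 0"
      by (rule first_variation_chart[OF g1 c(2-4)]) (simp add: c(5))
    have i2: "(\<integral>p. variation_density ?g2 p \<partial>vol) = 0"
    proof (rule insert.IH)
      show "\<exists>b\<in>B. b q = 1" if "?g2 q \<noteq> 0" for q
      proof -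
        have "g q \<noteq> 0" "b q \<noteq> 1" using that by auto
        then show ?thesis using insert.prems(2) by auto
      qed
      show "bump b" if "b \<in> B" for b using insert.prems(1) that by simp
      show "C1_function \<A> ?g2" by (rule g2)
      show "?g2 q = 0" if "q \<notin> K" for q using insert.prems(4)[OF that] by simp
    qed
    have "integrable vol (variation_density g)" "integrable vol (variation_density ?g1)"
      using insert.prems(4) by (auto intro!: integrable_variation_density[OF _ K] g g1)
    then show ?case
      using i1 i2 unfolding variation_density_diff[OF g g1] by simp
  qed
  show ?thesis
  proof (rule *[of "b ` D"])
    fix q assume "g q \<noteq> 0"
    then have "q \<in> K" using zero by blast
    then obtain p where "p \<in> D" "q \<in> T p" using D(3) by blast
    then show "\<exists>b'\<in>b ` D. b' q = 1" using bT(4) by blast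
  qed (use D(2) bT(1) g zero in auto)
qed

end


context self_expanding_hypersurface
begin

section \<open>The weighted Poincare inequality\<close>

definition radial :: "'a \<Rightarrow> real" where
  "radial p = (norm (x p))\<^sup>2 / 2"

lemma radial_nonneg: "0 \<le> radial p"
  by (simp add: radial_def)

lemma radial_has_derivative:
  assumes "c \<in> \<A>" "u \<in> chart_image c"
  shows "((\<lambda>u. radial (chart_param c u)) has_derivative
     (\<lambda>v. x (chart_param c u) \<bullet> differential_in c x u v)) (at u)"
proof -
  have x': "((\<lambda>u. x (chart_param c u)) has_derivative differential_in c x u) (at u)"
    using has_derivative_differential[OF _ assms(2), of x] C1_x assms(1) by (simp add: o_def)
  have "((\<lambda>u. (1 / 2) * (x (chart_param c u) \<bullet> x (chart_param c u))) has_derivative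
     (\<lambda>v. (1 / 2) * (x (chart_param c u) \<bullet> differential_in c x u v + differential_in c x u v \<bullet> x (chart_param c u)))) (at u)"
    by (intro has_derivative_mult_right has_derivative_inner x')
  then show ?thesis
    by (simp add: radial_def power2_norm_eq_inner inner_commute)
qed

lemma C1_radial: "C1_function \<A> radial"
proof -
  have "C1_on (chart_image c) (\<lambda>u. x (chart_param c u) \<bullet> x (chart_param c u) / 2)" if "c \<in> \<A>" for c
    using C1_x that by (intro C1_on_divide C1_on_inner C1_on_const) (simp_all add: o_def)
  then show ?thesis by (simp add: radial_def[abs_def] power2_norm_eq_inner o_def)
qed

lemma inner_x_tangential: "x p \<bullet> tangential p = (norm (tangential p))\<^sup>2"
proof -
  have "tangential p \<bullet> normal_part p = 0"
    using inner_normal_proj_normal_proj[of p "x p" "x p"] by (simp add: tangential_def inner_diff_left)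
  moreover have "x p = tangential p + normal_part p" by (simp add: tangential_def)
  ultimately show ?thesis
    by (metis add.right_neutral inner_add_left inner_commute power2_norm_eq_inner)
qed

lemma norm_tangential_le: "(norm (tangential p))\<^sup>2 \<le> 2 * radial p"
proof -
  have "(norm (tangential p))\<^sup>2 \<le> norm (x p) * norm (tangential p)"
    using norm_cauchy_schwarz[of "x p" "tangential p"] by (simp add: inner_x_tangential)
  then have "norm (tangential p) \<le> norm (x p)"
    by (cases "tangential p = 0") (simp_all add: power2_eq_square)
  then show ?thesis by (simp add: radial_def power_mono)
qed

lemma differential_position_coords:
  assumes "c \<in> \<A>" "u \<in> chart_image c"
  shows "x (chart_param c u) \<bullet> differential_in c x u (position_coords c u) = (norm (tangential (chart_param c u)))\<^sup>2"
  using inner_x_tangential tangential_chart[OF assms] by metis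

lemma
  assumes \<phi>: "C1_function \<A> \<phi>" and \<zeta>: "\<And>s. (\<zeta> has_real_derivative \<zeta>' s) (at s)" "continuous_on UNIV \<zeta>'"
  shows C1_function_mult_radial: "C1_function \<A> (\<lambda>p. \<phi> p * \<zeta> (radial p))" (is ?C1)
    and gradient_mult_radial: "gradient \<A> x (\<lambda>p. \<phi> p * \<zeta> (radial p)) p \<bullet> tangential p =
      \<zeta> (radial p) * (gradient \<A> x \<phi> p \<bullet> tangential p) + \<phi> p * \<zeta>' (radial p) * (norm (tangential p))\<^sup>2"
proof -
  have z: "C1_function \<A> (\<lambda>p. \<zeta> (radial p))"
  proof
    fix c assume c: "c \<in> \<A>"
    have "C1_on (chart_image c) (\<lambda>u. \<zeta> ((radial \<circ> chart_param c) u))"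
      by (rule C1_on_comp[OF C1_on_real[OF \<zeta>(1), of UNIV] _ subset_UNIV]) (use C1_radial c \<zeta>(2) in blast)+
    then show "C1_on (chart_image c) ((\<lambda>p. \<zeta> (radial p)) \<circ> chart_param c)" by (simp add: o_def)
  qed
  show C1: ?C1 by (rule C1_function_mult[OF \<phi> z])
  obtain c where c: "c \<in> \<A>" "p \<in> fst c" by (rule chart_exists)
  define u where "u = snd c p"
  have u: "u \<in> chart_image c" "chart_param c u = p" using c by (simp_all add: u_def)
  have "((\<lambda>u. \<phi> (chart_param c u)) has_derivative differential_in c \<phi> u) (at u)"
    using has_derivative_differential[OF _ u(1), of \<phi>] \<phi> c(1) by (simp add: o_def)
  moreover have "((\<lambda>u. \<zeta> (radial (chart_param c u))) has_derivative (\<lambda>v. (x p \<bullet> differential_in c x u v) * \<zeta>' (radial p))) (at u)"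
    using has_derivative_compose[OF radial_has_derivative[OF c(1) u(1)] \<zeta>(1)[THEN has_field_derivative_imp_has_derivative]]
    by (simp add: u(2) mult.commute)
  ultimately have "((\<lambda>u. \<phi> (chart_param c u) * \<zeta> (radial (chart_param c u))) has_derivative
     (\<lambda>v. \<phi> p * ((x p \<bullet> differential_in c x u v) * \<zeta>' (radial p)) + differential_in c \<phi> u v * \<zeta> (radial p))) (at u)"
    using has_derivative_mult u(2) by fastforce
  then have "differential_in c (\<lambda>p. \<phi> p * \<zeta> (radial p)) u =
     (\<lambda>v. \<phi> p * ((x p \<bullet> differential_in c x u v) * \<zeta>' (radial p)) + differential_in c \<phi> u v * \<zeta> (radial p))"
    unfolding differential_in_def[of c "\<lambda>p. \<phi> p * \<zeta> (radial p)"] o_def by (rule frechet_derivative_at[symmetric])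
  then show "gradient \<A> x (\<lambda>p. \<phi> p * \<zeta> (radial p)) p \<bullet> tangential p =
      \<zeta> (radial p) * (gradient \<A> x \<phi> p \<bullet> tangential p) + \<phi> p * \<zeta>' (radial p) * (norm (tangential p))\<^sup>2"
    using inner_gradient_tangential[OF C1 c(1) u(1)] inner_gradient_tangential[OF \<phi> c(1) u(1)]
      differential_position_coords[OF c(1) u(1)]
    by (simp add: u(2) algebra_simps)
qed

lemma continuous_gradient:
  assumes h: "C1_function \<A> h"
  shows "continuous_on UNIV (gradient \<A> x h)"
proof (rule continuous_on_charts)
  fix c assume c: "c \<in> \<A>"
  let ?M = "\<lambda>u k. \<chi> i j. if j = k then differential_in c h u (axis i 1) else metric_matrix c x u $ i $ j"
  let ?b = "\<lambda>u. \<chi> k. det (?M u k) / det (metric_matrix c x u)"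
  have dh: "continuous_on (chart_image c) (\<lambda>u. differential_in c h u v)" for v
    unfolding differential_in_def using h c by (blast intro: C1_on_continuous_derivative)
  have G: "continuous_on (chart_image c) (\<lambda>u. metric_matrix c x u $ i $ j)" for i j
    by (rule C1_on_imp_continuous_on[OF C1_metric_matrix[OF c]])
  have M: "continuous_on (chart_image c) (\<lambda>u. ?M u k $ i $ j)" for k i j
    using dh G by (cases "j = k") simp_all
  have "continuous_on (chart_image c) (\<lambda>u. \<Sum>k\<in>UNIV. ?b u $ k *\<^sub>R frame c u k)"
  proof (intro continuous_on_sum continuous_on_scaleR C1_on_imp_continuous_on[OF C1_differential_x[OF c]])
    fix k
    have "continuous_on (chart_image c) (\<lambda>u. det (?M u k) / det (metric_matrix c x u))"
    proof (rule continuous_on_divide)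
      show "continuous_on (chart_image c) (\<lambda>u. det (?M u k))"
        unfolding det_def by (intro continuous_on_sum continuous_on_mult continuous_on_const continuous_on_prod M)
      show "continuous_on (chart_image c) (\<lambda>u. det (metric_matrix c x u))"
        unfolding det_def by (intro continuous_on_sum continuous_on_mult continuous_on_const continuous_on_prod G)
      show "\<forall>u\<in>chart_image c. det (metric_matrix c x u) \<noteq> 0"
        using det_metric_matrix_pos[OF c] by (metis less_irrefl)
    qed
    then show "continuous_on (chart_image c) (\<lambda>u. ?b u $ k)" by simp
  qed
  moreover have "(\<Sum>k\<in>UNIV. ?b u $ k *\<^sub>R frame c u k) = (gradient \<A> x h \<circ> chart_param c) u"
    if u: "u \<in> chart_image c" for u
  proof -
    have lin: "linear (differential_in c x u)" "linear (differential_in c h u)"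
      by (rule linear_differential[OF C1_x c u], rule linear_differential[OF h c u])
    have p: "chart_param c u \<in> fst c" "snd c (chart_param c u) = u" using u by simp_all
    have "det (metric_matrix c x u) \<noteq> 0" using det_metric_matrix_pos[OF c u] by simp
    then have "metric_matrix c x u *v ?b u = (\<chi> i. differential_in c h u (axis i 1))"
      by (subst cramer) (simp_all cong: if_cong)
    from inner_differential_metric_solution[OF lin this]
    have inner: "differential_in c x u (?b u) \<bullet> differential_in c x u v = differential_in c h u v" for v .
    have "gradient \<A> x h (chart_param c u) = differential_in c x u (?b u)"
      using gradient_unique[OF h c p(1), of "differential_in c x u (?b u)"] inner
      by (simp add: p(2) tangent_space_chart[OF c p(1)])
    then show ?thesis using linear_basis_expansion[OF lin(1), of "?b u"] by (simp only: o_apply)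
  qed
  ultimately show "continuous_on (chart_image c) (gradient \<A> x h \<circ> chart_param c)"
    by (rule continuous_on_eq)
qed

text \<open>
  The first variation identity for \<open>\<phi>\<^sup>2 exp r\<close> and the square \<open>|\<nabla>\<phi> + \<phi> X|\<^sup>2 \<ge> 0\<close>.  Since integrals
  of functions that are not integrable are zero by convention, the integrability of all three
  integrands has to be established; they are continuous with compact support.
\<close>

theorem weighted_poincare_inequality:
  assumes \<phi>: "test_function \<A> \<phi>"
  shows "real CARD('m) * (\<integral>p. (\<phi> p)\<^sup>2 * exp (radial p) \<partial>vol)
      \<le> (\<integral>p. (real CARD('m) + (norm (normal_part p))\<^sup>2) * (\<phi> p)\<^sup>2 * exp (radial p) \<partial>vol)" (is "?L \<le> ?M")
    and "(\<integral>p. (real CARD('m) + (norm (normal_part p))\<^sup>2) * (\<phi> p)\<^sup>2 * exp (radial p) \<partial>vol)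
      \<le> (\<integral>p. (norm (gradient \<A> x \<phi> p))\<^sup>2 * exp (radial p) \<partial>vol)" (is "_ \<le> ?R")
proof -
  have \<phi>C1: "C1_function \<A> \<phi>"
    by (rule C1_function_smooth) (use \<phi> in \<open>simp add: test_function_def\<close>)
  define K where "K = closure {p. \<phi> p \<noteq> 0}"
  have K: "compact K" using \<phi> by (simp add: test_function_def K_def)
  have \<phi>0: "\<phi> p = 0" if "p \<notin> K" for p using that closure_subset[of "{p. \<phi> p \<noteq> 0}"] by (auto simp: K_def)
  have grad0: "gradient \<A> x \<phi> p = 0" if "p \<notin> K" for p
    by (rule gradient_eq_0[OF \<phi>C1, of "- K"]) (use that \<phi>0 K in \<open>auto intro: compact_imp_closed\<close>)
  have cont: "continuous_on UNIV \<phi>" "continuous_on UNIV radial"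
    by (intro C1_function_continuous \<phi>C1 C1_radial)+
  have int1: "integrable vol (\<lambda>p. (\<phi> p)\<^sup>2 * exp (radial p))"
    using \<phi>0 by (intro integrable_compact_support[OF _ K] continuous_intros cont) simp
  have int2: "integrable vol (\<lambda>p. (real CARD('m) + (norm (normal_part p))\<^sup>2) * (\<phi> p)\<^sup>2 * exp (radial p))"
    using \<phi>0 by (intro integrable_compact_support[OF _ K] continuous_intros cont continuous_normal_part) simp
  have int3: "integrable vol (\<lambda>p. (norm (gradient \<A> x \<phi> p))\<^sup>2 * exp (radial p))"
    using grad0 by (intro integrable_compact_support[OF _ K] continuous_intros cont continuous_gradient \<phi>C1) simp
  have "?L = (\<integral>p. real CARD('m) * ((\<phi> p)\<^sup>2 * exp (radial p)) \<partial>vol)" by simp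
  also have "\<dots> \<le> ?M"
    using int1 int2 by (intro integral_mono) (auto simp: mult.assoc intro!: mult_right_mono)
  finally show "?L \<le> ?M" .
  define g where "g p = (\<phi> p * \<phi> p) * exp (radial p)" for p
  have \<phi>2: "C1_function \<A> (\<lambda>p. \<phi> p * \<phi> p)" by (rule C1_function_mult[OF \<phi>C1 \<phi>C1])
  have g: "C1_function \<A> g"
    unfolding g_def by (rule C1_function_mult_radial[OF \<phi>2 DERIV_exp]) (intro continuous_intros)
  have gg: "gradient \<A> x g p \<bullet> tangential p = exp (radial p) * (gradient \<A> x (\<lambda>p. \<phi> p * \<phi> p) p \<bullet> tangential p)
     + (\<phi> p * \<phi> p) * exp (radial p) * (norm (tangential p))\<^sup>2" for p
    unfolding g_def by (rule gradient_mult_radial[OF \<phi>2 DERIV_exp]) (intro continuous_intros)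
  have gp: "gradient \<A> x (\<lambda>p. \<phi> p * \<phi> p) p \<bullet> tangential p = 2 * \<phi> p * (gradient \<A> x \<phi> p \<bullet> tangential p)" for p
  proof -
    obtain c where c: "c \<in> \<A>" "p \<in> fst c" by (rule chart_exists)
    define u where "u = snd c p"
    have u: "u \<in> chart_image c" "chart_param c u = p" using c by (simp_all add: u_def)
    have "((\<lambda>u. \<phi> (chart_param c u)) has_derivative differential_in c \<phi> u) (at u)"
      using has_derivative_differential[OF _ u(1), of \<phi>] \<phi>C1 c(1) by (simp add: o_def)
    from has_derivative_mult[OF this this]
    have "differential_in c (\<lambda>p. \<phi> p * \<phi> p) u = (\<lambda>v. \<phi> p * differential_in c \<phi> u v + differential_in c \<phi> u v * \<phi> p)"
      unfolding differential_in_def[of c "\<lambda>p. \<phi> p * \<phi> p"] o_def u(2) by (rule frechet_derivative_at[symmetric])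
    then show ?thesis
      using inner_gradient_tangential[OF \<phi>2 c(1) u(1)] inner_gradient_tangential[OF \<phi>C1 c(1) u(1)]
      by (simp add: u(2))
  qed
  have "?M - ?R = (\<integral>p. (real CARD('m) + (norm (normal_part p))\<^sup>2) * (\<phi> p)\<^sup>2 * exp (radial p)
      - (norm (gradient \<A> x \<phi> p))\<^sup>2 * exp (radial p) \<partial>vol)"
    using int2 int3 by simp
  also have "\<dots> \<le> (\<integral>p. variation_density g p \<partial>vol)"
  proof (rule integral_mono)
    show "integrable vol (variation_density g)"
      by (rule integrable_variation_density[OF g K]) (simp add: g_def \<phi>0)
    fix p
    have "0 \<le> exp (radial p) * (norm (gradient \<A> x \<phi> p + \<phi> p *\<^sub>R tangential p))\<^sup>2" by simp
    also have "(norm (gradient \<A> x \<phi> p + \<phi> p *\<^sub>R tangential p))\<^sup>2 = (norm (gradient \<A> x \<phi> p))\<^sup>2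
      + 2 * \<phi> p * (gradient \<A> x \<phi> p \<bullet> tangential p) + (\<phi> p)\<^sup>2 * (norm (tangential p))\<^sup>2"
      unfolding power2_norm_eq_inner
      by (simp add: inner_add_left inner_add_right inner_commute algebra_simps power2_eq_square[of "\<phi> p"])
    finally show "(real CARD('m) + (norm (normal_part p))\<^sup>2) * (\<phi> p)\<^sup>2 * exp (radial p)
      - (norm (gradient \<A> x \<phi> p))\<^sup>2 * exp (radial p) \<le> variation_density g p"
      unfolding variation_density_def gg gp by (simp add: g_def power2_eq_square algebra_simps)
  qed (use int2 int3 in auto)
  also have "\<dots> = 0" by (rule first_variation[OF g K]) (simp add: g_def \<phi>0)
  finally show "?M \<le> ?R" by simp
qed

section \<open>The volume of the ends\<close>

lemma C1_function_local:
  assumes "\<And>p. \<exists>T h. open T \<and> p \<in> T \<and> C1_function \<A> h \<and> (\<forall>q\<in>T. g q = h q)"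
  shows "C1_function \<A> g"
proof (intro ballI C1_on_local)
  fix c u assume c: "c \<in> \<A>" and u: "u \<in> chart_image c"
  obtain T h where T: "open T" "chart_param c u \<in> T" "C1_function \<A> h" "\<And>q. q \<in> T \<Longrightarrow> g q = h q"
    using assms by metis
  let ?V = "snd c ` (T \<inter> fst c)"
  have V: "open ?V" using T(1) by (intro open_image[OF c] open_Int open_domain[OF c]) auto
  have sub: "?V \<subseteq> chart_image c" by blast
  have "C1_on ?V (h \<circ> chart_param c)"
    using T(3) c by (intro C1_on_subset[OF _ sub]) blast
  then have "C1_on ?V (g \<circ> chart_param c)"
    by (rule C1_on_cong[OF V]) (use T(4) c in auto)
  moreover have "u \<in> ?V"
    using chart_chart_param[OF u] chart_param_in[OF u] T(2) by (intro image_eqI[of _ _ "chart_param c u"]) auto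
  ultimately show "\<exists>V. open V \<and> u \<in> V \<and> C1_on V (g \<circ> chart_param c)"
    using V by blast
qed

lemma variation_density_local:
  assumes g: "C1_function \<A> g" and h: "C1_function \<A> h" and T: "open T" "p \<in> T" "\<And>q. q \<in> T \<Longrightarrow> g q = h q"
  shows "variation_density g p = variation_density h p"
proof -
  have "variation_density (\<lambda>p. g p - h p) p = 0"
    by (rule variation_density_eq_0[OF C1_function_diff[OF g h], of "- T"]) (use T in auto)
  then show ?thesis by (simp add: variation_density_diff[OF g h])
qed

lemma compact_radial_le:
  assumes "compact_preimages x" shows "compact {p. radial p \<le> R}"
proof -
  have "{p. radial p \<le> R} = x -` cball 0 (sqrt (2 * R))"
  proof -
    have "radial p \<le> R \<longleftrightarrow> norm (x p) \<le> sqrt (2 * R)" for p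
    proof -
      have "radial p \<le> R \<longleftrightarrow> (norm (x p))\<^sup>2 \<le> 2 * R" unfolding radial_def by linarith
      also have "\<dots> \<longleftrightarrow> sqrt ((norm (x p))\<^sup>2) \<le> sqrt (2 * R)" by (rule real_sqrt_le_iff[symmetric])
      finally show ?thesis by simp
    qed
    then show ?thesis by (simp add: vimage_def)
  qed
  then show ?thesis using assms by (simp add: compact_preimages_def)
qed

text \<open>
  A cutoff to \<open>t < s < 2 T\<close> that is 1 for \<open>t + 1 \<le> s \<le> T\<close>, with derivative \<open>shell'\<close>.
\<close>

definition shell :: "real \<Rightarrow> real \<Rightarrow> real \<Rightarrow> real" where
  "shell t T s = cutoff (s - t) * cutoff (2 - s / T)"

definition shell' :: "real \<Rightarrow> real \<Rightarrow> real \<Rightarrow> real" where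
  "shell' t T s = cutoff' (s - t) * cutoff (2 - s / T) - cutoff (s - t) * cutoff' (2 - s / T) / T"

lemma shell_has_derivative: "(shell t T has_real_derivative shell' t T s) (at s)"
proof -
  have 1: "((\<lambda>s. cutoff (s - t)) has_real_derivative cutoff' (s - t) * 1) (at s)"
    by (rule DERIV_chain2[OF has_real_derivative_cutoff]) (auto intro!: derivative_eq_intros)
  have 2: "((\<lambda>s. cutoff (2 - s / T)) has_real_derivative cutoff' (2 - s / T) * (- (1 / T))) (at s)"
    by (rule DERIV_chain2[OF has_real_derivative_cutoff]) (auto intro!: derivative_eq_intros simp: divide_inverse)
  show ?thesis
    using DERIV_mult[OF 1 2] unfolding shell_def[abs_def] shell'_def by (simp add: algebra_simps)
qed

lemma continuous_shell': "continuous_on UNIV (shell' t T)"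
proof -
  have c: "continuous_on UNIV (\<lambda>s. cutoff (f s))" "continuous_on UNIV (\<lambda>s. cutoff' (f s))"
    if "continuous_on UNIV f" for f :: "real \<Rightarrow> real"
    unfolding cutoff_def cutoff'_def by (intro continuous_intros that)+
  show ?thesis
    unfolding shell'_def[abs_def] divide_inverse
    by (intro continuous_on_diff continuous_on_mult c continuous_on_const continuous_on_id)
qed

text \<open>
  Only the falling edge \<open>T < s < 2 T\<close> has negative slope, at least \<open>- 4 / T\<close>; there \<open>q \<le> 4 T\<close>, whence
  the constant 16.
\<close>

lemma shell'_lower_bound:
  assumes "0 < T" "0 \<le> s" "0 \<le> q" "q \<le> 2 * s"
  shows "- (16 * exp (s - T)) \<le> shell' t T s * q"
proof -
  have 1: "0 \<le> cutoff' (s - t) * cutoff (2 - s / T) * q"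
    using cutoff_bounds cutoff'_bounds assms by simp
  have 2: "cutoff (s - t) * cutoff' (2 - s / T) / T * q \<le> 16 * exp (s - T)"
  proof (cases "T < s \<and> s < 2 * T")
    case True
    have "cutoff (s - t) * cutoff' (2 - s / T) / T * q \<le> 1 * 4 / T * (4 * T)"
      using cutoff_bounds cutoff'_bounds True assms
      by (intro mult_mono divide_right_mono) auto
    also have "\<dots> = 16" using assms by simp
    also have "16 \<le> 16 * exp (s - T)" using True by simp
    finally show ?thesis .
  next
    case False
    then have "1 \<le> 2 - s / T \<or> 2 - s / T \<le> 0" using assms by (auto simp: field_simps)
    then have "cutoff' (2 - s / T) = 0" using cutoff'_eq_0 cutoff'_eq_0' by blast
    then show ?thesis by simp
  qed
  have "shell' t T s * q = cutoff' (s - t) * cutoff (2 - s / T) * q - cutoff (s - t) * cutoff' (2 - s / T) / T * q"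
    by (simp add: shell'_def left_diff_distrib)
  then show ?thesis using 1 2 by linarith
qed

text \<open>
  If the weighted volume \<open>V\<close> of \<open>E\<close> were finite, testing the first variation identity with a
  cutoff of \<open>E\<close> to the shell \<open>t < radial < 2 T\<close> would bound the volume of a fixed piece \<open>Q\<close> of \<open>E\<close>
  by \<open>16 V exp (- T)\<close>: the outer slope of the cutoff is of order \<open>1 / T\<close>, the squared length of the
  tangential position vector is at most of order \<open>T\<close>, and the weight is at least \<open>exp T\<close> there.
\<close>

theorem infinite_weighted_volume:
  assumes proper: "compact_preimages x" and K: "compact K" and E: "open E" "open (- K - E)" "E \<inter> K = {}"
    and unbounded: "\<And>R. \<exists>p\<in>E. R < radial p"
  shows "(\<integral>\<^sup>+p\<in>E. ennreal (exp (radial p)) \<partial>vol) = \<infinity>"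
proof (rule ccontr)
  assume fin: "(\<integral>\<^sup>+p\<in>E. ennreal (exp (radial p)) \<partial>vol) \<noteq> \<infinity>"
  have cont: "continuous_on UNIV radial" by (rule C1_function_continuous[OF C1_radial])
  have op: "open {p. a < radial p}" "open {p. radial p < a}" for a
    by (intro open_Collect_less continuous_on_const cont)+
  have meas: "radial \<in> borel_measurable vol"
    using borel_measurable_continuous_onI[OF cont] by (simp cong: measurable_cong_sets)
  obtain t where t: "\<And>p. p \<in> K \<Longrightarrow> radial p < t"
  proof -
    have "bounded (radial ` K)"
      by (rule compact_imp_bounded[OF compact_continuous_image[OF continuous_on_subset[OF cont] K]]) simp
    then obtain B where "\<And>p. p \<in> K \<Longrightarrow> \<bar>radial p\<bar> \<le> B" unfolding bounded_iff by auto
    then show ?thesis using that[of "B + 1"] by fastforce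
  qed
  obtain p0 where p0: "p0 \<in> E" "t + 1 < radial p0" using unbounded by blast
  define Q where "Q = E \<inter> {p. t + 1 < radial p} \<inter> {p. radial p < radial p0 + 1}"
  have Qop: "open Q" unfolding Q_def by (intro open_Int E op)
  have Qpos: "0 < emeasure vol Q"
    using p0 by (intro emeasure_open_pos[OF Qop]) (auto simp: Q_def)
  have "emeasure vol Q \<le> emeasure vol {p. radial p \<le> radial p0 + 1}"
    using compact_imp_closed[OF compact_radial_le[OF proper]] by (intro emeasure_mono) (auto simp: Q_def)
  then have Qfin: "emeasure vol Q < \<infinity>"
    using emeasure_compact[OF compact_radial_le[OF proper]] by (rule le_less_trans)
  have intQ: "integrable vol (indicator Q :: 'a \<Rightarrow> real)"
    using Qfin Qop by (intro integrable_real_indicator) simp_all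
  have intE: "integrable vol (\<lambda>p. indicator E p * exp (radial p) :: real)"
  proof (rule integrableI_nonneg)
    show "(\<lambda>p. indicator E p * exp (radial p) :: real) \<in> borel_measurable vol"
      using meas E(1) by (intro borel_measurable_times borel_measurable_indicator measurable_compose[OF meas]) simp_all
    have "(\<integral>\<^sup>+p. ennreal (indicator E p * exp (radial p)) \<partial>vol) = (\<integral>\<^sup>+p\<in>E. ennreal (exp (radial p)) \<partial>vol)"
      by (intro nn_integral_cong) (simp add: indicator_def)
    then show "(\<integral>\<^sup>+p. ennreal (indicator E p * exp (radial p)) \<partial>vol) < \<infinity>" using fin by (simp add: less_top)
  qed simp
  define V where "V = (\<integral>p. indicator E p * exp (radial p) \<partial>vol)"
  have bound: "measure vol Q \<le> 16 * V * exp (- T)" if T: "radial p0 + 1 \<le> T" for T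
  proof -
    have Tpos: "0 < T" using T radial_nonneg[of p0] by simp
    define g where "g p = (if p \<in> E then 1 * shell t T (radial p) else 0)" for p
    have h: "C1_function \<A> (\<lambda>p. 1 * shell t T (radial p))"
      by (rule C1_function_mult_radial[OF _ shell_has_derivative continuous_shell']) (simp add: o_def C1_on_const)
    have const: "C1_function \<A> (\<lambda>_. 0 :: real)" by (simp add: o_def C1_on_const)
    have g: "C1_function \<A> g"
    proof (rule C1_function_local)
      fix p
      \<comment> \<open>The boundary of \<open>E\<close> lies in \<open>K\<close>, and on the third of these open sets, which contains \<open>K\<close>,
        the cutoff vanishes.\<close>
      consider "p \<in> E" | "p \<in> - K - E" | "p \<in> {p. radial p < t}" using t by blast
      then show "\<exists>T h. open T \<and> p \<in> T \<and> C1_function \<A> h \<and> (\<forall>q\<in>T. g q = h q)"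
      proof cases
        case 1
        have "\<forall>q\<in>E. g q = 1 * shell t T (radial q)" by (simp add: g_def)
        then show ?thesis using 1 E(1) h by (intro exI[of _ E] exI[of _ "\<lambda>p. 1 * shell t T (radial p)"] conjI)
      next
        case 2
        have "\<forall>q\<in>- K - E. g q = 0" by (simp add: g_def)
        then show ?thesis using 2 E(2) const by (intro exI[of _ "- K - E"] exI[of _ "\<lambda>_. 0"] conjI)
      next
        case 3
        have "\<forall>q\<in>{p. radial p < t}. g q = 0" by (simp add: g_def shell_def cutoff_eq_0)
        then show ?thesis using 3 op(2) const by (intro exI[of _ "{p. radial p < t}"] exI[of _ "\<lambda>_. 0"] conjI)
      qed
    qed
    have g0: "g q = 0" if "q \<notin> {p. radial p \<le> 2 * T}" for q
    proof -
      have "2 - radial q / T \<le> 0" using that Tpos by (simp add: field_simps)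
      then show ?thesis by (simp add: g_def shell_def cutoff_eq_0)
    qed
    have density: "variation_density g p =
       (if p \<in> E then (real CARD('m) + (norm (normal_part p))\<^sup>2) * shell t T (radial p)
          + shell' t T (radial p) * (norm (tangential p))\<^sup>2 else 0)" for p
    proof (cases "p \<in> E")
      case True
      have "variation_density g p = variation_density (\<lambda>p. 1 * shell t T (radial p)) p"
        by (rule variation_density_local[OF g h E(1) True]) (simp add: g_def)
      moreover have "gradient \<A> x (\<lambda>p. 1 * shell t T (radial p)) p \<bullet> tangential p = shell' t T (radial p) * (norm (tangential p))\<^sup>2"
      proof -
        have "gradient \<A> x (\<lambda>_. 1 :: real) p = 0"
        proof -
          obtain c where c: "c \<in> \<A>" "p \<in> fst c" by (rule chart_exists)
          show ?thesis
            by (intro gradient_unique[OF _ c] zero_in_tangent_space) (simp_all add: o_def C1_on_const differential_in_def)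
        qed
        then show ?thesis
          using gradient_mult_radial[where \<phi> = "\<lambda>_. 1" and p = p, OF _ shell_has_derivative continuous_shell', of t T]
          by (simp add: o_def C1_on_const)
      qed
      ultimately show ?thesis using True by (simp add: variation_density_def)
    next
      case False
      have "\<exists>U. open U \<and> p \<in> U \<and> (\<forall>q\<in>U. g q = 0)"
      proof (cases "p \<in> K")
        case True
        then show ?thesis using t op(2)
          by (intro exI[of _ "{p. radial p < t}"]) (simp add: g_def shell_def cutoff_eq_0)
      next
        case F: False
        then show ?thesis using False E(2) by (intro exI[of _ "- K - E"]) (simp add: g_def)
      qed
      then obtain U where U: "open U" "p \<in> U" "\<And>q. q \<in> U \<Longrightarrow> g q = 0" by blast
      have "variation_density g p = 0"
        by (rule variation_density_eq_0[OF g, of "- U"]) (use U in auto)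
      then show ?thesis using False by simp
    qed
    have "measure vol Q - 16 * V * exp (- T) =
        (\<integral>p. indicator Q p - 16 * exp (- T) * (indicator E p * exp (radial p)) \<partial>vol)"
      using intQ intE by (simp add: V_def)
    also have "\<dots> \<le> (\<integral>p. variation_density g p \<partial>vol)"
    proof (rule integral_mono)
      show "integrable vol (variation_density g)"
        by (rule integrable_variation_density[OF g compact_radial_le[OF proper] g0])
      show "integrable vol (\<lambda>p. indicator Q p - 16 * exp (- T) * (indicator E p * exp (radial p)))"
        using intQ intE by (intro Bochner_Integration.integrable_diff integrable_mult_right) auto
      fix p
      show "indicator Q p - 16 * exp (- T) * (indicator E p * exp (radial p)) \<le> variation_density g p"
      proof (cases "p \<in> E")
        case True
        have s0: "0 \<le> shell t T (radial p)" using cutoff_bounds by (simp add: shell_def)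
        have "indicator Q p \<le> shell t T (radial p)"
        proof (cases "p \<in> Q")
          case True
          then have "1 \<le> radial p - t" "radial p \<le> T" using T by (auto simp: Q_def)
          then have "shell t T (radial p) = 1" using Tpos by (simp add: shell_def cutoff_eq_1)
          then show ?thesis by (simp add: indicator_def)
        qed (use s0 in simp)
        also have "\<dots> = 1 * shell t T (radial p)" by simp
        also have "\<dots> \<le> (real CARD('m) + (norm (normal_part p))\<^sup>2) * shell t T (radial p)"
        proof (rule mult_right_mono[OF _ s0])
          have "1 \<le> real CARD('m)" using zero_less_card_finite[where 'a = 'm] by linarith
          then show "1 \<le> real CARD('m) + (norm (normal_part p))\<^sup>2" by (simp add: add_increasing2)
        qed
        finally have 1: "indicator Q p \<le> (real CARD('m) + (norm (normal_part p))\<^sup>2) * shell t T (radial p)" .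
        have 2: "- (16 * exp (radial p - T)) \<le> shell' t T (radial p) * (norm (tangential p))\<^sup>2"
          by (rule shell'_lower_bound[OF Tpos radial_nonneg _ norm_tangential_le]) simp
        have "exp (- T) * exp (radial p) = exp (radial p - T)" by (simp add: exp_add[symmetric])
        then show ?thesis using 1 2 True by (simp add: density)
      next
        case False
        then show ?thesis by (simp add: density Q_def)
      qed
    qed
    also have "\<dots> = 0" by (rule first_variation[OF g compact_radial_le[OF proper] g0])
    finally show ?thesis by simp
  qed
  have "((\<lambda>T. 16 * V * exp (- T)) \<longlongrightarrow> 0) at_top"
    by (intro tendsto_mult_right_zero filterlim_compose[OF exp_at_bot filterlim_uminus_at_bot_at_top])
  then have "measure vol Q \<le> 0"
    by (rule tendsto_lowerbound) (rule eventually_mono[OF eventually_ge_at_top bound], simp_all)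
  then show False using Qpos Qfin by (simp add: emeasure_eq_ennreal_measure)
qed

end


section \<open>Relatively compact connected sets have bounded intrinsic diameter\<close>

lemma has_vector_derivative_join:
  fixes F1 F2 :: "real \<Rightarrow> 'w::real_normed_vector"
  assumes F: "\<And>t. t < 1 / 2 \<Longrightarrow> F t = F1 (2 * t)" "\<And>t. 1 / 2 < t \<Longrightarrow> F t = F2 (2 * t - 1)"
  shows "t < 1 / 2 \<Longrightarrow> (F1 has_vector_derivative D) (at (2 * t)) \<Longrightarrow> (F has_vector_derivative 2 *\<^sub>R D) (at t)"
    and "1 / 2 < t \<Longrightarrow> (F2 has_vector_derivative D) (at (2 * t - 1)) \<Longrightarrow> (F has_vector_derivative 2 *\<^sub>R D) (at t)"
proof -
  assume t: "t < 1 / 2" and D: "(F1 has_vector_derivative D) (at (2 * t))"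
  have "((\<lambda>t. 2 * t) has_vector_derivative 2) (at t)"
    by (auto intro!: derivative_eq_intros simp: has_real_derivative_iff_has_vector_derivative[symmetric])
  from vector_diff_chain_at[OF this D] show "(F has_vector_derivative 2 *\<^sub>R D) (at t)"
    by (rule has_vector_derivative_transform_within_open[of _ _ _ "{..<1 / 2}"]) (use t F in auto)
next
  assume t: "1 / 2 < t" and D: "(F2 has_vector_derivative D) (at (2 * t - 1))"
  have "((\<lambda>t. 2 * t - 1) has_vector_derivative 2) (at t)"
    by (auto intro!: derivative_eq_intros simp: has_real_derivative_iff_has_vector_derivative[symmetric])
  from vector_diff_chain_at[OF this D] show "(F has_vector_derivative 2 *\<^sub>R D) (at t)"
    by (rule has_vector_derivative_transform_within_open[of _ _ _ "{1 / 2<..}"]) (use t F in auto)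
qed

lemma C1_differentiable_on_join:
  fixes F1 F2 :: "real \<Rightarrow> 'w::real_normed_vector"
  assumes F1: "F1 C1_differentiable_on S1" and F2: "F2 C1_differentiable_on S2"
    and S: "\<And>t. t \<in> S \<Longrightarrow> t < 1 / 2 \<and> 2 * t \<in> S1 \<or> 1 / 2 < t \<and> 2 * t - 1 \<in> S2"
    and F: "\<And>t. t < 1 / 2 \<Longrightarrow> F t = F1 (2 * t)" "\<And>t. 1 / 2 < t \<Longrightarrow> F t = F2 (2 * t - 1)"
  shows "F C1_differentiable_on S"
proof -
  obtain D1 where D1: "\<And>t. t \<in> S1 \<Longrightarrow> (F1 has_vector_derivative D1 t) (at t)" "continuous_on S1 D1"
    using F1 unfolding C1_differentiable_on_def by blast
  obtain D2 where D2: "\<And>t. t \<in> S2 \<Longrightarrow> (F2 has_vector_derivative D2 t) (at t)" "continuous_on S2 D2"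
    using F2 unfolding C1_differentiable_on_def by blast
  let ?D = "\<lambda>t. if t < 1 / 2 then 2 *\<^sub>R D1 (2 * t) else 2 *\<^sub>R D2 (2 * t - 1)"
  let ?A = "S \<inter> {..1 / 2}" and ?B = "S \<inter> {1 / 2..}"
  have ne: "1 / 2 \<notin> S" using S[of "1 / 2"] by auto
  have "(F has_vector_derivative ?D t) (at t)" if "t \<in> S" for t
    using S[OF that] has_vector_derivative_join(1)[of F F1 F2, OF F _ D1(1)]
      has_vector_derivative_join(2)[of F F1 F2, OF F _ D2(1)] by auto
  moreover have "continuous_on (?A \<union> ?B) ?D"
  proof (rule continuous_on_cases_local)
    show "closedin (top_of_set (?A \<union> ?B)) ?A" "closedin (top_of_set (?A \<union> ?B)) ?B"
      unfolding closedin_closed by (rule exI[of _ "{..1 / 2}"], use ne in force, rule exI[of _ "{1 / 2..}"], use ne in force)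
    show "continuous_on ?A (\<lambda>t. 2 *\<^sub>R D1 (2 * t))"
      by (intro continuous_intros continuous_on_compose2[OF D1(2)]) (use S ne in force)
    show "continuous_on ?B (\<lambda>t. 2 *\<^sub>R D2 (2 * t - 1))"
      by (intro continuous_intros continuous_on_compose2[OF D2(2)]) (use S ne in force)
  next
    fix t assume "t \<in> ?A \<and> \<not> t < 1 / 2 \<or> t \<in> ?B \<and> t < 1 / 2"
    then have "t = 1 / 2" "t \<in> S" by auto
    then show "2 *\<^sub>R D1 (2 * t) = 2 *\<^sub>R D2 (2 * t - 1)" using ne by blast
  qed
  moreover have "?A \<union> ?B = S" by auto
  ultimately show ?thesis unfolding C1_differentiable_on_def by (intro exI[of _ ?D]) simp
qed

context immersed_manifold
begin

text \<open>
  Two points are joined with speed \<open>C\<close> if there is a piecewise C1 curve of speed at most \<open>C\<close> between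
  them, on the parameter interval from 0 to 1.  A bound of the speed is easier to keep track of
  under concatenation than the length.
\<close>

definition joined :: "real \<Rightarrow> 'a \<Rightarrow> 'a \<Rightarrow> bool" where
  "joined C p q \<longleftrightarrow> (\<exists>\<gamma> T. path \<gamma> \<and> pathstart \<gamma> = p \<and> pathfinish \<gamma> = q \<and> finite T \<and>
     (\<forall>c\<in>\<A>. (snd c \<circ> \<gamma>) C1_differentiable_on ({t\<in>{0..1}. \<gamma> t \<in> fst c} - T)) \<and>
     (\<forall>t\<in>{0<..<1} - T. \<exists>D. ((x \<circ> \<gamma>) has_vector_derivative D) (at t) \<and> norm D \<le> C))"

lemma riemannian_dist_le:
  assumes "joined C p q" shows "riemannian_dist \<A> x p q \<le> ennreal C"
proof -
  obtain \<gamma> T where \<gamma>: "path \<gamma>" "pathstart \<gamma> = p" "pathfinish \<gamma> = q" and T: "finite T"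
    and C1: "\<forall>c\<in>\<A>. (snd c \<circ> \<gamma>) C1_differentiable_on ({t\<in>{0..1}. \<gamma> t \<in> fst c} - T)"
    and D: "\<And>t. t \<in> {0<..<1} - T \<Longrightarrow> \<exists>D. ((x \<circ> \<gamma>) has_vector_derivative D) (at t) \<and> norm D \<le> C"
    using assms unfolding joined_def by blast
  have bound: "norm (vector_derivative (x \<circ> \<gamma>) (at t)) \<le> C" if "t \<in> {0<..<1} - T" for t
    using D[OF that] vector_derivative_at by metis
  have "curve_length x \<gamma> \<le> (\<integral>\<^sup>+ t \<in> {0..1::real}. ennreal C \<partial>lborel)"
    unfolding curve_length_def
  proof (rule nn_integral_mono_AE)
    have "finite (T \<union> {0, 1})" using T by simp
    then have "AE t in lborel. t \<notin> T \<union> {0, 1 :: real}" by (intro AE_not_in finite_imp_null_set_lborel)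
    then show "AE t in lborel. ennreal (norm (vector_derivative (x \<circ> \<gamma>) (at t))) * indicator {0..1} t
        \<le> ennreal C * indicator {0..1} t"
    proof eventually_elim
      case (elim t)
      then have "t \<in> {0<..<1} - T" if "t \<in> {0..1}" using that by auto
      then show ?case using bound by (cases "t \<in> {0..1}") (auto intro: ennreal_leI)
    qed
  qed
  also have "\<dots> = ennreal C" by (simp add: nn_integral_cmult_indicator)
  finally have "curve_length x \<gamma> \<le> ennreal C" .
  moreover have "piecewise_C1_curve \<A> \<gamma>" unfolding piecewise_C1_curve_def using \<gamma>(1) T C1 by blast
  ultimately show ?thesis
    unfolding riemannian_dist_def using \<gamma>(2,3) by (intro Inf_lower2[of "curve_length x \<gamma>"]) blast+
qed

lemma joined_trans:
  assumes "joined C1 p q" "joined C2 q s" shows "joined (2 * max C1 C2) p s"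
proof -
  obtain \<gamma>1 T1 where 1: "path \<gamma>1" "pathstart \<gamma>1 = p" "pathfinish \<gamma>1 = q" "finite T1"
    and C1: "\<And>c. c \<in> \<A> \<Longrightarrow> (snd c \<circ> \<gamma>1) C1_differentiable_on ({t\<in>{0..1}. \<gamma>1 t \<in> fst c} - T1)"
    and D1: "\<And>t. t \<in> {0<..<1} - T1 \<Longrightarrow> \<exists>D. ((x \<circ> \<gamma>1) has_vector_derivative D) (at t) \<and> norm D \<le> C1"
    using assms(1) unfolding joined_def by blast
  obtain \<gamma>2 T2 where 2: "path \<gamma>2" "pathstart \<gamma>2 = q" "pathfinish \<gamma>2 = s" "finite T2"
    and C2: "\<And>c. c \<in> \<A> \<Longrightarrow> (snd c \<circ> \<gamma>2) C1_differentiable_on ({t\<in>{0..1}. \<gamma>2 t \<in> fst c} - T2)"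
    and D2: "\<And>t. t \<in> {0<..<1} - T2 \<Longrightarrow> \<exists>D. ((x \<circ> \<gamma>2) has_vector_derivative D) (at t) \<and> norm D \<le> C2"
    using assms(2) unfolding joined_def by blast
  define \<gamma> where "\<gamma> = \<gamma>1 +++ \<gamma>2"
  define T where "T = (\<lambda>t. t / 2) ` T1 \<union> (\<lambda>t. (t + 1) / 2) ` T2 \<union> {1 / 2}"
  have \<gamma>: "t < 1 / 2 \<Longrightarrow> \<gamma> t = \<gamma>1 (2 * t)" "1 / 2 < t \<Longrightarrow> \<gamma> t = \<gamma>2 (2 * t - 1)" for t
    by (simp_all add: \<gamma>_def joinpaths_def)
  have T1: "2 * t \<notin> T1" if "t \<notin> T" for t
  proof
    assume "2 * t \<in> T1"
    then have "(2 * t) / 2 \<in> T" unfolding T_def by blast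
    then show False using that by simp
  qed
  have T2: "2 * t - 1 \<notin> T2" if "t \<notin> T" for t
  proof
    assume "2 * t - 1 \<in> T2"
    then have "((2 * t - 1) + 1) / 2 \<in> T" unfolding T_def by blast
    then show False using that by simp
  qed
  have half: "t < 1 / 2 \<or> 1 / 2 < t" if "t \<notin> T" for t
    using that unfolding T_def by (metis UnCI insertI1 linorder_neqE_linordered_idom)
  have "(snd c \<circ> \<gamma>) C1_differentiable_on ({t\<in>{0..1}. \<gamma> t \<in> fst c} - T)" if c: "c \<in> \<A>" for c
  proof (rule C1_differentiable_on_join[OF C1[OF c] C2[OF c]])
    fix t assume t: "t \<in> {t\<in>{0..1}. \<gamma> t \<in> fst c} - T"
    then show "t < 1 / 2 \<and> 2 * t \<in> {t\<in>{0..1}. \<gamma>1 t \<in> fst c} - T1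
      \<or> 1 / 2 < t \<and> 2 * t - 1 \<in> {t\<in>{0..1}. \<gamma>2 t \<in> fst c} - T2"
      using half[of t] T1[of t] T2[of t] \<gamma>[of t] by auto
  qed (simp_all add: \<gamma>)
  moreover have "\<exists>D. ((x \<circ> \<gamma>) has_vector_derivative D) (at t) \<and> norm D \<le> 2 * max C1 C2"
    if t: "t \<in> {0<..<1} - T" for t
  proof -
    have "t \<notin> T" using t by simp
    from half[OF this] show ?thesis
    proof
      assume lt: "t < 1 / 2"
      then obtain D where D: "((x \<circ> \<gamma>1) has_vector_derivative D) (at (2 * t))" "norm D \<le> C1"
        using D1[of "2 * t"] T1[OF \<open>t \<notin> T\<close>] t by auto
      have "((x \<circ> \<gamma>) has_vector_derivative 2 *\<^sub>R D) (at t)"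
        using has_vector_derivative_join(1)[of "x \<circ> \<gamma>" "x \<circ> \<gamma>1" "x \<circ> \<gamma>2", OF _ _ lt D(1)] \<gamma> by simp
      moreover have "norm (2 *\<^sub>R D) \<le> 2 * max C1 C2" using D(2) by simp
      ultimately show ?thesis by blast
    next
      assume gt: "1 / 2 < t"
      then obtain D where D: "((x \<circ> \<gamma>2) has_vector_derivative D) (at (2 * t - 1))" "norm D \<le> C2"
        using D2[of "2 * t - 1"] T2[OF \<open>t \<notin> T\<close>] t by auto
      have "((x \<circ> \<gamma>) has_vector_derivative 2 *\<^sub>R D) (at t)"
        using has_vector_derivative_join(2)[of "x \<circ> \<gamma>" "x \<circ> \<gamma>1" "x \<circ> \<gamma>2", OF _ _ gt D(1)] \<gamma> by simp
      moreover have "norm (2 *\<^sub>R D) \<le> 2 * max C1 C2" using D(2) by simp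
      ultimately show ?thesis by blast
    qed
  qed
  moreover have "path \<gamma>" "pathstart \<gamma> = p" "pathfinish \<gamma> = s" unfolding \<gamma>_def using 1 2 by simp_all
  moreover have "finite T" unfolding T_def using 1(4) 2(4) by simp
  ultimately show ?thesis unfolding joined_def by blast
qed

text \<open>A segment in a coordinate ball is a curve of speed bounded on the ball.\<close>

lemma joined_in_coordinate_ball: "\<exists>B C. open B \<and> p \<in> B \<and> (\<forall>a\<in>B. \<forall>b\<in>B. joined C a b)"
proof -
  obtain c r where c: "c \<in> \<A>" "p \<in> fst c" "0 < r" "cball (snd c p) r \<subseteq> chart_image c"
    "open (chart_param c ` ball (snd c p) r)" "p \<in> chart_param c ` ball (snd c p) r"
    by (rule coordinate_ball)
  let ?z = "snd c p"
  have "\<exists>M. \<forall>u\<in>cball ?z r. norm (frame c u i) \<le> M" for i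
  proof -
    have "bounded ((\<lambda>u. frame c u i) ` cball ?z r)"
      by (rule compact_imp_bounded[OF compact_continuous_image[OF continuous_on_subset[OF
              C1_on_imp_continuous_on[OF C1_differential_x[OF c(1)]] c(4)] compact_cball]])
    then show ?thesis unfolding bounded_iff by auto
  qed
  then obtain M where M: "\<And>i u. u \<in> cball ?z r \<Longrightarrow> norm (frame c u i) \<le> M i" by metis
  define C where "C = (\<Sum>i\<in>UNIV. 2 * r * M i)"
  have "joined C a b" if a: "a \<in> chart_param c ` ball ?z r" and b: "b \<in> chart_param c ` ball ?z r" for a b
  proof -
    obtain \<alpha> \<beta> where \<alpha>: "a = chart_param c \<alpha>" "\<alpha> \<in> ball ?z r" and \<beta>: "b = chart_param c \<beta>" "\<beta> \<in> ball ?z r"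
      using a b by (elim imageE)
    define l where "l t = \<alpha> + t *\<^sub>R (\<beta> - \<alpha>)" for t :: real
    define \<gamma> where "\<gamma> t = chart_param c (l t)" for t
    have l_ball: "l t \<in> ball ?z r" if "t \<in> {0..1}" for t
    proof -
      have "(1 - t) *\<^sub>R \<alpha> + t *\<^sub>R \<beta> \<in> ball ?z r"
        using that by (intro convexD[OF convex_ball \<alpha>(2) \<beta>(2)]) auto
      then show ?thesis by (simp add: l_def algebra_simps)
    qed
    have l_im: "l t \<in> chart_image c" if "t \<in> {0..1}" for t
      using l_ball[OF that] by (intro subsetD[OF c(4)]) auto
    have l': "(l has_vector_derivative (\<beta> - \<alpha>)) (at t)" for t
      unfolding l_def by (auto intro!: derivative_eq_intros)
    have l_cont: "continuous_on S l" for S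
      unfolding l_def by (intro continuous_intros)
    have "path \<gamma>"
      unfolding path_def \<gamma>_def
      by (rule continuous_on_compose2[OF continuous_chart_param[OF c(1)] l_cont image_subsetI]) (rule l_im)
    moreover have "pathstart \<gamma> = a" "pathfinish \<gamma> = b"
      by (simp_all add: pathstart_def pathfinish_def \<gamma>_def l_def \<alpha>(1) \<beta>(1))
    moreover have "(snd d \<circ> \<gamma>) C1_differentiable_on ({t\<in>{0..1}. \<gamma> t \<in> fst d} - {})" if d: "d \<in> \<A>" for d
    proof -
      let ?S = "{t\<in>{0..1}. \<gamma> t \<in> fst d} - {}"
      let ?V = "snd c ` (fst c \<inter> fst d)"
      have lV: "l t \<in> ?V" if "t \<in> ?S" for t
      proof (rule image_eqI[of _ _ "\<gamma> t"])
        show "l t = snd c (\<gamma> t)" using l_im that by (simp add: \<gamma>_def)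
        show "\<gamma> t \<in> fst c \<inter> fst d" using l_im that by (simp add: \<gamma>_def)
      qed
      have T: "C1_on ?V (transition c d)"
        by (rule smooth_on_imp_C1_on[OF smooth_transition[OF c(1) d]])
      have "((snd d \<circ> \<gamma>) has_vector_derivative fderiv (transition c d) (l t) (\<beta> - \<alpha>)) (at t)"
        if "t \<in> ?S" for t
        using vector_derivative_diff_chain_within[of l "\<beta> - \<alpha>" t UNIV "transition c d"
            "fderiv (transition c d) (l t)"] l' C1_on_derivative[OF T lV[OF that]]
        by (auto simp: o_def \<gamma>_def intro: has_derivative_at_withinI)
      moreover have "continuous_on ?S (\<lambda>t. fderiv (transition c d) (l t) (\<beta> - \<alpha>))"
        by (rule continuous_on_compose2[OF C1_on_continuous_derivative[OF T] l_cont image_subsetI]) (rule lV)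
      ultimately show ?thesis
        unfolding C1_differentiable_on_def
        by (intro exI[of _ "\<lambda>t. fderiv (transition c d) (l t) (\<beta> - \<alpha>)"] conjI ballI)
    qed
    moreover have "\<exists>D. ((x \<circ> \<gamma>) has_vector_derivative D) (at t) \<and> norm D \<le> C" if t: "t \<in> {0<..<1} - {}" for t
    proof (intro exI conjI)
      have t01: "t \<in> {0..1}" using t by simp
      have dx: "((x \<circ> chart_param c) has_derivative differential_in c x (l t)) (at (l t))"
        using has_derivative_differential[OF _ l_im[OF t01], of x] C1_x c(1) by blast
      show "((x \<circ> \<gamma>) has_vector_derivative differential_in c x (l t) (\<beta> - \<alpha>)) (at t)"
        using vector_derivative_diff_chain_within[of l "\<beta> - \<alpha>" t UNIV "x \<circ> chart_param c" "differential_in c x (l t)"] l' dx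
        by (auto simp: o_def \<gamma>_def intro: has_derivative_at_withinI)
      have lc: "l t \<in> cball ?z r" using l_ball[OF t01] by auto
      have "norm (\<beta> - \<alpha>) \<le> 2 * r"
        using \<alpha>(2) \<beta>(2) dist_triangle2[of \<beta> \<alpha> ?z] by (simp add: dist_norm norm_minus_commute)
      then have comp: "\<bar>(\<beta> - \<alpha>) $ i\<bar> \<le> 2 * r" for i
        using component_le_norm_cart[of "\<beta> - \<alpha>" i] by simp
      have lin: "linear (differential_in c x (l t))" by (rule linear_differential[OF C1_x c(1) l_im[OF t01]])
      have "norm (differential_in c x (l t) (\<beta> - \<alpha>)) \<le> (\<Sum>i\<in>UNIV. norm ((\<beta> - \<alpha>) $ i *\<^sub>R differential_in c x (l t) (axis i 1)))"
        unfolding linear_basis_expansion[OF lin, of "\<beta> - \<alpha>"] by (rule norm_sum)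
      also have "\<dots> \<le> C"
        unfolding C_def norm_scaleR real_norm_def
        using comp M[OF lc] c(3) by (intro sum_mono mult_mono) auto
      finally show "norm (differential_in c x (l t) (\<beta> - \<alpha>)) \<le> C" .
    qed
    ultimately show ?thesis
      unfolding joined_def by (intro exI[of _ \<gamma>] exI[of _ "{}"] conjI ballI finite.emptyI)
  qed
  then show ?thesis using c(5,6) by blast
qed

text \<open>
  Being joined to a fixed point is locally constant, hence constant on the connected set.  Since
  finitely many coordinate balls cover the set, passing through their centres bounds the speed
  uniformly.
\<close>

lemma bounded_intrinsic_diameter:
  assumes S: "connected S" "compact S"
  shows "\<exists>C. \<forall>p\<in>S. \<forall>q\<in>S. joined C p q"
proof -
  obtain B C where BC: "\<And>p. open (B p)" "\<And>p. p \<in> B p" "\<And>p a b. a \<in> B p \<Longrightarrow> b \<in> B p \<Longrightarrow> joined (C p) a b"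
    using joined_in_coordinate_ball by metis
  have fin: "\<exists>C. joined C p q" if "p \<in> S" "q \<in> S" for p q
  proof -
    have "(\<exists>C. joined C p p) = (\<exists>C. joined C p q)"
    proof (rule connected_local_const[OF S(1) that], rule ballI)
      fix a assume "a \<in> S"
      have "(\<exists>C. joined C p a) = (\<exists>C. joined C p b)" if "b \<in> B a" for b
        using joined_trans[OF _ BC(3)[OF BC(2) that]] joined_trans[OF _ BC(3)[OF that BC(2)]] by blast
      then show "\<forall>\<^sub>F b in at a within S. (\<exists>C. joined C p a) = (\<exists>C. joined C p b)"
        unfolding eventually_at_topological by (intro exI[of _ "B a"] conjI BC ballI impI)
    qed
    then show ?thesis using BC(3)[OF BC(2) BC(2)] by auto
  qed
  obtain D where D: "D \<subseteq> S" "finite D" "S \<subseteq> (\<Union>p\<in>D. B p)"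
    using compactE_image[OF S(2), of S B] BC(1,2) by (metis UN_I subsetI)
  define L where "L a b = (SOME C. joined C a b)" for a b
  have L: "joined (L a b) a b" if "a \<in> S" "b \<in> S" for a b
    unfolding L_def using fin[OF that] by (rule someI_ex)
  have mono: "joined C' a b" if joined: "joined C a b" and le: "C \<le> C'" for C C' a b
  proof -
    obtain \<gamma> T where \<gamma>: "path \<gamma>" "pathstart \<gamma> = a" "pathfinish \<gamma> = b" "finite T"
        "\<forall>c\<in>\<A>. (snd c \<circ> \<gamma>) C1_differentiable_on ({t\<in>{0..1}. \<gamma> t \<in> fst c} - T)"
      and D: "\<forall>t\<in>{0<..<1} - T. \<exists>D. ((x \<circ> \<gamma>) has_vector_derivative D) (at t) \<and> norm D \<le> C"
      using joined unfolding joined_def by blast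
    have "\<forall>t\<in>{0<..<1} - T. \<exists>D. ((x \<circ> \<gamma>) has_vector_derivative D) (at t) \<and> norm D \<le> C'"
    proof
      fix t assume "t \<in> {0<..<1} - T"
      then obtain D where "((x \<circ> \<gamma>) has_vector_derivative D) (at t)" "norm D \<le> C" using D by blast
      then show "\<exists>D. ((x \<circ> \<gamma>) has_vector_derivative D) (at t) \<and> norm D \<le> C'"
        using le by (intro exI[of _ D]) simp
    qed
    with \<gamma> show ?thesis unfolding joined_def by (intro exI[of _ \<gamma>] exI[of _ T] conjI)
  qed
  define R where "R = (\<Sum>a\<in>D. \<bar>C a\<bar>) + (\<Sum>a\<in>D. \<Sum>b\<in>D. \<bar>L a b\<bar>)"
  have CR: "C a \<le> R" if "a \<in> D" for a
  proof -
    have "\<bar>C a\<bar> \<le> (\<Sum>a\<in>D. \<bar>C a\<bar>)" using D(2) that by (intro member_le_sum) auto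
    moreover have "0 \<le> (\<Sum>a\<in>D. \<Sum>b\<in>D. \<bar>L a b\<bar>)" by (intro sum_nonneg) auto
    ultimately show ?thesis unfolding R_def by linarith
  qed
  have LR: "L a b \<le> R" if "a \<in> D" "b \<in> D" for a b
  proof -
    have "\<bar>L a b\<bar> \<le> (\<Sum>b\<in>D. \<bar>L a b\<bar>)" using D(2) that by (intro member_le_sum) auto
    also have "\<dots> \<le> (\<Sum>a\<in>D. \<Sum>b\<in>D. \<bar>L a b\<bar>)"
      using D(2) that by (intro member_le_sum[of a D "\<lambda>a. \<Sum>b\<in>D. \<bar>L a b\<bar>"]) (auto intro: sum_nonneg)
    finally have "\<bar>L a b\<bar> \<le> (\<Sum>a\<in>D. \<Sum>b\<in>D. \<bar>L a b\<bar>)" .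
    moreover have "0 \<le> (\<Sum>a\<in>D. \<bar>C a\<bar>)" by (intro sum_nonneg) auto
    ultimately show ?thesis unfolding R_def by linarith
  qed
  have "joined (2 * max (2 * max R R) R) p q" if p: "p \<in> S" and q: "q \<in> S" for p q
  proof -
    obtain a where a: "a \<in> D" "p \<in> B a" using D(3) p by blast
    obtain b where b: "b \<in> D" "q \<in> B b" using D(3) q by blast
    have "joined R p a" by (rule mono[OF BC(3)[OF a(2) BC(2)] CR[OF a(1)]])
    moreover have "joined R a b" using a b D(1) by (intro mono[OF L LR]) auto
    moreover have "joined R b q" by (rule mono[OF BC(3)[OF BC(2) b(2)] CR[OF b(1)]])
    ultimately show ?thesis by (rule joined_trans[OF joined_trans])
  qed
  then show ?thesis by blast
qed

lemma riemannian_unbounded_not_relatively_compact: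
  assumes "riemannian_unbounded \<A> x E" "connected E"
  shows "\<not> compact (closure E)"
proof
  assume "compact (closure E)"
  then obtain C where C: "\<And>p q. p \<in> closure E \<Longrightarrow> q \<in> closure E \<Longrightarrow> joined C p q"
    using bounded_intrinsic_diameter[OF connected_imp_connected_closure[OF assms(2)]] by blast
  obtain p q where pq: "p \<in> E" "q \<in> E" "riemannian_dist \<A> x p q > ennreal C"
    using assms(1) unfolding riemannian_unbounded_def by blast
  have "riemannian_dist \<A> x p q \<le> ennreal C"
    using pq(1,2) closure_subset by (intro riemannian_dist_le C) blast+
  then show False using pq(3) by (simp add: not_le[symmetric])
qed

section \<open>The components of the complement of a compact set\<close>

lemma connected_neighbourhood:
  fixes p :: 'a
  assumes "open W" "p \<in> W"
  shows "\<exists>T. open T \<and> p \<in> T \<and> connected T \<and> T \<subseteq> W"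
proof -
  obtain c where c: "c \<in> \<A>" "p \<in> fst c" by (rule chart_exists)
  have "open (snd c ` (W \<inter> fst c))"
    using assms by (intro open_image[OF c(1)] open_Int open_domain[OF c(1)]) auto
  moreover have "snd c p \<in> snd c ` (W \<inter> fst c)" using assms c by blast
  ultimately obtain r where r: "0 < r" "ball (snd c p) r \<subseteq> snd c ` (W \<inter> fst c)"
    using open_contains_ball by metis
  have sub: "ball (snd c p) r \<subseteq> chart_image c" using r(2) by (rule subset_trans) blast
  let ?T = "chart_param c ` ball (snd c p) r"
  have "open ?T" by (rule open_param_image[OF c(1) open_ball sub])
  moreover have "p \<in> ?T" using c r(1) by (intro image_eqI[of _ _ "snd c p"]) simp_all
  moreover have "connected ?T"
    by (rule connected_continuous_image[OF continuous_on_subset[OF continuous_chart_param[OF c(1)] sub] connected_ball])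
  moreover have "?T \<subseteq> W"
  proof (rule image_subsetI)
    fix u assume "u \<in> ball (snd c p) r"
    then obtain q where "q \<in> W \<inter> fst c" "u = snd c q" using r(2) by blast
    then show "chart_param c u \<in> W" using c(1) by simp
  qed
  ultimately show ?thesis by blast
qed

lemma
  fixes W :: "'a set"
  assumes W: "open W" and E: "E \<in> components W"
  shows open_component: "open E" and open_other_components: "open (W - E)"
proof -
  have sub: "E \<subseteq> W" using E by (rule in_components_subset)
  show "open E"
  proof (subst open_subopen, intro ballI)
    fix p assume p: "p \<in> E"
    then obtain T where T: "open T" "p \<in> T" "connected T" "T \<subseteq> W"
      using connected_neighbourhood[OF W] sub by blast
    then have "T \<subseteq> E" using p by (intro components_maximal[OF E]) auto
    then show "\<exists>T. open T \<and> p \<in> T \<and> T \<subseteq> E" using T by blast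
  qed
  show "open (W - E)"
  proof (subst open_subopen, intro ballI)
    fix p assume p: "p \<in> W - E"
    then obtain T where T: "open T" "p \<in> T" "connected T" "T \<subseteq> W"
      using connected_neighbourhood[OF W] by blast
    have "E \<inter> T = {}"
    proof (rule ccontr)
      assume "E \<inter> T \<noteq> {}"
      then have "T \<subseteq> E" using T by (intro components_maximal[OF E]) auto
      then show False using p T(2) by blast
    qed
    then have "T \<subseteq> W - E" using T(4) by blast
    then show "\<exists>T. open T \<and> p \<in> T \<and> T \<subseteq> W - E" using T by blast
  qed
qed

end

theorem (in self_expanding_hypersurface) end_infinite_weighted_volume:
  assumes proper: "compact_preimages x" and E: "is_end \<A> x K E"
  shows "(\<integral>\<^sup>+p\<in>E. ennreal (exp (radial p)) \<partial>vol) = \<infinity>"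
proof (rule infinite_weighted_volume[OF proper])
  have K: "compact K" and comp: "E \<in> components (- K)" and unb: "riemannian_unbounded \<A> x E"
    using E by (simp_all add: is_end_def)
  have op: "open (- K)" using K by (simp add: compact_imp_closed open_Compl)
  show "compact K" by (rule K)
  show "open E" "open (- K - E)" by (rule open_component[OF op comp], rule open_other_components[OF op comp])
  show "E \<inter> K = {}" using in_components_subset[OF comp] by blast
  fix R
  show "\<exists>p\<in>E. R < radial p"
  proof (rule ccontr)
    assume "\<not> ?thesis"
    then have "E \<subseteq> {p. radial p \<le> R}" by (auto simp: not_less)
    then have "closure E \<subseteq> {p. radial p \<le> R}"
      by (rule closure_minimal) (rule compact_imp_closed[OF compact_radial_le[OF proper]])
    then have "closure E = {p. radial p \<le> R} \<inter> closure E" by blast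
    moreover have "compact ({p. radial p \<le> R} \<inter> closure E)"
      by (rule compact_Int_closed[OF compact_radial_le[OF proper] closed_closure])
    ultimately have "compact (closure E)" by simp
    then show False
      using riemannian_unbounded_not_relatively_compact[OF unb in_components_connected[OF comp]] by blast
  qed
qed

theorem theorem1p4:
  fixes \<A> :: "('a::{t2_space, second_countable_topology}, 'm::finite) chart set"
    and x :: "'a \<Rightarrow> real^'n::finite"
    and f :: "'a \<Rightarrow> real"
  assumes "CARD('m) \<ge> 2"
    and "self_expander \<A> x"
    and "f = (\<lambda>p. - (norm (x p))\<^sup>2 / 2)"
  shows "(\<forall>\<nu> \<phi>. unit_normal \<A> x \<nu> \<longrightarrow> test_function \<A> \<phi> \<longrightarrow>
            real CARD('m) * (\<integral>p. (\<phi> p)\<^sup>2 * exp (- f p) \<partial>riemannian_measure \<A> x)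
              \<le> (\<integral>p. (real CARD('m) + (scalar_mean_curvature \<A> x \<nu> p)\<^sup>2) * (\<phi> p)\<^sup>2 * exp (- f p)
                    \<partial>riemannian_measure \<A> x) \<and>
            (\<integral>p. (real CARD('m) + (scalar_mean_curvature \<A> x \<nu> p)\<^sup>2) * (\<phi> p)\<^sup>2 * exp (- f p)
                    \<partial>riemannian_measure \<A> x)
              \<le> (\<integral>p. (norm (gradient \<A> x \<phi> p))\<^sup>2 * exp (- f p) \<partial>riemannian_measure \<A> x)) \<and>
         (compact_preimages x \<longrightarrow> (\<forall>K E. is_end \<A> x K E \<longrightarrow> f_volume \<A> x f E = \<infinity>))"
proof -
  interpret self_expanding_hypersurface \<A> x
    using assms(2) by unfold_locales (auto simp: self_expander_def)
  have f: "- f p = radial p" for p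
    by (simp add: assms(3) radial_def)
  show ?thesis
    unfolding f f_volume_def
    using weighted_poincare_inequality end_infinite_weighted_volume
    by (auto simp: scalar_mean_curvature_power2)
qed

end
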